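(* Let $t_0<t_1$, let $c_1,c_2,c_s,y_s>0$ satisfy $\frac{y_s^2}{c_1y_s+c_2}<1$, and let $w\in\left(\frac{y_s^2}{c_1y_s+c_2},1\right)$. Let $N\geq1$ be an integer, let $(x_1^{k0},x_2^{k0})\in[0,1]\times[0,y_s]$ and $x_3^{k0}>0$ for $k=1,\dots,N$. Let $u_*\in L^\infty((t_0,t_1);[w,1])$ be an optimal control for the problem of minimizing $J$ over $L^\infty((t_0,t_1);[w,1])$, and let $x_*^k=(x_{*1}^k,x_{*2}^k,x_{*3}^k)\in (W^{1,\infty}(t_0,t_1))^3$, $k=1,\dots,N$, be the corresponding trajectories. For each $k$, if $y_s\in\{x_{*2}^k(t):t\in[t_0,t_1]\}$ let $\hat t_k\in[t_0,t_1]$ be the unique time with $x_{*2}^k(\hat t_k)=y_s$; otherwise let $\hat t_k:=t_1+1$. Then there exist $N$ vector functions $\psi^k=(\psi_1^k,\psi_2^k,\psi_3^k)\in\left(W^{1,\infty}(((t_0,\hat t_k)\cup(\hat t_k,t_1))\cap(t_0,t_1))\right)^3$, $k=1,\dots,N$, such that, a.e. in $((t_0,\hat t_k)\cup(\hat t_k,t_1))\cap(t_0,t_1)$, $$\dot\psi_1^k=0,$$ $$\dot\psi_2^k=-(a'(x_{*2}^k)+b'(x_{*2}^k)u_* )\psi_2^k-(a'(x_{*2}^k)+b'(x_{*2}^k)u_* )x_{*3}^k-c(x_{*2}^k)x_{*3}^k,$$ $$\dot\psi_3^k=-c(x_{*2}^k)\psi_3^k-(a(x_{*2}^k)+b(x_{*2}^k)u_*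 )-c(x_{*2}^k)x_{*2}^k,$$ with $\psi_1^k(t_1)=\psi_3^k(t_1)=0$ and the following conditions: - if $t_0<\hat t_k<t_1$: $\psi_1^k(\hat t_k-0)=\psi_1^k(\hat t_k+0)$, $\psi_3^k(\hat t_k-0)=\psi_3^k(\hat t_k+0)$, and $$\psi_2^k(\hat t_k+0)-\psi_2^k(\hat t_k-0)\in\left[\frac{c_s\,x_{*3}^k(\hat t_k)(y_s+\psi_3^k(\hat t_k))}{a(y_s)+b(y_s)},\ \frac{c_s\,x_{*3}^k(\hat t_k)(y_s+\psi_3^k(\hat t_k))}{a(y_s)+b(y_s)w}\right];$$ - if $\hat t_k<t_1$: $\psi_2^k(t_1)=0$; - if $\hat t_k=t_1$: $$-\psi_2^k(t_1)\in\left[0,\ \frac{c_s\,x_{*3}^k(t_1)\,y_s}{a(y_s)+b(y_s)w}\right].$$ Moreover, there exists a constant $h$ such that, writing $x_*=(x_*^1,\dots,x_*^N)$ and $\psi=(\psi^1,\dots,\psi^N)$, $$\mathcal H(x_*(t),u_*(t),\psi(t))=H(x_*(t),\psi(t))=h\quad\text{for a.e. }t\in(t_0,t_1).$$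
   Context: Functions: $a(y):=-y^2$, $b(y):=c_1y+c_2$, and $c(y):=c_s$ if $y\in[0,y_s)$, $c(y):=0$ if $y\in[y_s,\infty)$. The condition on $w$ implies $a(y)+b(y)u>0$ for all $y\in[0,y_s]$, $u\in[w,1]$, so each trajectory takes the value $y_s$ in its second component at most once. Controls: $L^\infty((t_0,t_1);[w,1])$ is the set of (classes of) measurable functions $u:(t_0,t_1)\to[w,1]$. Dynamics: for such $u$ and $k=1,\dots,N$, the corresponding trajectory $x^k=(x^k_1,x^k_2,x^k_3)$ is the (Carathéodory) solution on $[t_0,t_1]$ of $$\dot x_1^k=1,\quad \dot x_2^k=a(x_2^k)+b(x_2^k)u,\quad \dot x_3^k=c(x_2^k)x_3^k,\qquad x^k(t_0)=(x_1^{k0},x_2^{k0},x_3^{k0}).$$ Cost: $J(u):=-\sum_{k=1}^Nx_2^k(t_1)\,x_3^k(t_1)$. An optimal control is a minimizer of $J$ over $L^\infty((t_0,t_1);[w,1])$. Hamiltonian: for $x=(x^1,\dots,x^N)\in(\mathbb{R}^3)^N$, $u\in\mathbb{R}$, $\psi=(\psi^1,\dots,\psi^N)\in(\mathbb{R}^3)^N$, $$\mathcal H(x,u,\psi):=\sum_{k=1}^N\langle f(x^k,u),\psi^k\rangle-\sum_{k=1}^Nf^0(x^k,u),$$ where $f(x^k,u)=(1,\ a(x_2^k)+b(x_2^k)u,\ c(x_2^k)x_3^k)$ and $f^0(x^k,u)=-(a(x_2^k)+b(x_2^k)u+c(x_2^k)x_2^k)x_3^k$, and $$H(x,\psi):=\max_{u\in[w,1]}\mathcal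 H(x,u,\psi).$$ Notation: $g(t\pm0)$ are the right/left limits of $g$ at $t$; $\psi^k(t_1)$ denotes the left limit at $t_1$; $\psi_3^k(\hat t_k)$ denotes the common value of the one-sided limits at $\hat t_k$. *)

theory Defs
  imports "HOL-Analysis.Analysis"
begin

section \<open>Sobolev spaces \<open>W\<^sup>1\<^sup>,\<^sup>\<infinity>\<close> on open subsets of the line\<close>

definition test_function :: "real set \<Rightarrow> (real \<Rightarrow> real) \<Rightarrow> bool" where
  "test_function S \<phi> \<longleftrightarrow>
     (\<forall>n t. (deriv ^^ n) \<phi> differentiable (at t)) \<and>
     compact (closure {t. \<phi> t \<noteq> 0}) \<and> closure {t. \<phi> t \<noteq> 0} \<subseteq> S"

definition L_infinity :: "real set \<Rightarrow> (real \<Rightarrow> real) \<Rightarrow> bool" where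
  "L_infinity S g \<longleftrightarrow>
     g \<in> borel_measurable (lebesgue_on S) \<and> (\<exists>B. AE t in lebesgue_on S. \<bar>g t\<bar> \<le> B)"

definition weak_derivative_on :: "real set \<Rightarrow> (real \<Rightarrow> real) \<Rightarrow> (real \<Rightarrow> real) \<Rightarrow> bool" where
  "weak_derivative_on S g v \<longleftrightarrow>
     (\<forall>K. compact K \<and> K \<subseteq> S \<longrightarrow>
        integrable (lebesgue_on K) g \<and> integrable (lebesgue_on K) v) \<and>
     (\<forall>\<phi>. test_function S \<phi> \<longrightarrow>
        (LINT t|lebesgue_on S. g t * deriv \<phi> t) = - (LINT t|lebesgue_on S. v t * \<phi> t))"

definition W1_infinity :: "real set \<Rightarrow> (real \<Rightarrow> real) \<Rightarrow> bool" where
  "W1_infinity S g \<longleftrightarrow> L_infinity S g \<and> (\<exists>v. L_infinity S v \<and> weak_derivative_on S g v)"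

section \<open>The control problem\<close>

definition a_fun :: "real \<Rightarrow> real" where
  "a_fun y = - (y\<^sup>2)"

definition b_fun :: "real \<Rightarrow> real \<Rightarrow> real \<Rightarrow> real" where
  "b_fun c1 c2 y = c1 * y + c2"

(* The paper defines c on [0,\<infinity>) only; the value 0 for y < 0 is an arbitrary totalisation,
   never used because the second components of trajectories stay nonnegative. *)
definition c_fun :: "real \<Rightarrow> real \<Rightarrow> real \<Rightarrow> real" where
  "c_fun cs ys y = (if y \<in> {0..<ys} then cs else 0)"

(* Representatives of classes in L^\<infinity>((t0,t1);[w,1]), hence the bound only a.e. *)
definition controls :: "real \<Rightarrow> real \<Rightarrow> real \<Rightarrow> (real \<Rightarrow> real) set" where
  "controls t0 t1 w =
     {u. u \<in> borel_measurable (lebesgue_on {t0<..<t1}) \<and>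
         (AE t in lebesgue_on {t0<..<t1}. u t \<in> {w..1})}"

definition f_dyn :: "real \<Rightarrow> real \<Rightarrow> real \<Rightarrow> real \<Rightarrow> real^3 \<Rightarrow> real \<Rightarrow> real^3" where
  "f_dyn c1 c2 cs ys x u =
     vector [1, a_fun (x$2) + b_fun c1 c2 (x$2) * u, c_fun cs ys (x$2) * x$3]"

definition f0_dyn :: "real \<Rightarrow> real \<Rightarrow> real \<Rightarrow> real \<Rightarrow> real^3 \<Rightarrow> real \<Rightarrow> real" where
  "f0_dyn c1 c2 cs ys x u =
     - ((a_fun (x$2) + b_fun c1 c2 (x$2) * u + c_fun cs ys (x$2) * x$2) * x$3)"

(* Caratheodory solution on [t0,t1], in integral form. *)
definition trajectory ::
  "real \<Rightarrow> real \<Rightarrow> real \<Rightarrow> real \<Rightarrow> real \<Rightarrow> real \<Rightarrow> real^3 \<Rightarrow> (real \<Rightarrow> real) \<Rightarrow> (real \<Rightarrow> real^3) \<Rightarrow> bool"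
  where
  "trajectory t0 t1 c1 c2 cs ys x0 u x \<longleftrightarrow>
     (\<lambda>s. f_dyn c1 c2 cs ys (x s) (u s)) absolutely_integrable_on {t0..t1} \<and>
     (\<forall>t\<in>{t0..t1}. x t = x0 + integral {t0..t} (\<lambda>s. f_dyn c1 c2 cs ys (x s) (u s)))"

(* A trajectory is determined on [t0,t1] but arbitrary outside, hence SOME rather than THE. *)
definition traj_of ::
  "real \<Rightarrow> real \<Rightarrow> real \<Rightarrow> real \<Rightarrow> real \<Rightarrow> real \<Rightarrow> real^3 \<Rightarrow> (real \<Rightarrow> real) \<Rightarrow> real \<Rightarrow> real^3" where
  "traj_of t0 t1 c1 c2 cs ys x0 u = (SOME x. trajectory t0 t1 c1 c2 cs ys x0 u x)"

definition J_cost ::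
  "real \<Rightarrow> real \<Rightarrow> real \<Rightarrow> real \<Rightarrow> real \<Rightarrow> real \<Rightarrow> nat \<Rightarrow> (nat \<Rightarrow> real^3) \<Rightarrow> (real \<Rightarrow> real) \<Rightarrow> real"
  where
  "J_cost t0 t1 c1 c2 cs ys N x0 u =
     - (\<Sum>k=1..N. traj_of t0 t1 c1 c2 cs ys (x0 k) u t1 $ 2 *
                  traj_of t0 t1 c1 c2 cs ys (x0 k) u t1 $ 3)"

definition optimal_control ::
  "real \<Rightarrow> real \<Rightarrow> real \<Rightarrow> real \<Rightarrow> real \<Rightarrow> real \<Rightarrow> real \<Rightarrow> nat \<Rightarrow> (nat \<Rightarrow> real^3) \<Rightarrow> (real \<Rightarrow> real) \<Rightarrow> bool"
  where
  "optimal_control t0 t1 c1 c2 cs ys w N x0 u \<longleftrightarrow>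
     u \<in> controls t0 t1 w \<and>
     (\<forall>v\<in>controls t0 t1 w.
        J_cost t0 t1 c1 c2 cs ys N x0 u \<le> J_cost t0 t1 c1 c2 cs ys N x0 v)"

definition hamiltonian ::
  "real \<Rightarrow> real \<Rightarrow> real \<Rightarrow> real \<Rightarrow> nat \<Rightarrow> (nat \<Rightarrow> real^3) \<Rightarrow> real \<Rightarrow> (nat \<Rightarrow> real^3) \<Rightarrow> real" where
  "hamiltonian c1 c2 cs ys N x u \<psi> =
     (\<Sum>k=1..N. f_dyn c1 c2 cs ys (x k) u \<bullet> \<psi> k) - (\<Sum>k=1..N. f0_dyn c1 c2 cs ys (x k) u)"

(* The supremum is a maximum: the Hamiltonian is affine in u and [w,1] is compact. *)
definition max_hamiltonian ::
  "real \<Rightarrow> real \<Rightarrow> real \<Rightarrow> real \<Rightarrow> real \<Rightarrow> nat \<Rightarrow> (nat \<Rightarrow> real^3) \<Rightarrow> (nat \<Rightarrow> real^3) \<Rightarrow> real" where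
  "max_hamiltonian c1 c2 cs ys w N x \<psi> = (SUP u\<in>{w..1}. hamiltonian c1 c2 cs ys N x u \<psi>)"

definition crossing_time :: "real \<Rightarrow> real \<Rightarrow> real \<Rightarrow> (real \<Rightarrow> real) \<Rightarrow> real" where
  "crossing_time t0 t1 ys y =
     (if \<exists>t\<in>{t0..t1}. y t = ys then (THE t. t \<in> {t0..t1} \<and> y t = ys) else t1 + 1)"

definition crossing_free :: "real \<Rightarrow> real \<Rightarrow> real \<Rightarrow> real set" where
  "crossing_free t0 t1 that = ({t0<..<that} \<union> {that<..<t1}) \<inter> {t0<..<t1}"

end

theory Submission
  imports Defs
begin

text \<open>
  In the coordinates \<open>p = \<psi>\<^sub>2 + x\<^sub>3\<close> and \<open>q = \<psi>\<^sub>3 + x\<^sub>2\<close> the adjoint system is homogeneous and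
  \<open>q x\<^sub>3\<close> is a constant \<open>Q\<close>, so everything reduces to finding the jumps of \<open>p\<close>. A trajectory meets
  the final cost through \<open>x\<^sub>2(t\<^sub>1)\<close> and its crossing time only. The optimal control is perturbed by a
  bounded change \<open>\<rho>\<close> of its values together with a change of clock with speed \<open>1 + \<epsilon> g\<close>. Seen from the new
  clock, a crossing displaced by \<open>\<epsilon> \<delta>\<close> is advanced by at most \<open>\<epsilon> \<delta> / (a + b w)\<close> if \<open>\<delta> > 0\<close>, and delayed by at
  least \<open>\<epsilon> \<bar>\<delta>\<bar> / (a + b)\<close> if \<open>\<delta> < 0\<close>, however irregular the control is there. Optimality thus bounds a linear
  functional of \<open>(g, \<rho>)\<close> by a sum of terms \<open>max (lo \<delta>) (hi \<delta>)\<close>. On the convex cone of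
  variations a minimax argument replaces each maximum by one linear functional \<open>\<eta> \<delta>\<close> with
  \<open>\<eta> \<in> [lo, hi]\<close>; these \<open>\<eta>\<close> are the jumps. Varying \<open>\<rho>\<close> then gives the maximum condition, and varying \<open>g\<close> among the
  functions of mean zero gives that the Hamiltonian is constant, also across the crossings.
\<close>


section \<open>Primitives of bounded measurable functions\<close>

definition bdd_meas :: "real \<Rightarrow> real \<Rightarrow> (real \<Rightarrow> real) \<Rightarrow> bool" where
  "bdd_meas a b f \<longleftrightarrow>
     f \<in> borel_measurable (lebesgue_on {a..b}) \<and> (\<exists>B. \<forall>t\<in>{a..b}. \<bar>f t\<bar> \<le> B)"

lemma bdd_measI:
  assumes "f \<in> borel_measurable (lebesgue_on {a..b})" "\<And>t. t \<in> {a..b} \<Longrightarrow> \<bar>f t\<bar> \<le> B"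
  shows "bdd_meas a b f"
  using assms unfolding bdd_meas_def by blast

lemma bdd_meas_bound:
  assumes "bdd_meas a b f"
  obtains B where "B > 0" "\<And>t. t \<in> {a..b} \<Longrightarrow> \<bar>f t\<bar> \<le> B"
proof -
  obtain B where "\<forall>t\<in>{a..b}. \<bar>f t\<bar> \<le> B" using assms unfolding bdd_meas_def by blast
  then have "\<And>t. t \<in> {a..b} \<Longrightarrow> \<bar>f t\<bar> \<le> max B 1" by fastforce
  then show thesis using that[of "max B 1"] by auto
qed

lemma bdd_meas_const [simp]: "bdd_meas a b (\<lambda>_. c)"
  by (rule bdd_measI[of _ _ _ "\<bar>c\<bar>"]) auto

lemma bdd_meas_add [intro]:
  assumes "bdd_meas a b f" "bdd_meas a b g"
  shows "bdd_meas a b (\<lambda>t. f t + g t)"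
proof -
  obtain B C where "\<And>t. t \<in> {a..b} \<Longrightarrow> \<bar>f t\<bar> \<le> B" "\<And>t. t \<in> {a..b} \<Longrightarrow> \<bar>g t\<bar> \<le> C"
    using assms bdd_meas_bound by metis
  then have "\<bar>f t + g t\<bar> \<le> B + C" if "t \<in> {a..b}" for t
    using that by (smt (verit))
  moreover have "(\<lambda>t. f t + g t) \<in> borel_measurable (lebesgue_on {a..b})"
    using assms unfolding bdd_meas_def by (intro borel_measurable_add) auto
  ultimately show ?thesis by (rule bdd_measI[rotated])
qed

lemma bdd_meas_mult [intro]:
  assumes "bdd_meas a b f" "bdd_meas a b g"
  shows "bdd_meas a b (\<lambda>t. f t * g t)"
proof -
  obtain B C where "B > 0" "\<And>t. t \<in> {a..b} \<Longrightarrow> \<bar>f t\<bar> \<le> B" "\<And>t. t \<in> {a..b} \<Longrightarrow> \<bar>g t\<bar> \<le> C"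
    using assms bdd_meas_bound by metis
  then have "\<bar>f t * g t\<bar> \<le> B * C" if "t \<in> {a..b}" for t
    unfolding abs_mult using that by (intro mult_mono) auto
  moreover have "(\<lambda>t. f t * g t) \<in> borel_measurable (lebesgue_on {a..b})"
    using assms unfolding bdd_meas_def by (intro borel_measurable_times) auto
  ultimately show ?thesis by (rule bdd_measI[rotated])
qed

lemma bdd_meas_uminus [intro]: "bdd_meas a b f \<Longrightarrow> bdd_meas a b (\<lambda>t. - f t)"
  using bdd_meas_mult[of a b "\<lambda>_. -1" f] by simp

lemma bdd_meas_diff [intro]:
  "bdd_meas a b f \<Longrightarrow> bdd_meas a b g \<Longrightarrow> bdd_meas a b (\<lambda>t. f t - g t)"
  using bdd_meas_add[of a b f "\<lambda>t. - g t"] by auto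

lemma bdd_meas_power [intro]: "bdd_meas a b f \<Longrightarrow> bdd_meas a b (\<lambda>t. f t ^ n)"
  by (induction n) auto

lemma bdd_meas_sum [intro]:
  assumes "\<And>k. k \<in> K \<Longrightarrow> bdd_meas a b (f k)"
  shows "bdd_meas a b (\<lambda>t. \<Sum>k\<in>K. f k t)"
  using assms by (induction K rule: infinite_finite_induct) auto

lemma bdd_meas_continuous: "continuous_on {a..b} f \<Longrightarrow> bdd_meas a b f"
proof -
  assume c: "continuous_on {a..b} f"
  then have "bounded (f ` {a..b})" by (simp add: compact_continuous_image compact_imp_bounded)
  then obtain B where "\<forall>t\<in>{a..b}. \<bar>f t\<bar> \<le> B" unfolding bounded_iff by auto
  then show ?thesis
    using continuous_imp_measurable_on_sets_lebesgue[OF c] unfolding bdd_meas_def by auto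
qed

lemma bdd_meas_if:
  assumes "bdd_meas a b f" "bdd_meas a b g" "{t \<in> {a..b}. P t} \<in> sets (lebesgue_on {a..b})"
  shows "bdd_meas a b (\<lambda>t. if P t then f t else g t)"
proof -
  obtain B C where "\<And>t. t \<in> {a..b} \<Longrightarrow> \<bar>f t\<bar> \<le> B" "\<And>t. t \<in> {a..b} \<Longrightarrow> \<bar>g t\<bar> \<le> C"
    using assms bdd_meas_bound by metis
  then have "\<bar>if P t then f t else g t\<bar> \<le> max B C" if "t \<in> {a..b}" for t
    using that by (smt (verit))
  moreover have "(\<lambda>t. if P t then f t else g t) \<in> borel_measurable (lebesgue_on {a..b})"
    using assms unfolding bdd_meas_def by (intro measurable_If) auto
  ultimately show ?thesis by (rule bdd_measI[rotated])
qed

lemma bdd_meas_if_less: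
  assumes "bdd_meas a b f" "bdd_meas a b g" "bdd_meas a b h"
  shows "bdd_meas a b (\<lambda>t. if h t < c then f t else g t)"
proof (rule bdd_meas_if[OF assms(1,2)])
  have "h -` {..<c} \<inter> space (lebesgue_on {a..b}) \<in> sets (lebesgue_on {a..b})"
    using assms(3) unfolding bdd_meas_def by (intro measurable_sets[of _ _ borel]) auto
  moreover have "h -` {..<c} \<inter> space (lebesgue_on {a..b}) = {t \<in> {a..b}. h t < c}" by auto
  ultimately show "{t \<in> {a..b}. h t < c} \<in> sets (lebesgue_on {a..b})" by simp
qed

lemma bdd_meas_subset:
  assumes "bdd_meas a b f" "a \<le> c" "d \<le> b"
  shows "bdd_meas c d f"
proof -
  have "f \<in> borel_measurable (lebesgue_on {c..d})"
    by (rule measurable_restrict_mono[of f lebesgue "{a..b}"]) (use assms in \<open>auto simp: bdd_meas_def\<close>)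
  moreover obtain B where "\<And>t. t \<in> {a..b} \<Longrightarrow> \<bar>f t\<bar> \<le> B" using assms bdd_meas_bound by metis
  ultimately show ?thesis using assms(2,3) by (intro bdd_measI[of _ _ _ B]) auto
qed

lemma bdd_meas_cong:
  assumes "bdd_meas a b f" "\<And>t. t \<in> {a..b} \<Longrightarrow> f t = g t"
  shows "bdd_meas a b g"
proof -
  obtain B where B: "\<And>t. t \<in> {a..b} \<Longrightarrow> \<bar>f t\<bar> \<le> B" using assms bdd_meas_bound by metis
  have "g \<in> borel_measurable (lebesgue_on {a..b}) \<longleftrightarrow> f \<in> borel_measurable (lebesgue_on {a..b})"
    using assms(2) by (intro measurable_cong) auto
  then show ?thesis using assms B unfolding bdd_meas_def by (metis)
qed

lemma bdd_meas_abs_integrable: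
  assumes "bdd_meas a b f" shows "f absolutely_integrable_on {a..b}"
proof -
  obtain B where B: "\<And>t. t \<in> {a..b} \<Longrightarrow> \<bar>f t\<bar> \<le> B" using assms bdd_meas_bound by metis
  show ?thesis
    by (rule measurable_bounded_by_integrable_imp_absolutely_integrable[of _ _ "\<lambda>_. B"])
      (use assms B in \<open>auto simp: bdd_meas_def\<close>)
qed

lemma bdd_meas_integrable_on:
  assumes "bdd_meas a b f" "{c..d} \<subseteq> {a..b}" shows "f integrable_on {c..d}"
  using bdd_meas_abs_integrable[OF assms(1)] assms(2)
  by (meson integrable_on_subinterval set_lebesgue_integral_eq_integral(1))

lemma bdd_meas_integral_bound:
  assumes "bdd_meas a b f" "\<And>t. t \<in> {a..b} \<Longrightarrow> \<bar>f t\<bar> \<le> B" "a \<le> s" "s \<le> t" "t \<le> b"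
  shows "\<bar>integral {s..t} f\<bar> \<le> B * (t - s)"
proof -
  have "norm (integral {s..t} f) \<le> integral {s..t} (\<lambda>_. B)"
    using assms by (intro integral_norm_bound_integral bdd_meas_integrable_on) auto
  then show ?thesis using assms by (simp add: mult.commute)
qed

lemma bdd_meas_integral_combine:
  assumes "bdd_meas a b f" "a \<le> s" "s \<le> t" "t \<le> b"
  shows "integral {a..t} f - integral {a..s} f = integral {s..t} f"
proof -
  have "f integrable_on {a..t}" using assms by (intro bdd_meas_integrable_on) auto
  then show ?thesis using Henstock_Kurzweil_Integration.integral_combine[OF assms(2,3)] assms by fastforce
qed

lemmas bdd_meas_intros = bdd_meas_const bdd_meas_add bdd_meas_diff bdd_meas_mult bdd_meas_uminus
  bdd_meas_power bdd_meas_sum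

definition primitive :: "real \<Rightarrow> real \<Rightarrow> (real \<Rightarrow> real) \<Rightarrow> (real \<Rightarrow> real) \<Rightarrow> bool" where
  "primitive a b F f \<longleftrightarrow> bdd_meas a b f \<and> (\<forall>t\<in>{a..b}. F t = F a + integral {a..t} f)"

lemma primitive_bdd_meas: "primitive a b F f \<Longrightarrow> bdd_meas a b f"
  by (simp add: primitive_def)

lemma primitive_eq: "primitive a b F f \<Longrightarrow> t \<in> {a..b} \<Longrightarrow> F t = F a + integral {a..t} f"
  unfolding primitive_def by blast

lemma primitive_diff_eq:
  assumes "primitive a b F f" "a \<le> s" "s \<le> t" "t \<le> b"
  shows "F t - F s = integral {s..t} f"
proof -
  have "F t = F a + integral {a..t} f" "F s = F a + integral {a..s} f"
    using assms by (auto intro!: primitive_eq)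
  then show ?thesis
    using bdd_meas_integral_combine[OF primitive_bdd_meas[OF assms(1)] assms(2-4)] by simp
qed

lemma primitive_lipschitz:
  assumes "primitive a b F f" "\<And>t. t \<in> {a..b} \<Longrightarrow> \<bar>f t\<bar> \<le> B" "s \<in> {a..b}" "t \<in> {a..b}"
  shows "\<bar>F t - F s\<bar> \<le> B * \<bar>t - s\<bar>"
proof -
  have *: "\<bar>F t - F s\<bar> \<le> B * (t - s)" if "a \<le> s" "s \<le> t" "t \<le> b" for s t
    using primitive_diff_eq[OF assms(1) that]
      bdd_meas_integral_bound[OF primitive_bdd_meas[OF assms(1)] assms(2) that] by simp
  show ?thesis using *[of s t] *[of t s] assms(3,4) by (cases "s \<le> t") auto
qed

lemma primitive_continuous:
  assumes "primitive a b F f" shows "continuous_on {a..b} F"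
proof -
  obtain B where "B > 0" "\<And>t. t \<in> {a..b} \<Longrightarrow> \<bar>f t\<bar> \<le> B"
    by (rule bdd_meas_bound[OF primitive_bdd_meas[OF assms]]) blast
  then have "B-lipschitz_on {a..b} F"
    by (intro lipschitz_onI) (auto simp: dist_real_def intro!: primitive_lipschitz[OF assms])
  then show ?thesis by (rule lipschitz_on_continuous_on)
qed

lemma primitive_bdd_meas': "primitive a b F f \<Longrightarrow> bdd_meas a b F"
  by (simp add: bdd_meas_continuous primitive_continuous)

lemma primitive_integral:
  assumes "bdd_meas a b f" shows "primitive a b (\<lambda>t. C + integral {a..t} f) f"
  using assms unfolding primitive_def by simp

lemma primitive_cong:
  assumes "primitive a b F f" "\<And>t. t \<in> {a..b} \<Longrightarrow> F t = G t" "\<And>t. t \<in> {a..b} \<Longrightarrow> f t = g t"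
  shows "primitive a b G g"
  unfolding primitive_def
proof (intro conjI ballI)
  show "bdd_meas a b g" using bdd_meas_cong[OF primitive_bdd_meas] assms by blast
  fix t assume t: "t \<in> {a..b}"
  have "integral {a..t} f = integral {a..t} g"
    using t assms(3) by (intro integral_cong) auto
  then show "G t = G a + integral {a..t} g"
    using primitive_eq[OF assms(1) t] assms(2)[OF t] assms(2)[of a] t by simp
qed

lemma primitive_subset:
  assumes "primitive a b F f" "a \<le> c" "d \<le> b"
  shows "primitive c d F f"
  unfolding primitive_def
proof (intro conjI ballI)
  show "bdd_meas c d f" using assms bdd_meas_subset primitive_bdd_meas by blast
  fix t assume "t \<in> {c..d}"
  then show "F t = F c + integral {c..t} f"
    using primitive_diff_eq[OF assms(1), of c t] assms by simp
qed

text \<open>Since only bounded integrands occur, an identity between such primitives follows once its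
  defect is quadratically small on short intervals. This replaces the calculus of absolutely
  continuous functions.\<close>

lemma quadratic_increment_constant:
  fixes \<Phi> :: "real \<Rightarrow> real"
  assumes "\<And>s t. a \<le> s \<Longrightarrow> s \<le> t \<Longrightarrow> t \<le> b \<Longrightarrow> \<bar>\<Phi> t - \<Phi> s\<bar> \<le> C * (t - s)\<^sup>2"
    and "t \<in> {a..b}"
  shows "\<Phi> t = \<Phi> a"
proof -
  have C: "\<bar>\<Phi> y - \<Phi> x\<bar> \<le> \<bar>C\<bar> * (y - x)\<^sup>2" if "x \<in> {a..b}" "y \<in> {a..b}" for x y
  proof -
    have "C * (y - x)\<^sup>2 \<le> \<bar>C\<bar> * (y - x)\<^sup>2" "C * (x - y)\<^sup>2 \<le> \<bar>C\<bar> * (y - x)\<^sup>2"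
      by (auto simp: power2_commute intro: mult_right_mono)
    then show ?thesis
      using assms(1)[of x y] assms(1)[of y x] that by (cases "x \<le> y") auto
  qed
  have "(\<Phi> has_field_derivative 0) (at x within {a..b})" if x: "x \<in> {a..b}" for x
    unfolding has_field_derivative_iff
  proof (rule Lim_null_comparison)
    have "norm ((\<Phi> y - \<Phi> x) / (y - x)) \<le> \<bar>C\<bar> * \<bar>y - x\<bar>" if "y \<in> {a..b}" "y \<noteq> x" for y
      using C[OF x that(1)] that(2) by (simp add: divide_le_eq power2_eq_square abs_mult mult.assoc)
    then show "\<forall>\<^sub>F y in at x within {a..b}. norm ((\<Phi> y - \<Phi> x) / (y - x)) \<le> \<bar>C\<bar> * \<bar>y - x\<bar>"
      by (auto simp: eventually_at_filter)
    have "((\<lambda>y. \<bar>C\<bar> * \<bar>y - x\<bar>) \<longlongrightarrow> \<bar>C\<bar> * \<bar>x - x\<bar>) (at x within {a..b})"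
      by (intro tendsto_intros)
    then show "((\<lambda>y. \<bar>C\<bar> * \<bar>y - x\<bar>) \<longlongrightarrow> 0) (at x within {a..b})" by simp
  qed
  then obtain c where "\<forall>x\<in>{a..b}. \<Phi> x = c"
    using has_field_derivative_zero_constant[of "{a..b}" \<Phi>] by auto
  then show ?thesis using assms(2) by auto
qed

lemma primitiveI_quadratic:
  assumes f: "bdd_meas a b f"
    and q: "\<And>s t. a \<le> s \<Longrightarrow> s \<le> t \<Longrightarrow> t \<le> b \<Longrightarrow>
              \<bar>F t - F s - integral {s..t} f\<bar> \<le> C * (t - s)\<^sup>2"
  shows "primitive a b F f"
  unfolding primitive_def
proof (intro conjI ballI)
  fix t assume t: "t \<in> {a..b}"
  define \<Phi> where "\<Phi> = (\<lambda>t. F t - integral {a..t} f)"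
  have "\<bar>\<Phi> t - \<Phi> s\<bar> \<le> C * (t - s)\<^sup>2" if "a \<le> s" "s \<le> t" "t \<le> b" for s t
    using q[OF that] bdd_meas_integral_combine[OF f that] unfolding \<Phi>_def by (simp add: algebra_simps)
  then have "\<Phi> t = \<Phi> a" using t by (rule quadratic_increment_constant) auto
  then show "F t = F a + integral {a..t} f" unfolding \<Phi>_def by simp
qed (rule f)

lemma primitive_add:
  assumes "primitive a b F f" "primitive a b G g"
  shows "primitive a b (\<lambda>t. F t + G t) (\<lambda>t. f t + g t)"
proof (rule primitiveI_quadratic[where C=0])
  fix s t assume st: "a \<le> s" "s \<le> t" "t \<le> b"
  have "integral {s..t} (\<lambda>t. f t + g t) = integral {s..t} f + integral {s..t} g"
    using st assms by (intro integral_add bdd_meas_integrable_on[of a b]) (auto dest: primitive_bdd_meas)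
  then show "\<bar>F t + G t - (F s + G s) - integral {s..t} (\<lambda>t. f t + g t)\<bar> \<le> 0 * (t - s)\<^sup>2"
    using primitive_diff_eq[OF assms(1) st] primitive_diff_eq[OF assms(2) st] by simp
qed (use assms in \<open>auto dest: primitive_bdd_meas\<close>)

lemma primitive_cmult:
  assumes "primitive a b F f"
  shows "primitive a b (\<lambda>t. c * F t) (\<lambda>t. c * f t)"
proof (rule primitiveI_quadratic[where C=0])
  fix s t assume st: "a \<le> s" "s \<le> t" "t \<le> b"
  show "\<bar>c * F t - c * F s - integral {s..t} (\<lambda>t. c * f t)\<bar> \<le> 0 * (t - s)\<^sup>2"
    using primitive_diff_eq[OF assms(1) st] by (simp flip: right_diff_distrib)
qed (use assms in \<open>auto dest: primitive_bdd_meas\<close>)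

lemma primitive_const: "primitive a b (\<lambda>_. c) (\<lambda>_. 0)"
  unfolding primitive_def by simp

lemma primitive_diff:
  assumes "primitive a b F f" "primitive a b G g"
  shows "primitive a b (\<lambda>t. F t - G t) (\<lambda>t. f t - g t)"
  using primitive_add[OF assms(1) primitive_cmult[OF assms(2), of "-1"]] by simp

lemma primitive_mult:
  assumes "primitive a b F f" "primitive a b G g"
  shows "primitive a b (\<lambda>t. F t * G t) (\<lambda>t. f t * G t + F t * g t)"
proof -
  have m: "bdd_meas a b f" "bdd_meas a b g" "bdd_meas a b F" "bdd_meas a b G"
    using assms primitive_bdd_meas primitive_bdd_meas' by auto
  obtain A where A: "A > 0" "\<And>t. t \<in> {a..b} \<Longrightarrow> \<bar>f t\<bar> \<le> A" by (rule bdd_meas_bound[OF m(1)]) blast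
  obtain B where B: "B > 0" "\<And>t. t \<in> {a..b} \<Longrightarrow> \<bar>g t\<bar> \<le> B" by (rule bdd_meas_bound[OF m(2)]) blast
  show ?thesis
  proof (rule primitiveI_quadratic[where C="3 * A * B"])
    fix s t assume st: "a \<le> s" "s \<le> t" "t \<le> b"
    let ?h = "\<lambda>r. f r * (G r - G s) + (F r - F s) * g r"
    have *: "(\<lambda>r. ?h r) integrable_on {s..t}" "f integrable_on {s..t}" "g integrable_on {s..t}"
      using m st by (intro bdd_meas_integrable_on[of a b] bdd_meas_add bdd_meas_mult bdd_meas_diff; auto)+
    have "integral {s..t} (\<lambda>r. f r * G r + F r * g r)
        = integral {s..t} (\<lambda>r. ?h r + (f r * G s + F s * g r))"
      by (intro integral_cong) (auto simp: algebra_simps)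
    also have "\<dots> = integral {s..t} ?h + (integral {s..t} f * G s + F s * integral {s..t} g)"
      using * by (intro integral_unique has_integral_add has_integral_mult_left
          has_integral_mult_right integrable_integral)
    also have "\<dots> = integral {s..t} ?h + ((F t - F s) * G s + F s * (G t - G s))"
      by (simp add: primitive_diff_eq[OF assms(1) st] primitive_diff_eq[OF assms(2) st])
    finally have e: "F t * G t - F s * G s - integral {s..t} (\<lambda>r. f r * G r + F r * g r)
        = (F t - F s) * (G t - G s) - integral {s..t} ?h" by (simp add: algebra_simps)
    have h: "norm (?h r) \<le> 2 * A * B * (t - s)" if "r \<in> {s..t}" for r
    proof -
      have "\<bar>G r - G s\<bar> \<le> B * \<bar>r - s\<bar>" "\<bar>F r - F s\<bar> \<le> A * \<bar>r - s\<bar>"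
        using primitive_lipschitz[OF assms(2) B(2), of s r] primitive_lipschitz[OF assms(1) A(2), of s r]
          that st by auto
      moreover have "B * \<bar>r - s\<bar> \<le> B * (t - s)" "A * \<bar>r - s\<bar> \<le> A * (t - s)"
        using that A B by auto
      ultimately have "\<bar>G r - G s\<bar> \<le> B * (t - s)" "\<bar>F r - F s\<bar> \<le> A * (t - s)" by linarith+
      then have "\<bar>f r\<bar> * \<bar>G r - G s\<bar> \<le> A * (B * (t - s))" "\<bar>F r - F s\<bar> * \<bar>g r\<bar> \<le> (A * (t - s)) * B"
        using A B that st by (intro mult_mono; auto)+
      moreover have "norm (?h r) \<le> \<bar>f r\<bar> * \<bar>G r - G s\<bar> + \<bar>F r - F s\<bar> * \<bar>g r\<bar>"
        using abs_triangle_ineq[of "f r * (G r - G s)" "(F r - F s) * g r"] by (simp add: abs_mult)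
      ultimately show ?thesis by (simp add: algebra_simps)
    qed
    have "norm (integral {s..t} ?h) \<le> integral {s..t} (\<lambda>_. 2 * A * B * (t - s))"
      using * h by (intro integral_norm_bound_integral) auto
    then have i: "\<bar>integral {s..t} ?h\<bar> \<le> 2 * A * B * (t - s)\<^sup>2"
      using st by (simp add: power2_eq_square mult_ac)
    have "\<bar>F t - F s\<bar> * \<bar>G t - G s\<bar> \<le> (A * (t - s)) * (B * (t - s))"
      using primitive_lipschitz[OF assms(2) B(2), of s t] primitive_lipschitz[OF assms(1) A(2), of s t] st A
      by (intro mult_mono) auto
    then have "\<bar>(F t - F s) * (G t - G s)\<bar> \<le> A * B * (t - s)\<^sup>2"
      by (simp add: power2_eq_square abs_mult mult_ac)
    then show "\<bar>F t * G t - F s * G s - integral {s..t} (\<lambda>r. f r * G r + F r * g r)\<bar> \<le> 3 * A * B * (t - s)\<^sup>2"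
      unfolding e using i by linarith
  qed (use m in auto)
qed

lemma primitive_exp:
  assumes "primitive a b K k"
  shows "primitive a b (\<lambda>t. exp (K t)) (\<lambda>t. k t * exp (K t))"
proof -
  have m: "bdd_meas a b k" "bdd_meas a b K" "bdd_meas a b (\<lambda>t. exp (K t))"
    using assms primitive_bdd_meas primitive_bdd_meas'
    by (auto intro!: bdd_meas_continuous continuous_on_exp dest: primitive_continuous)
  obtain B where B: "B > 0" "\<And>t. t \<in> {a..b} \<Longrightarrow> \<bar>k t\<bar> \<le> B" by (rule bdd_meas_bound[OF m(1)]) blast
  obtain M where M: "M > 0" "\<And>t. t \<in> {a..b} \<Longrightarrow> \<bar>K t\<bar> \<le> M" by (rule bdd_meas_bound[OF m(2)]) blast
  have l: "\<bar>exp y - exp x\<bar> \<le> exp M * \<bar>y - x\<bar>" if "\<bar>x\<bar> \<le> M" "\<bar>y\<bar> \<le> M" for x y :: real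
  proof -
    have *: "exp y - exp x \<le> exp M * (y - x)" if "x \<le> y" "y \<le> M" for x y
    proof -
      have "1 - exp (x - y) \<le> y - x" using exp_ge_add_one_self[of "x - y"] by linarith
      then have "exp y * (1 - exp (x - y)) \<le> exp M * (y - x)"
        using that by (intro mult_mono) auto
      then show ?thesis by (simp add: right_diff_distrib exp_diff)
    qed
    show ?thesis using *[of x y] *[of y x] that by (cases "x \<le> y") auto
  qed
  have r: "\<bar>exp y - exp x - exp x * (y - x)\<bar> \<le> exp M * (y - x)\<^sup>2" if "\<bar>x\<bar> \<le> M" "\<bar>y\<bar> \<le> M" for x y
  proof -
    have "exp x * (y - x) \<le> exp y - exp x"
      using mult_left_mono[OF exp_ge_add_one_self[of "y - x"], of "exp x"] by (simp add: exp_diff algebra_simps)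
    moreover have "exp y - exp x \<le> exp y * (y - x)"
      using mult_left_mono[OF exp_ge_add_one_self[of "x - y"], of "exp y"] by (simp add: exp_diff algebra_simps)
    then have "exp y - exp x - exp x * (y - x) \<le> (exp y - exp x) * (y - x)" by (simp add: algebra_simps)
    moreover have "(exp y - exp x) * (y - x) \<le> \<bar>exp y - exp x\<bar> * \<bar>y - x\<bar>"
      by (simp flip: abs_mult)
    moreover have "\<dots> \<le> exp M * \<bar>y - x\<bar> * \<bar>y - x\<bar>"
      using l[OF that] by (intro mult_right_mono) auto
    ultimately show ?thesis by (simp add: power2_eq_square mult.assoc)
  qed
  show ?thesis
  proof (rule primitiveI_quadratic[where C="2 * exp M * B\<^sup>2"])
    fix s t assume st: "a \<le> s" "s \<le> t" "t \<le> b"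
    let ?h = "\<lambda>r. k r * (exp (K r) - exp (K s))"
    have *: "?h integrable_on {s..t}" "k integrable_on {s..t}"
      using m st by (intro bdd_meas_integrable_on[of a b] bdd_meas_add bdd_meas_mult bdd_meas_diff; auto)+
    have "integral {s..t} (\<lambda>r. k r * exp (K r)) = integral {s..t} (\<lambda>r. ?h r + exp (K s) * k r)"
      by (intro integral_cong) (auto simp: algebra_simps)
    also have "\<dots> = integral {s..t} ?h + exp (K s) * integral {s..t} k"
      using * by (intro integral_unique has_integral_add has_integral_mult_right integrable_integral)
    also have "\<dots> = integral {s..t} ?h + exp (K s) * (K t - K s)"
      by (simp add: primitive_diff_eq[OF assms(1) st])
    finally have e: "exp (K t) - exp (K s) - integral {s..t} (\<lambda>r. k r * exp (K r))
        = (exp (K t) - exp (K s) - exp (K s) * (K t - K s)) - integral {s..t} ?h" by simp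
    have h: "norm (?h r) \<le> exp M * B\<^sup>2 * (t - s)" if "r \<in> {s..t}" for r
    proof -
      have "\<bar>K r - K s\<bar> \<le> B * \<bar>r - s\<bar>"
        using primitive_lipschitz[OF assms(1) B(2), of s r] that st by auto
      also have "\<dots> \<le> B * (t - s)" using that B by auto
      finally have "exp M * \<bar>K r - K s\<bar> \<le> exp M * (B * (t - s))" by (rule mult_left_mono) simp
      moreover have "\<bar>exp (K r) - exp (K s)\<bar> \<le> exp M * \<bar>K r - K s\<bar>"
        by (rule l[OF M(2) M(2)]) (use that st in auto)
      ultimately have "\<bar>exp (K r) - exp (K s)\<bar> \<le> exp M * (B * (t - s))" by linarith
      then have "\<bar>k r\<bar> * \<bar>exp (K r) - exp (K s)\<bar> \<le> B * (exp M * (B * (t - s)))"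
        using B that st by (intro mult_mono) auto
      then show ?thesis by (simp add: abs_mult power2_eq_square mult_ac)
    qed
    have "norm (integral {s..t} ?h) \<le> integral {s..t} (\<lambda>_. exp M * B\<^sup>2 * (t - s))"
      using * h by (intro integral_norm_bound_integral) auto
    then have i: "\<bar>integral {s..t} ?h\<bar> \<le> exp M * B\<^sup>2 * (t - s)\<^sup>2"
      using st by (simp add: power2_eq_square mult_ac)
    have "\<bar>K t - K s\<bar> \<le> B * (t - s)"
      using primitive_lipschitz[OF assms(1) B(2), of s t] st by auto
    then have "(K t - K s)\<^sup>2 \<le> (B * (t - s))\<^sup>2" by (rule power2_le_iff_abs_le[THEN iffD2, rotated]) (use B st in auto)
    then have "exp M * (K t - K s)\<^sup>2 \<le> exp M * (B * (t - s))\<^sup>2" by (rule mult_left_mono) simp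
    moreover have "\<bar>exp (K t) - exp (K s) - exp (K s) * (K t - K s)\<bar> \<le> exp M * (K t - K s)\<^sup>2"
      by (rule r[OF M(2) M(2)]) (use st in auto)
    ultimately have "\<bar>exp (K t) - exp (K s) - exp (K s) * (K t - K s)\<bar> \<le> exp M * B\<^sup>2 * (t - s)\<^sup>2"
      unfolding power_mult_distrib mult.assoc by linarith
    then show "\<bar>exp (K t) - exp (K s) - integral {s..t} (\<lambda>r. k r * exp (K r))\<bar> \<le> 2 * exp M * B\<^sup>2 * (t - s)\<^sup>2"
      unfolding e using i by linarith
  qed (use m in auto)
qed

lemma primitive_linear:
  assumes D: "primitive a b D (\<lambda>t. k t * D t + f t)" and k: "bdd_meas a b k" and f: "bdd_meas a b f"
  shows "primitive a b (\<lambda>t. D t * exp (- integral {a..t} k)) (\<lambda>t. f t * exp (- integral {a..t} k))"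
proof -
  have "primitive a b (\<lambda>t. exp (- integral {a..t} k)) (\<lambda>t. - k t * exp (- integral {a..t} k))"
    using primitive_exp[OF primitive_cmult[OF primitive_integral[OF k, of 0], of "-1"]] by simp
  from primitive_mult[OF D this] show ?thesis
    by (rule primitive_cong) (auto simp: algebra_simps)
qed

lemma linear_bound:
  assumes D: "primitive a b D (\<lambda>t. k t * D t + f t)" and k: "bdd_meas a b k" and f: "bdd_meas a b f"
    and D0: "D a = 0" and L: "\<And>t. t \<in> {a..b} \<Longrightarrow> \<bar>k t\<bar> \<le> L" and F: "\<And>t. t \<in> {a..b} \<Longrightarrow> \<bar>f t\<bar> \<le> F"
    and t: "t \<in> {a..b}"
  shows "\<bar>D t\<bar> \<le> F * ((b - a) * exp (2 * L * (b - a)))"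
proof -
  note P = primitive_linear[OF D k f]
  have L0: "L \<ge> 0" using L[OF t] by linarith
  have F0: "F \<ge> 0" using F[OF t] by linarith
  have K: "\<bar>integral {a..s} k\<bar> \<le> L * (b - a)" if "s \<in> {a..b}" for s
  proof -
    have "\<bar>integral {a..s} k\<bar> \<le> L * (s - a)" using that by (intro bdd_meas_integral_bound[OF k L]) auto
    also have "\<dots> \<le> L * (b - a)" using that L0 by (intro mult_left_mono) auto
    finally show ?thesis .
  qed
  have "D t * exp (- integral {a..t} k) = integral {a..t} (\<lambda>s. f s * exp (- integral {a..s} k))"
    using primitive_eq[OF P t] D0 by simp
  moreover have "\<bar>\<dots>\<bar> \<le> (F * exp (L * (b - a))) * (t - a)"
  proof (rule bdd_meas_integral_bound[OF primitive_bdd_meas[OF P]])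
    fix s assume s: "s \<in> {a..b}"
    show "\<bar>f s * exp (- integral {a..s} k)\<bar> \<le> F * exp (L * (b - a))"
      unfolding abs_mult using F[OF s] K[OF s] F0 by (intro mult_mono) auto
  qed (use t in auto)
  ultimately have "\<bar>D t\<bar> * exp (- integral {a..t} k) \<le> (F * exp (L * (b - a))) * (t - a)"
    by (simp add: abs_mult)
  also have "\<dots> \<le> (F * exp (L * (b - a))) * (b - a)" using t F0 by (intro mult_left_mono) auto
  finally have "\<bar>D t\<bar> * exp (- integral {a..t} k) * exp (L * (b - a)) \<le> (F * exp (L * (b - a))) * (b - a) * exp (L * (b - a))"
    by (intro mult_right_mono) auto
  moreover have "1 \<le> exp (- integral {a..t} k) * exp (L * (b - a))"
    using K[OF t] by (simp flip: exp_add)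
  then have "\<bar>D t\<bar> * 1 \<le> \<bar>D t\<bar> * (exp (- integral {a..t} k) * exp (L * (b - a)))"
    by (intro mult_left_mono) auto
  moreover have "exp (L * (b - a)) * exp (L * (b - a)) = exp (2 * L * (b - a))" by (simp flip: exp_add)
  ultimately show ?thesis by (simp add: mult_ac)
qed

lemma linear_nonneg:
  assumes D: "primitive a b D (\<lambda>t. k t * D t + f t)" and k: "bdd_meas a b k" and f: "bdd_meas a b f"
    and D0: "D a \<ge> 0" and F: "\<And>t. t \<in> {a..b} \<Longrightarrow> f t \<ge> 0" and t: "t \<in> {a..b}"
  shows "D t \<ge> 0"
proof -
  note P = primitive_linear[OF D k f]
  have "D t * exp (- integral {a..t} k) = D a + integral {a..t} (\<lambda>s. f s * exp (- integral {a..s} k))"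
    using primitive_eq[OF P, of t] t by simp
  moreover have "integral {a..t} (\<lambda>s. f s * exp (- integral {a..s} k)) \<ge> 0"
    using t F by (intro integral_nonneg bdd_meas_integrable_on[OF primitive_bdd_meas[OF P]]) auto
  ultimately have "D t * exp (- integral {a..t} k) \<ge> 0" using D0 by linarith
  then show ?thesis by (simp add: zero_le_mult_iff not_le[symmetric])
qed

lemma linear_pos:
  assumes D: "primitive a b D (\<lambda>t. k t * D t + f t)" and k: "bdd_meas a b k" and f: "bdd_meas a b f"
    and D0: "D a \<ge> 0" and F: "\<And>t. t \<in> {a..b} \<Longrightarrow> f t \<ge> m" and m: "m > 0" and t: "t \<in> {a<..b}"
  shows "D t > 0"
proof -
  note P = primitive_linear[OF D k f]
  obtain L where L: "L > 0" "\<And>t. t \<in> {a..b} \<Longrightarrow> \<bar>k t\<bar> \<le> L" by (rule bdd_meas_bound[OF k]) blast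
  have K: "exp (- integral {a..s} k) \<ge> exp (- (L * (t - a)))" if "s \<in> {a..t}" for s
  proof -
    have "\<bar>integral {a..s} k\<bar> \<le> L * (s - a)" using that t by (intro bdd_meas_integral_bound[OF k L(2)]) auto
    also have "\<dots> \<le> L * (t - a)" using that L by (intro mult_left_mono) auto
    finally show ?thesis by auto
  qed
  have "D t * exp (- integral {a..t} k) = D a + integral {a..t} (\<lambda>s. f s * exp (- integral {a..s} k))"
    using primitive_eq[OF P, of t] t by simp
  moreover have "integral {a..t} (\<lambda>s. m * exp (- (L * (t - a)))) \<le> integral {a..t} (\<lambda>s. f s * exp (- integral {a..s} k))"
    using t F K m by (intro integral_le bdd_meas_integrable_on[OF primitive_bdd_meas[OF P]]) (auto intro!: mult_mono order_trans[OF _ F])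
  moreover have "integral {a..t} (\<lambda>s. m * exp (- (L * (t - a)))) > 0"
    using t m by simp
  ultimately have "D t * exp (- integral {a..t} k) > 0" using D0 by linarith
  then show ?thesis by (simp add: zero_less_mult_iff)
qed

section \<open>Existence and comparison of trajectories\<close>

lemma picard_lindelof_measurable:
  fixes F :: "real \<Rightarrow> real \<Rightarrow> real"
  assumes meas: "\<And>y. continuous_on {a..b} y \<Longrightarrow> bdd_meas a b (\<lambda>t. F t (y t))"
    and lip: "\<And>t y z. t \<in> {a..b} \<Longrightarrow> \<bar>F t y - F t z\<bar> \<le> L * \<bar>y - z\<bar>"
    and bnd: "\<And>t y. t \<in> {a..b} \<Longrightarrow> \<bar>F t y\<bar> \<le> B"
    and L: "L > 0"
  obtains y where "y a = y0" "primitive a b y (\<lambda>t. F t (y t))"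
proof (cases "a \<le> b")
  case False
  have "bdd_meas a b (\<lambda>t. F t y0)" using meas[of "\<lambda>_. y0"] by simp
  then have "primitive a b (\<lambda>_. y0) (\<lambda>t. F t y0)" using False unfolding primitive_def by simp
  then show thesis using that[of "\<lambda>_. y0"] by simp
next
  case ab: True
  define Y where "Y = rec_nat (\<lambda>_. y0) (\<lambda>_ y t. y0 + integral {a..t} (\<lambda>s. F s (y s)))"
  have Y0: "Y 0 = (\<lambda>_. y0)" and YS: "Y (Suc n) = (\<lambda>t. y0 + integral {a..t} (\<lambda>s. F s (Y n s)))" for n
    by (simp_all add: Y_def)
  have cont: "continuous_on {a..b} (Y n)" for n
    by (induction n) (auto simp: Y0 YS intro!: primitive_continuous[OF primitive_integral] meas)
  have m: "bdd_meas a b (\<lambda>s. F s (Y n s))" for n using meas cont by blast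
  have prim: "primitive a b (Y (Suc n)) (\<lambda>s. F s (Y n s))" for n
    unfolding YS by (rule primitive_integral[OF m])
  have B0: "B \<ge> 0" using bnd[of a 0] ab by auto
  have step: "\<bar>Y (Suc n) t - Y n t\<bar> \<le> (B * (b - a)) * (1/2) ^ n * exp (2 * L * (t - a))"
    if "t \<in> {a..b}" for n t
    using that
  proof (induction n arbitrary: t)
    case 0
    have "\<bar>Y 1 t - Y 0 t\<bar> \<le> B * (t - a)"
      using bdd_meas_integral_bound[OF m bnd, of a t 0] 0 by (simp add: Y0 YS)
    also have "\<dots> \<le> (B * (b - a)) * 1" using 0 B0 by (simp add: mult_left_mono)
    also have "\<dots> \<le> (B * (b - a)) * exp (2 * L * (t - a))"
      using 0 B0 L ab by (intro mult_left_mono) auto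
    finally show ?case by simp
  next
    case (Suc n)
    define C where "C = L * ((B * (b - a)) * (1/2) ^ n)"
    have C0: "C \<ge> 0" unfolding C_def using L B0 ab by simp
    have ex: "((\<lambda>s. C * exp (2 * L * (s - a))) has_integral
        C * (exp (2 * L * (t - a)) / (2 * L)) - C * (exp (2 * L * (a - a)) / (2 * L))) {a..t}"
      using Suc.prems L
      by (intro fundamental_theorem_of_calculus)
         (auto intro!: derivative_eq_intros simp flip: has_real_derivative_iff_has_vector_derivative)
    have int: "(\<lambda>s. F s (Y k s)) integrable_on {a..t}" for k
      using Suc.prems by (intro bdd_meas_integrable_on[OF m]) auto
    have eq: "Y (Suc k) t = y0 + integral {a..t} (\<lambda>s. F s (Y k s))" for k by (simp add: YS)
    have "\<bar>Y (Suc (Suc n)) t - Y (Suc n) t\<bar> = \<bar>integral {a..t} (\<lambda>s. F s (Y (Suc n) s) - F s (Y n s))\<bar>"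
      unfolding eq[of n] eq[of "Suc n"] integral_diff[OF int int] by simp
    also have "\<dots> \<le> integral {a..t} (\<lambda>s. C * exp (2 * L * (s - a)))"
      unfolding real_norm_def[symmetric]
    proof (rule integral_norm_bound_integral)
      show "(\<lambda>s. F s (Y (Suc n) s) - F s (Y n s)) integrable_on {a..t}"
        using int by (intro integrable_diff) auto
      show "(\<lambda>s. C * exp (2 * L * (s - a))) integrable_on {a..t}" using ex by blast
      fix s assume s: "s \<in> {a..t}"
      then have sb: "s \<in> {a..b}" using Suc.prems by auto
      have "\<bar>F s (Y (Suc n) s) - F s (Y n s)\<bar> \<le> L * \<bar>Y (Suc n) s - Y n s\<bar>" by (rule lip[OF sb])
      also have "\<dots> \<le> L * ((B * (b - a)) * (1/2) ^ n * exp (2 * L * (s - a)))"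
        using Suc.IH[OF sb] L by (intro mult_left_mono) auto
      finally show "norm (F s (Y (Suc n) s) - F s (Y n s)) \<le> C * exp (2 * L * (s - a))"
        by (simp add: C_def mult.assoc)
    qed
    also have "\<dots> = C * (exp (2 * L * (t - a)) / (2 * L)) - C / (2 * L)"
      using integral_unique[OF ex] by simp
    also have "\<dots> \<le> C * (exp (2 * L * (t - a)) / (2 * L))" using C0 L by simp
    also have "\<dots> = (B * (b - a)) * (1/2) ^ Suc n * exp (2 * L * (t - a))"
      using L by (simp add: C_def)
    finally show ?case .
  qed
  have conv: "convergent (\<lambda>n. Y n t)" if t: "t \<in> {a..b}" for t
  proof -
    have "summable (\<lambda>n. Y (Suc n) t - Y n t)"
    proof (rule summable_comparison_test')
      show "summable (\<lambda>n. (B * (b - a)) * (1/2) ^ n * exp (2 * L * (t - a)))"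
        by (intro summable_mult2 summable_mult summable_geometric) simp
    qed (use step[OF t] in simp)
    then have "(\<lambda>n. \<Sum>i<n. Y (Suc i) t - Y i t) \<longlonglongrightarrow> (\<Sum>i. Y (Suc i) t - Y i t)"
      by (rule summable_LIMSEQ)
    then have "(\<lambda>n. Y n t - Y 0 t) \<longlonglongrightarrow> (\<Sum>i. Y (Suc i) t - Y i t)"
      unfolding sum_lessThan_telescope[of "\<lambda>i. Y i t"] .
    then have "(\<lambda>n. (Y n t - Y 0 t) + Y 0 t) \<longlonglongrightarrow> (\<Sum>i. Y (Suc i) t - Y i t) + Y 0 t"
      by (intro tendsto_intros)
    then show ?thesis unfolding convergent_def by auto
  qed
  define y where "y t = lim (\<lambda>n. Y n t)" for t
  have lim: "(\<lambda>n. Y n t) \<longlonglongrightarrow> y t" if "t \<in> {a..b}" for t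
    using conv[OF that] unfolding y_def by (simp add: convergent_LIMSEQ_iff)
  have "B-lipschitz_on {a..b} y"
  proof (rule lipschitz_onI)
    fix s t assume st: "s \<in> {a..b}" "t \<in> {a..b}"
    have "(\<lambda>n. \<bar>Y (Suc n) s - Y (Suc n) t\<bar>) \<longlonglongrightarrow> \<bar>y s - y t\<bar>"
      using lim st by (intro tendsto_intros LIMSEQ_Suc) auto
    moreover have "\<bar>Y (Suc n) s - Y (Suc n) t\<bar> \<le> B * \<bar>s - t\<bar>" for n
      using primitive_lipschitz[OF prim bnd st(2,1)] .
    ultimately show "dist (y s) (y t) \<le> B * dist s t"
      unfolding dist_real_def by (blast intro: LIMSEQ_le_const2)
  qed (rule B0)
  then have my: "bdd_meas a b (\<lambda>s. F s (y s))" by (intro meas lipschitz_on_continuous_on)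
  have eq: "y t = y0 + integral {a..t} (\<lambda>s. F s (y s))" if t: "t \<in> {a..b}" for t
  proof -
    have "(\<lambda>n. integral {a..t} (\<lambda>s. F s (Y n s))) \<longlonglongrightarrow> integral {a..t} (\<lambda>s. F s (y s))"
    proof (rule dominated_convergence(2)[where h="\<lambda>_. B"])
      fix s assume "s \<in> {a..t}"
      then have s: "s \<in> {a..b}" using t by auto
      show "(\<lambda>n. F s (Y n s)) \<longlonglongrightarrow> F s (y s)"
      proof (rule LIM_zero_cancel[OF Lim_null_comparison])
        show "\<forall>\<^sub>F n in sequentially. norm (F s (Y n s) - F s (y s)) \<le> L * \<bar>Y n s - y s\<bar>"
          using lip[OF s] by simp
        have "(\<lambda>n. L * \<bar>Y n s - y s\<bar>) \<longlonglongrightarrow> L * \<bar>y s - y s\<bar>"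
          using lim[OF s] by (intro tendsto_intros)
        then show "(\<lambda>n. L * \<bar>Y n s - y s\<bar>) \<longlonglongrightarrow> 0" by simp
      qed
      show "norm (F s (Y n s)) \<le> B" for n using bnd[OF s] by simp
    qed (use t in \<open>auto intro!: bdd_meas_integrable_on[OF m]\<close>)
    then have "(\<lambda>n. Y (Suc n) t) \<longlonglongrightarrow> y0 + integral {a..t} (\<lambda>s. F s (y s))"
      unfolding YS by (intro tendsto_intros)
    moreover have "(\<lambda>n. Y (Suc n) t) \<longlonglongrightarrow> y t" using lim[OF t] by (rule LIMSEQ_Suc)
    ultimately show ?thesis using LIMSEQ_unique by blast
  qed
  have ya: "y a = y0" using eq[of a] ab by simp
  moreover have "primitive a b y (\<lambda>t. F t (y t))"
    unfolding primitive_def ya using my eq by blast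
  ultimately show thesis by (rule that)
qed

locale control_setting =
  fixes t0 t1 c1 c2 cs ys w :: real
  assumes t01: "t0 < t1" and c1: "c1 > 0" and c2: "c2 > 0" and cs: "cs > 0" and ys: "ys > 0"
    and w_gt: "ys\<^sup>2 / (c1 * ys + c2) < w" and w1: "w < 1"
begin

definition speed :: "real \<Rightarrow> real \<Rightarrow> real" where "speed y v = - (y\<^sup>2) + (c1 * y + c2) * v"

abbreviation "bm \<equiv> bdd_meas t0 t1"

definition adm :: "(real \<Rightarrow> real) \<Rightarrow> bool" where
  "adm v \<longleftrightarrow> bm v \<and> (\<forall>t\<in>{t0..t1}. v t \<in> {w..1})"

definition sol :: "real \<Rightarrow> (real \<Rightarrow> real) \<Rightarrow> (real \<Rightarrow> real) \<Rightarrow> bool" where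
  "sol y0 v y \<longleftrightarrow> y t0 = y0 \<and> primitive t0 t1 y (\<lambda>t. speed (y t) (v t))"

definition min_speed :: real where "min_speed = - (ys\<^sup>2) + (c1 * ys + c2) * w"
definition max_speed :: real where "max_speed = - (ys\<^sup>2) + (c1 * ys + c2)"
definition R :: real where "R = c1 + c2 + 1 + ys"

lemma bys: "c1 * ys + c2 > 0" using c1 c2 ys by (simp add: add_pos_pos)

lemma w0: "w > 0" using bys w_gt by (smt (verit) divide_nonneg_pos zero_le_power2)

lemma min_speed_pos: "min_speed > 0"
  using w_gt bys unfolding min_speed_def by (simp add: divide_less_eq mult.commute)

lemma min_speed_less_max_speed: "min_speed < max_speed"
  using bys w1 unfolding min_speed_def max_speed_def by simp

lemma max_speed_pos: "max_speed > 0" using min_speed_pos min_speed_less_max_speed by simp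

lemma speed_ys: "v \<in> {w..1} \<Longrightarrow> min_speed \<le> speed ys v \<and> speed ys v \<le> max_speed"
  using bys unfolding min_speed_def max_speed_def speed_def by simp

lemma speed_diff: "speed y v - speed z v = (y - z) * (- (y + z) + c1 * v)"
  unfolding speed_def by (simp add: algebra_simps power2_eq_square)

lemma R_ge: "R \<ge> ys" "R \<ge> 1" "R > 0" "c1 * R + c2 \<le> R\<^sup>2"
proof -
  show R1: "R \<ge> ys" "R \<ge> 1" "R > 0" unfolding R_def using c1 c2 ys by auto
  have "c1 * R + c2 * 1 \<le> c1 * R + c2 * R" using R1 c2 by simp
  also have "\<dots> \<le> R * R" unfolding R_def using c1 c2 ys by (simp add: algebra_simps)
  finally show "c1 * R + c2 \<le> R\<^sup>2" by (simp add: power2_eq_square)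
qed

lemma admD: assumes "adm v" shows "bm v" "t \<in> {t0..t1} \<Longrightarrow> v t \<in> {w..1}"
  "t \<in> {t0..t1} \<Longrightarrow> v t > 0"
  using assms w0 unfolding adm_def by force+

lemma solD: assumes "sol y0 v y"
  shows "y t0 = y0" "primitive t0 t1 y (\<lambda>t. speed (y t) (v t))" "bm y" "continuous_on {t0..t1} y"
  using assms primitive_bdd_meas' primitive_continuous unfolding sol_def by auto

lemma sol_nonneg:
  assumes y: "sol y0 v y" and v: "adm v" and "y0 \<ge> 0" and t: "t \<in> {t0..t1}"
  shows "y t \<ge> 0"
proof (rule linear_nonneg[where k="\<lambda>t. - y t + c1 * v t" and f="\<lambda>t. c2 * v t" and a=t0 and b=t1
      and D=y and t=t])
  show "primitive t0 t1 y (\<lambda>t. (- y t + c1 * v t) * y t + c2 * v t)"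
    using solD(2)[OF y] by (rule primitive_cong) (auto simp: speed_def algebra_simps power2_eq_square)
  show "bm (\<lambda>t. - y t + c1 * v t)" "bm (\<lambda>t. c2 * v t)"
    by (intro bdd_meas_intros solD(3)[OF y] admD(1)[OF v])+
  show "0 \<le> y t0" using assms solD(1) by auto
  show "0 \<le> c2 * v t" if "t \<in> {t0..t1}" for t using admD(3)[OF v that] c2 by simp
qed (rule t)

lemma sol_le_R:
  assumes y: "sol y0 v y" and v: "adm v" and "y0 \<le> ys" and t: "t \<in> {t0..t1}"
  shows "y t \<le> R"
proof -
  have "R - y t \<ge> 0"
  proof (rule linear_nonneg[where k="\<lambda>t. - (y t + R) + c1 * v t" and f="\<lambda>t. - speed R (v t)"
        and a=t0 and b=t1 and D="\<lambda>t. R - y t"])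
    have "primitive t0 t1 (\<lambda>t. R - y t) (\<lambda>t. 0 - speed (y t) (v t))"
      using primitive_diff[OF primitive_const solD(2)[OF y]] .
    then show "primitive t0 t1 (\<lambda>t. R - y t) (\<lambda>t. (- (y t + R) + c1 * v t) * (R - y t) + - speed R (v t))"
    proof (rule primitive_cong)
      show "0 - speed (y t) (v t) = (- (y t + R) + c1 * v t) * (R - y t) + - speed R (v t)" for t
        using speed_diff[of "y t" "v t" R] by (simp add: algebra_simps)
    qed auto
    show "bm (\<lambda>t. - (y t + R) + c1 * v t)" "bm (\<lambda>t. - speed R (v t))"
      unfolding speed_def by (intro bdd_meas_intros solD(3)[OF y] admD(1)[OF v])+
    show "0 \<le> R - y t0" using assms solD(1) R_ge by fastforce
    show "0 \<le> - speed R (v t)" if "t \<in> {t0..t1}" for t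
    proof -
      have "(c1 * R + c2) * v t \<le> c1 * R + c2"
        using admD(2)[OF v that] c1 c2 R_ge by (intro mult_left_le) auto
      then show ?thesis unfolding speed_def using R_ge(4) by linarith
    qed
  qed (rule t)
  then show ?thesis by simp
qed

lemma sol_unique:
  assumes y: "sol y0 v y" and z: "sol y0 v z" and v: "adm v" and t: "t \<in> {t0..t1}"
  shows "y t = z t"
proof -
  have k: "bm (\<lambda>t. - (y t + z t) + c1 * v t)"
    by (intro bdd_meas_intros solD(3)[OF y] solD(3)[OF z] admD(1)[OF v])
  obtain L where "\<And>t. t \<in> {t0..t1} \<Longrightarrow> \<bar>- (y t + z t) + c1 * v t\<bar> \<le> L"
    by (rule bdd_meas_bound[OF k]) blast
  note L = this
  have p: "primitive t0 t1 (\<lambda>t. y t - z t) (\<lambda>t. (- (y t + z t) + c1 * v t) * (y t - z t) + 0)"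
    using primitive_diff[OF solD(2)[OF y] solD(2)[OF z]]
    by (rule primitive_cong) (auto simp: speed_diff)
  have "\<bar>y t - z t\<bar> \<le> 0 * ((t1 - t0) * exp (2 * L * (t1 - t0)))"
    by (rule linear_bound[OF p k bdd_meas_const _ L]) (use solD(1)[OF y] solD(1)[OF z] t in auto)
  then show ?thesis by simp
qed

lemma sol_crossed:
  assumes y: "sol y0 v y" and v: "adm v" and s: "s \<in> {t0..t1}" "y s \<ge> ys" and t: "t \<in> {s<..t1}"
  shows "y t > ys"
proof -
  have v': "bdd_meas s t1 v" using admD(1)[OF v] s by (auto intro: bdd_meas_subset)
  have y': "primitive s t1 y (\<lambda>t. speed (y t) (v t))" using solD(2)[OF y] s by (auto intro: primitive_subset)
  have "y t - ys > 0"
  proof (rule linear_pos[where k="\<lambda>t. - (y t + ys) + c1 * v t" and f="\<lambda>t. speed ys (v t)"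
        and a=s and b=t1 and D="\<lambda>t. y t - ys" and m=min_speed])
    have "primitive s t1 (\<lambda>t. y t - ys) (\<lambda>t. speed (y t) (v t) - 0)"
      using primitive_diff[OF y' primitive_const] .
    then show "primitive s t1 (\<lambda>t. y t - ys) (\<lambda>t. (- (y t + ys) + c1 * v t) * (y t - ys) + speed ys (v t))"
    proof (rule primitive_cong)
      show "speed (y t) (v t) - 0 = (- (y t + ys) + c1 * v t) * (y t - ys) + speed ys (v t)" for t
        using speed_diff[of "y t" "v t" ys] by (simp add: algebra_simps)
    qed auto
    show "bdd_meas s t1 (\<lambda>t. - (y t + ys) + c1 * v t)" "bdd_meas s t1 (\<lambda>t. speed ys (v t))"
      unfolding speed_def by (intro bdd_meas_intros primitive_bdd_meas'[OF y'] v')+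
    show "min_speed \<le> speed ys (v t)" if "t \<in> {s..t1}" for t
      using speed_ys admD(2)[OF v] that s by auto
  qed (use s t min_speed_pos in auto)
  then show ?thesis by simp
qed

lemma bdd_meas_speed:
  assumes "bm y" "bm v" shows "bm (\<lambda>t. speed (y t) (v t))"
  unfolding speed_def by (intro bdd_meas_intros assms)

lemma sol_exists:
  assumes v: "adm v" and y0: "0 \<le> y0" "y0 \<le> ys"
  obtains y where "sol y0 v y"
proof -
  define cl where "cl y = min R (max 0 y)" for y
  have cl: "\<bar>cl y - cl z\<bar> \<le> \<bar>y - z\<bar>" "\<bar>cl y\<bar> \<le> R" "0 \<le> cl y" "cl y \<le> R" for y z
    using R_ge(3) unfolding cl_def by auto
  define F where "F t y = speed (cl y) (v t)" for t y
  define L where "L = 2 * R + c1"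
  have Lpos: "L > 0" unfolding L_def using R_ge c1 by simp
  have kb: "\<bar>- (cl y + cl z) + c1 * v t\<bar> \<le> L" if "t \<in> {t0..t1}" for t y z
  proof -
    have "c1 * v t \<le> c1 * 1" "0 \<le> c1 * v t" using admD(2,3)[OF v that] c1 by (auto simp: less_imp_le)
    then show ?thesis using cl(3,4)[of y] cl(3,4)[of z] R_ge unfolding L_def by linarith
  qed
  have lip: "\<bar>F t y - F t z\<bar> \<le> L * \<bar>y - z\<bar>" if "t \<in> {t0..t1}" for t y z
  proof -
    have "\<bar>F t y - F t z\<bar> = \<bar>cl y - cl z\<bar> * \<bar>- (cl y + cl z) + c1 * v t\<bar>"
      unfolding F_def speed_diff by (simp add: abs_mult)
    also have "\<dots> \<le> \<bar>y - z\<bar> * L" using cl(1) kb[OF that] by (intro mult_mono) auto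
    finally show ?thesis by (simp add: mult.commute)
  qed
  have meas: "bm (\<lambda>t. F t (y t))" if "continuous_on {t0..t1} y" for y
  proof -
    have "bm (\<lambda>t. cl (y t))"
      using that unfolding cl_def by (intro bdd_meas_continuous continuous_intros)
    then show ?thesis unfolding F_def using admD(1)[OF v] by (intro bdd_meas_speed)
  qed
  have bnd: "\<bar>F t y\<bar> \<le> R\<^sup>2 + (c1 * R + c2)" if "t \<in> {t0..t1}" for t y
  proof -
    have "(cl y)\<^sup>2 \<le> R\<^sup>2" using cl by (intro power_mono) auto
    moreover have "c1 * cl y \<le> c1 * R" "0 \<le> c1 * cl y" using cl[of y] c1 by auto
    then have "0 \<le> c1 * cl y + c2" "c1 * cl y + c2 \<le> c1 * R + c2" using c2 by auto
    then have "(c1 * cl y + c2) * v t \<le> c1 * cl y + c2" "0 \<le> (c1 * cl y + c2) * v t"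
      "c1 * cl y + c2 \<le> c1 * R + c2"
      using admD(2,3)[OF v that] by (auto intro: mult_left_le)
    ultimately show ?thesis unfolding F_def speed_def using zero_le_power2[of "cl y"] by linarith
  qed
  obtain y where y: "y t0 = y0" "primitive t0 t1 y (\<lambda>t. F t (y t))"
    using picard_lindelof_measurable[OF meas lip bnd Lpos] by blast
  define \<kappa> where "\<kappa> c t = (F t (y t) - F t c) / (y t - c)" for c t
  have \<kappa>eq: "F t (y t) - F t c = \<kappa> c t * (y t - c)" for c t unfolding \<kappa>_def by auto
  have \<kappa>m: "bm (\<kappa> c)" for c
  proof (rule bdd_measI)
    have "bm (\<lambda>t. F t (y t) - F t c)" "bm (\<lambda>t. y t - c)"
      using meas[of "\<lambda>_. c"] primitive_bdd_meas[OF y(2)] primitive_bdd_meas'[OF y(2)] by auto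
    then show "\<kappa> c \<in> borel_measurable (lebesgue_on {t0..t1})"
      unfolding bdd_meas_def \<kappa>_def[abs_def] by (intro borel_measurable_divide) auto
    show "\<bar>\<kappa> c t\<bar> \<le> L" if "t \<in> {t0..t1}" for t
      using lip[OF that, of "y t" c] Lpos unfolding \<kappa>_def
      by (cases "y t = c") (auto simp: divide_le_eq abs_divide)
  qed
  have "y t \<ge> 0" if t: "t \<in> {t0..t1}" for t
  proof (rule linear_nonneg[where k="\<kappa> 0" and f="\<lambda>t. F t 0" and a=t0 and b=t1 and D=y and t=t])
    show "primitive t0 t1 y (\<lambda>t. \<kappa> 0 t * y t + F t 0)"
      using y(2) by (rule primitive_cong) (use \<kappa>eq[of _ 0] in \<open>auto simp: algebra_simps\<close>)
    show "bm (\<lambda>t. F t 0)" using meas[of "\<lambda>_. 0"] by simp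
    show "0 \<le> F t 0" if "t \<in> {t0..t1}" for t
      using admD(3)[OF v that] c2 R_ge unfolding F_def speed_def cl_def by simp
  qed (use \<kappa>m y y0 t in auto)
  moreover have "R - y t \<ge> 0" if t: "t \<in> {t0..t1}" for t
  proof (rule linear_nonneg[where k="\<kappa> R" and f="\<lambda>t. - F t R" and a=t0 and b=t1 and D="\<lambda>t. R - y t"])
    have "primitive t0 t1 (\<lambda>t. R - y t) (\<lambda>t. 0 - F t (y t))"
      using primitive_diff[OF primitive_const y(2)] .
    then show "primitive t0 t1 (\<lambda>t. R - y t) (\<lambda>t. \<kappa> R t * (R - y t) + - F t R)"
      by (rule primitive_cong) (use \<kappa>eq[of _ R] in \<open>auto simp: algebra_simps\<close>)
    show "bm (\<lambda>t. - F t R)" using meas[of "\<lambda>_. R"] by auto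
    show "0 \<le> - F t R" if "t \<in> {t0..t1}" for t
    proof -
      have "(c1 * R + c2) * v t \<le> c1 * R + c2"
        using admD(2)[OF v that] c1 c2 R_ge by (intro mult_left_le) auto
      moreover have "cl R = R" using R_ge unfolding cl_def by simp
      ultimately show ?thesis unfolding F_def speed_def using R_ge(4) by auto
    qed
    show "0 \<le> R - y t0" using y y0 R_ge by simp
  qed (use \<kappa>m t in auto)
  ultimately have "cl (y t) = y t" if "t \<in> {t0..t1}" for t
    using that unfolding cl_def by fastforce
  then have "primitive t0 t1 y (\<lambda>t. speed (y t) (v t))"
    using y(2) by (elim primitive_cong) (auto simp: F_def)
  then show thesis using y(1) by (intro that[of y]) (simp add: sol_def)
qed

end

section \<open>Time changes and a minimax theorem\<close>

lemma primitive_exp_integral: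
  assumes "bdd_meas a b k"
  shows "primitive a b (\<lambda>t. exp (integral {a..t} k)) (\<lambda>t. k t * exp (integral {a..t} k))"
  using primitive_exp[OF primitive_integral[OF assms, of 0]] by simp

lemma strict_mono_image_interval:
  fixes \<theta> :: "real \<Rightarrow> real"
  assumes "continuous_on {a..b} \<theta>" "\<And>s t. a \<le> s \<Longrightarrow> s < t \<Longrightarrow> t \<le> b \<Longrightarrow> \<theta> s < \<theta> t" "t \<in> {a..b}"
  shows "\<theta> ` {a..t} = {\<theta> a..\<theta> t}"
proof
  show "\<theta> ` {a..t} \<subseteq> {\<theta> a..\<theta> t}"
  proof
    fix x assume "x \<in> \<theta> ` {a..t}"
    then obtain s where s: "a \<le> s" "s \<le> t" "x = \<theta> s" by auto
    then show "x \<in> {\<theta> a..\<theta> t}"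
      using assms(2)[of a s] assms(2)[of s t] assms(3) by (cases "a = s"; cases "s = t"; force)
  qed
  show "{\<theta> a..\<theta> t} \<subseteq> \<theta> ` {a..t}"
  proof
    fix x assume "x \<in> {\<theta> a..\<theta> t}"
    moreover have "continuous_on {a..t} \<theta>" using assms(1,3) by (auto intro: continuous_on_subset)
    ultimately obtain s where "a \<le> s" "s \<le> t" "\<theta> s = x"
      using IVT'[of \<theta> a x t] assms(3) by auto
    then show "x \<in> \<theta> ` {a..t}" by auto
  qed
qed

locale time_change =
  fixes a b :: real and \<theta> \<alpha> :: "real \<Rightarrow> real"
  assumes ab: "a \<le> b"
    and deriv: "\<And>t. t \<in> {a..b} \<Longrightarrow> (\<theta> has_field_derivative \<alpha> t) (at t within {a..b})"
    and pos: "\<And>t. t \<in> {a..b} \<Longrightarrow> \<alpha> t > 0"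
    and cont: "continuous_on {a..b} \<alpha>"
    and ends: "\<theta> a = a" "\<theta> b = b"
begin

lemma cont_theta: "continuous_on {a..b} \<theta>"
  using deriv by (meson DERIV_continuous_on)

lemma mono:
  assumes "a \<le> s" "s < t" "t \<le> b" shows "\<theta> s < \<theta> t"
proof (rule DERIV_pos_imp_increasing_open[OF assms(2)])
  fix x assume x: "s < x" "x < t"
  then have "at x within {a..b} = at x" using assms by (intro at_within_Icc_at) auto
  then show "\<exists>d. DERIV \<theta> x :> d \<and> d > 0" using deriv[of x] pos[of x] x assms by auto
next
  show "continuous_on {s..t} \<theta>" using cont_theta assms by (auto intro: continuous_on_subset)
qed

lemma image: "t \<in> {a..b} \<Longrightarrow> \<theta> ` {a..t} = {a..\<theta> t}"
  using strict_mono_image_interval[OF cont_theta mono] ends by simp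

lemma inj: "t \<in> {a..b} \<Longrightarrow> inj_on \<theta> {a..t}"
  by (rule inj_onI) (smt (verit, best) atLeastAtMost_iff mono)

lemma theta_mem: "t \<in> {a..b} \<Longrightarrow> \<theta> t \<in> {a..b}"
  using image[of b] ab ends by auto

lemma change_of_variables:
  assumes "t \<in> {a..b}"
  shows "(\<lambda>s. \<bar>\<alpha> s\<bar> * f (\<theta> s)) absolutely_integrable_on {a..t} \<and>
      integral {a..t} (\<lambda>s. \<bar>\<alpha> s\<bar> * f (\<theta> s)) = c \<longleftrightarrow>
      f absolutely_integrable_on {a..\<theta> t} \<and> integral {a..\<theta> t} f = c"
proof -
  have "(\<theta> has_field_derivative \<alpha> s) (at s within {a..t})" if "s \<in> {a..t}" for s
    using deriv[of s] that assms by (auto intro: DERIV_subset)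
  from has_absolute_integral_change_of_variables_1'[OF _ this inj[OF assms], of f c]
  show ?thesis using image[OF assms] by simp
qed

lemma bdd_meas_pullback:
  assumes f: "bdd_meas a b f" shows "bdd_meas a b (\<lambda>t. \<alpha> t * f (\<theta> t))"
proof -
  have "(\<lambda>s. \<bar>\<alpha> s\<bar> * f (\<theta> s)) absolutely_integrable_on {a..b}"
    using change_of_variables[of b f] bdd_meas_abs_integrable[OF f] ab ends by auto
  then have "(\<lambda>s. \<bar>\<alpha> s\<bar> * f (\<theta> s)) \<in> borel_measurable (lebesgue_on {a..b})"
    using absolutely_integrable_measurable[of "{a..b}"] by auto
  moreover obtain A where A: "\<And>t. t \<in> {a..b} \<Longrightarrow> \<bar>\<alpha> t\<bar> \<le> A" "A > 0"
    using bdd_meas_bound[OF bdd_meas_continuous[OF cont]] by metis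
  obtain B where B: "\<And>t. t \<in> {a..b} \<Longrightarrow> \<bar>f t\<bar> \<le> B"
    using bdd_meas_bound[OF f] by metis
  have "\<bar>\<bar>\<alpha> t\<bar> * f (\<theta> t)\<bar> \<le> A * B" if "t \<in> {a..b}" for t
    unfolding abs_mult abs_abs using A(1)[OF that] B[OF theta_mem[OF that]] A(2) by (intro mult_mono) auto
  ultimately have "bdd_meas a b (\<lambda>t. \<bar>\<alpha> t\<bar> * f (\<theta> t))" by (rule bdd_measI)
  then show ?thesis by (rule bdd_meas_cong) (use pos in force)
qed

lemma primitive_pullback:
  assumes F: "primitive a b F f"
  shows "primitive a b (\<lambda>t. F (\<theta> t)) (\<lambda>t. \<alpha> t * f (\<theta> t))"
  unfolding primitive_def
proof (intro conjI ballI)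
  show "bdd_meas a b (\<lambda>t. \<alpha> t * f (\<theta> t))" by (rule bdd_meas_pullback[OF primitive_bdd_meas[OF F]])
  fix t assume t: "t \<in> {a..b}"
  have "bdd_meas a (\<theta> t) f"
    using primitive_bdd_meas[OF F] theta_mem[OF t] by (auto intro: bdd_meas_subset)
  then have "integral {a..t} (\<lambda>s. \<bar>\<alpha> s\<bar> * f (\<theta> s)) = integral {a..\<theta> t} f"
    using change_of_variables[OF t, of f] bdd_meas_abs_integrable by auto
  moreover have "integral {a..t} (\<lambda>s. \<bar>\<alpha> s\<bar> * f (\<theta> s)) = integral {a..t} (\<lambda>s. \<alpha> s * f (\<theta> s))"
    using t pos by (intro integral_cong) force
  ultimately show "F (\<theta> t) = F (\<theta> a) + integral {a..t} (\<lambda>s. \<alpha> s * f (\<theta> s))"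
    using primitive_eq[OF F theta_mem[OF t]] ends by simp
qed

lemma bdd_meas_pushforward:
  assumes \<mu>: "bdd_meas a b \<mu>"
  obtains v where "bdd_meas a b v" "\<And>t. t \<in> {a..b} \<Longrightarrow> v (\<theta> t) = \<mu> t" "\<And>t. t \<in> {a..b} \<Longrightarrow> v t \<in> \<mu> ` {a..b}"
proof -
  define v where "v s = \<mu> (the_inv_into {a..b} \<theta> s)" for s
  have bb: "b \<in> {a..b}" using ab by simp
  have v\<theta>: "v (\<theta> t) = \<mu> t" if "t \<in> {a..b}" for t
    unfolding v_def using the_inv_into_f_f[OF inj[OF bb] that] by simp
  have vr: "v t \<in> \<mu> ` {a..b}" if "t \<in> {a..b}" for t
  proof -
    have "t \<in> \<theta> ` {a..b}" using that image[OF bb] ends by simp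
    then obtain s where "s \<in> {a..b}" "t = \<theta> s" by blast
    then show ?thesis using v\<theta> by auto
  qed
  have m: "bdd_meas a b (\<lambda>t. \<alpha> t * \<mu> t)" using bdd_meas_continuous[OF cont] \<mu> by auto
  have "(\<lambda>s. \<bar>\<alpha> s\<bar> * v (\<theta> s)) absolutely_integrable_on {a..b}"
    by (rule bdd_meas_abs_integrable, rule bdd_meas_cong[OF m]) (use pos v\<theta> in force)
  then have "v absolutely_integrable_on {a..b}"
    using change_of_variables[OF bb, of v] ends by auto
  then have "v \<in> borel_measurable (lebesgue_on {a..b})"
    using absolutely_integrable_measurable[of "{a..b}"] by auto
  moreover obtain B where "\<And>t. t \<in> {a..b} \<Longrightarrow> \<bar>\<mu> t\<bar> \<le> B" using bdd_meas_bound[OF \<mu>] by metis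
  then have "\<And>t. t \<in> {a..b} \<Longrightarrow> \<bar>v t\<bar> \<le> B" using vr by force
  ultimately have "bdd_meas a b v" by (rule bdd_measI)
  then show thesis using that v\<theta> vr by blast
qed

end

lemma time_change_integral:
  assumes "a \<le> b" and g: "continuous_on {a..b} g" "integral {a..b} g = 0"
    and e: "\<And>t. t \<in> {a..b} \<Longrightarrow> \<epsilon> * \<bar>g t\<bar> < 1" "\<epsilon> \<ge> 0"
  shows "time_change a b (\<lambda>t. t + \<epsilon> * integral {a..t} g) (\<lambda>t. 1 + \<epsilon> * g t)"
proof
  have pos: "1 + \<epsilon> * g t > 0" if "t \<in> {a..b}" for t
    using e(1)[OF that] abs_le_iff[of "\<epsilon> * g t" "\<epsilon> * \<bar>g t\<bar>"] e(2) by (simp add: abs_mult)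
  then show "0 < 1 + \<epsilon> * g t" if "t \<in> {a..b}" for t using that .
  show "continuous_on {a..b} (\<lambda>t. 1 + \<epsilon> * g t)" by (intro continuous_intros g)
  fix t assume "t \<in> {a..b}"
  then show "((\<lambda>t. t + \<epsilon> * integral {a..t} g) has_real_derivative 1 + \<epsilon> * g t) (at t within {a..b})"
    by (auto intro!: derivative_eq_intros integral_has_real_derivative g)
qed (use assms in auto)

text \<open>The loss caused by each crossing is replaced by one linear functional, chosen uniformly over
  the cone of variations.\<close>

lemma minimax_single:
  fixes f l :: "'d \<Rightarrow> real"
  assumes comb: "\<And>d1 d2 s t. d1 \<in> C \<Longrightarrow> d2 \<in> C \<Longrightarrow> s \<ge> 0 \<Longrightarrow> t \<ge> 0 \<Longrightarrow>
      \<exists>d\<in>C. f d \<ge> s * f d1 + t * f d2 \<and> l d = s * l d1 + t * l d2"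
    and bound: "\<And>d. d \<in> C \<Longrightarrow> f d \<le> max (lo * l d) (hi * l d)" and "lo \<le> hi"
  obtains \<eta> where "\<eta> \<in> {lo..hi}" "\<And>d. d \<in> C \<Longrightarrow> f d \<le> \<eta> * l d"
proof -
  define S where "S = insert lo {f d / l d | d. d \<in> C \<and> l d > 0}"
  have le_hi: "x \<le> hi" if xS: "x \<in> S" for x
  proof (cases "x = lo")
    case False
    then obtain d where d: "d \<in> C" "l d > 0" "x = f d / l d" using xS unfolding S_def by auto
    then have "f d \<le> hi * l d"
      using bound[OF d(1)] assms(3) mult_right_mono[of lo hi "l d"] by simp
    then show ?thesis using d by (simp add: divide_le_eq)
  qed (use assms(3) in simp)
  have bdd: "bdd_above S" using le_hi by (auto simp: bdd_above_def)
  have ne: "S \<noteq> {}" unfolding S_def by simp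
  define \<eta> where "\<eta> = Sup S"
  have mem: "\<eta> \<in> {lo..hi}"
    using cSup_upper[OF _ bdd, of lo] cSup_least[OF ne le_hi] unfolding \<eta>_def S_def by auto
  moreover have "f d \<le> \<eta> * l d" if d: "d \<in> C" for d
  proof -
    consider "l d > 0" | "l d = 0" | "l d < 0" by linarith
    then show ?thesis
    proof cases
      case 1
      then have "f d / l d \<le> \<eta>" unfolding \<eta>_def using d by (intro cSup_upper[OF _ bdd]) (auto simp: S_def)
      then show ?thesis using 1 by (simp add: divide_le_eq)
    next
      case 2
      then show ?thesis using bound[OF d] by simp
    next
      case 3
      have "x \<le> f d / l d" if xS: "x \<in> S" for x
      proof (cases "x = lo")
        case True
        have "f d \<le> lo * l d" using bound[OF d] assms(3) 3 mult_right_mono_neg[of lo hi "l d"] by simp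
        then show ?thesis using 3 True by (simp add: le_divide_eq)
      next
        case False
        then obtain e where e: "e \<in> C" "l e > 0" "x = f e / l e" using xS unfolding S_def by auto
        obtain h where h: "h \<in> C" "f h \<ge> l e * f d + (- l d) * f e" "l h = l e * l d + (- l d) * l e"
          using comb[OF d e(1), of "l e" "- l d"] e(2) 3 by auto
        then have "f h \<le> 0" using bound[OF h(1)] by simp
        then have "l e * f d \<le> l d * f e" using h(2) by simp
        moreover have "f e = x * l e" using e by simp
        ultimately have "f d * l e \<le> (x * l d) * l e" by (simp only: mult_ac)
        then have "f d \<le> x * l d" using e(2) by (rule mult_right_le_imp_le)
        then show ?thesis using 3 by (simp add: le_divide_eq)
      qed
      then have "\<eta> \<le> f d / l d" unfolding \<eta>_def by (intro cSup_least[OF ne]) auto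
      then show ?thesis using 3 by (simp add: le_divide_eq)
    qed
  qed
  ultimately show thesis by (rule that)
qed

lemma minimax:
  fixes A :: "'d \<Rightarrow> real" and l :: "'k \<Rightarrow> 'd \<Rightarrow> real"
  assumes "finite K"
    and "\<And>d1 d2 s t. d1 \<in> C \<Longrightarrow> d2 \<in> C \<Longrightarrow> s \<ge> 0 \<Longrightarrow> t \<ge> 0 \<Longrightarrow>
      \<exists>d\<in>C. A d = s * A d1 + t * A d2 \<and> (\<forall>k\<in>K. l k d = s * l k d1 + t * l k d2)"
    and "\<And>d. d \<in> C \<Longrightarrow> A d \<le> (\<Sum>k\<in>K. max (lo k * l k d) (hi k * l k d))"
    and "\<And>k. k \<in> K \<Longrightarrow> lo k \<le> hi k"
  shows "\<exists>\<eta>. (\<forall>k\<in>K. \<eta> k \<in> {lo k..hi k}) \<and> (\<forall>d\<in>C. A d \<le> (\<Sum>k\<in>K. \<eta> k * l k d))"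
  using assms
proof (induction K arbitrary: A rule: finite_induct)
  case empty
  then show ?case by auto
next
  case (insert j K)
  define m where "m k d = max (lo k * l k d) (hi k * l k d)" for k d
  have sub: "m k d \<le> s * m k d1 + t * m k d2"
    if "s \<ge> 0" "t \<ge> 0" "l k d = s * l k d1 + t * l k d2" for k d d1 d2 s t
  proof -
    have "c * l k d = s * (c * l k d1) + t * (c * l k d2)" for c
      using that(3) by (simp add: algebra_simps)
    moreover have "s * (c * l k d1) \<le> s * m k d1" "t * (c * l k d2) \<le> t * m k d2"
      if "c \<in> {lo k, hi k}" for c
      using that \<open>s \<ge> 0\<close> \<open>t \<ge> 0\<close> unfolding m_def by (auto intro!: mult_left_mono)
    ultimately have "c * l k d \<le> s * m k d1 + t * m k d2" if "c \<in> {lo k, hi k}" for c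
      using that by (metis add_mono)
    then show ?thesis unfolding m_def[of k d] by simp
  qed
  obtain \<eta>j where \<eta>j: "\<eta>j \<in> {lo j..hi j}" "\<And>d. d \<in> C \<Longrightarrow> A d - (\<Sum>k\<in>K. m k d) \<le> \<eta>j * l j d"
  proof (rule minimax_single[of C "\<lambda>d. A d - (\<Sum>k\<in>K. m k d)" "l j" "lo j" "hi j"])
    fix d1 d2 and s t :: real assume C: "d1 \<in> C" "d2 \<in> C" and st: "s \<ge> 0" "t \<ge> 0"
    obtain d where d: "d \<in> C" "A d = s * A d1 + t * A d2"
        "\<And>k. k \<in> insert j K \<Longrightarrow> l k d = s * l k d1 + t * l k d2"
      using insert.prems(1)[OF C st] by blast
    have "(\<Sum>k\<in>K. m k d) \<le> (\<Sum>k\<in>K. s * m k d1 + t * m k d2)"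
      using d(3) by (intro sum_mono sub[OF st]) auto
    also have "\<dots> = s * (\<Sum>k\<in>K. m k d1) + t * (\<Sum>k\<in>K. m k d2)"
      by (simp add: sum.distrib sum_distrib_left)
    finally have "s * (A d1 - (\<Sum>k\<in>K. m k d1)) + t * (A d2 - (\<Sum>k\<in>K. m k d2)) \<le> A d - (\<Sum>k\<in>K. m k d)"
      using d(2) by (simp add: algebra_simps)
    then show "\<exists>d\<in>C. s * (A d1 - (\<Sum>k\<in>K. m k d1)) + t * (A d2 - (\<Sum>k\<in>K. m k d2)) \<le> A d - (\<Sum>k\<in>K. m k d)
        \<and> l j d = s * l j d1 + t * l j d2" using d by blast
  next
    fix d assume "d \<in> C"
    from insert.prems(2)[OF this] show "A d - (\<Sum>k\<in>K. m k d) \<le> max (lo j * l j d) (hi j * l j d)"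
      using insert.hyps unfolding m_def by simp
  qed (use insert.prems(3) in auto)
  have "\<exists>\<eta>. (\<forall>k\<in>K. \<eta> k \<in> {lo k..hi k}) \<and> (\<forall>d\<in>C. A d - \<eta>j * l j d \<le> (\<Sum>k\<in>K. \<eta> k * l k d))"
  proof (rule insert.IH)
    fix d1 d2 and s t :: real assume C: "d1 \<in> C" "d2 \<in> C" and st: "s \<ge> 0" "t \<ge> 0"
    obtain d where d: "d \<in> C" "A d = s * A d1 + t * A d2"
        "\<And>k. k \<in> insert j K \<Longrightarrow> l k d = s * l k d1 + t * l k d2"
      using insert.prems(1)[OF C st] by blast
    then have "A d - \<eta>j * l j d = s * (A d1 - \<eta>j * l j d1) + t * (A d2 - \<eta>j * l j d2)"
      by (simp add: algebra_simps)
    then show "\<exists>d\<in>C. A d - \<eta>j * l j d = s * (A d1 - \<eta>j * l j d1) + t * (A d2 - \<eta>j * l j d2) \<and>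
        (\<forall>k\<in>K. l k d = s * l k d1 + t * l k d2)" using d by blast
  next
    fix d assume "d \<in> C"
    from \<eta>j(2)[OF this] show "A d - \<eta>j * l j d \<le> (\<Sum>k\<in>K. max (lo k * l k d) (hi k * l k d))"
      unfolding m_def by simp
  qed (use insert.prems(3) in auto)
  then obtain \<eta> where \<eta>: "\<And>k. k \<in> K \<Longrightarrow> \<eta> k \<in> {lo k..hi k}"
      "\<And>d. d \<in> C \<Longrightarrow> A d - \<eta>j * l j d \<le> (\<Sum>k\<in>K. \<eta> k * l k d)" by blast
  have "(\<Sum>k\<in>K. (\<eta>(j := \<eta>j)) k * l k d) = (\<Sum>k\<in>K. \<eta> k * l k d)" for d
    using insert.hyps by (intro sum.cong) auto
  then have "A d \<le> (\<Sum>k\<in>insert j K. (\<eta>(j := \<eta>j)) k * l k d)" if "d \<in> C" for d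
    using \<eta>(2)[OF that] insert.hyps by simp
  then show ?case using \<eta>(1) \<eta>j(1) by (intro exI[of _ "\<eta>(j := \<eta>j)"]) auto
qed

section \<open>Trajectories and their linearisation\<close>

lemma AE_lebesgue_on_interval_negligible:
  fixes a b :: real
  assumes "AE t in lebesgue_on {a<..<b}. P t"
  obtains N where "negligible N" "\<And>t. t \<in> {a..b} \<Longrightarrow> t \<notin> N \<Longrightarrow> P t"
proof -
  have "AE t in lebesgue. t \<in> {a<..<b} \<longrightarrow> P t"
    using assms by (subst (asm) AE_restrict_space_iff) auto
  then obtain N where N: "N \<in> null_sets lebesgue" "{t \<in> space lebesgue. \<not> (t \<in> {a<..<b} \<longrightarrow> P t)} \<subseteq> N"
    unfolding eventually_ae_filter by blast
  have "negligible (N \<union> {a, b})" using N(1) by (simp add: negligible_iff_null_sets)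
  moreover have "P t" if "t \<in> {a..b}" "t \<notin> N \<union> {a, b}" for t using N(2) that by force
  ultimately show thesis by (rule that)
qed

lemma Basis_real3: "(Basis :: (real^3) set) = range (\<lambda>i. axis i 1)"
  by (auto simp: Basis_vec_def)

context control_setting
begin

abbreviation "cf \<equiv> c_fun cs ys"
abbreviation "growth y \<equiv> integral {t0..t1} (\<lambda>t. cf (y t))"

lemma cf_measurable: "cf \<in> borel_measurable borel"
  unfolding c_fun_def by (intro measurable_If) auto

lemma cf_nonneg: "cf y \<ge> 0" and cf_le: "cf y \<le> cs"
  using cs unfolding c_fun_def by auto

lemma bdd_meas_cf: "bdd_meas a b y \<Longrightarrow> bdd_meas a b (\<lambda>t. cf (y t))"
  using cf_nonneg cf_le cf_measurable unfolding bdd_meas_def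
  by (auto intro!: exI[of _ cs] intro: measurable_compose[OF _ cf_measurable])

lemma f_dyn_nth:
  "f_dyn c1 c2 cs ys x v $ 1 = 1" "f_dyn c1 c2 cs ys x v $ 2 = speed (x $ 2) v"
  "f_dyn c1 c2 cs ys x v $ 3 = cf (x $ 2) * x $ 3"
  by (simp_all add: f_dyn_def speed_def a_fun_def b_fun_def)

lemma trajectory_sol:
  assumes X: "trajectory t0 t1 c1 c2 cs ys X0 u X" and v: "adm v"
    and uv: "AE t in lebesgue_on {t0<..<t1}. u t = v t"
  shows "sol (X0 $ 2) v (\<lambda>t. X t $ 2)"
    and "t \<in> {t0..t1} \<Longrightarrow> X t $ 3 = X0 $ 3 * exp (integral {t0..t} (\<lambda>s. cf (X s $ 2)))"
    and "continuous_on {t0..t1} X"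
proof -
  obtain N where N: "negligible N" "\<And>t. t \<in> {t0..t1} \<Longrightarrow> t \<notin> N \<Longrightarrow> u t = v t"
    by (rule AE_lebesgue_on_interval_negligible[OF uv]) blast
  let ?F = "\<lambda>s. f_dyn c1 c2 cs ys (X s) (u s)"
  have F: "?F integrable_on {t0..t1}"
    using X unfolding trajectory_def by (auto dest: set_lebesgue_integral_eq_integral(1))
  have Xeq: "X t = X0 + integral {t0..t} ?F" if "t \<in> {t0..t1}" for t
    using X that unfolding trajectory_def by auto
  have "continuous_on {t0..t1} (\<lambda>t. X0 + integral {t0..t} ?F)"
    by (intro continuous_intros indefinite_integral_continuous_1 F)
  then show cX: "continuous_on {t0..t1} X"
    by (rule continuous_on_eq) (simp add: Xeq)
  have comp: "X t $ i = X0 $ i + integral {t0..t} (\<lambda>s. ?F s $ i)" if t: "t \<in> {t0..t1}" for t i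
  proof -
    have "?F integrable_on {t0..t}" using F t by (auto intro: integrable_on_subinterval)
    then show ?thesis by (simp add: Xeq[OF t])
  qed
  have X0: "X t0 = X0" using Xeq[of t0] t01 by simp
  have m2: "bm (\<lambda>t. X t $ 2)" and m3: "bm (\<lambda>t. X t $ 3)"
    using cX by (auto intro!: bdd_meas_continuous continuous_intros)
  have p2: "primitive t0 t1 (\<lambda>t. X t $ 2) (\<lambda>t. speed (X t $ 2) (v t))"
    unfolding primitive_def
  proof (intro conjI ballI)
    show "bm (\<lambda>t. speed (X t $ 2) (v t))" by (intro bdd_meas_speed m2 admD(1)[OF v])
    fix t assume t: "t \<in> {t0..t1}"
    have "integral {t0..t} (\<lambda>s. ?F s $ 2) = integral {t0..t} (\<lambda>t. speed (X t $ 2) (v t))"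
      using t N(2) by (intro integral_spike[OF N(1)]) (auto simp: f_dyn_nth)
    then show "X t $ 2 = X t0 $ 2 + integral {t0..t} (\<lambda>t. speed (X t $ 2) (v t))"
      using comp[OF t, of 2] X0 by simp
  qed
  then show "sol (X0 $ 2) v (\<lambda>t. X t $ 2)" using X0 unfolding sol_def by simp
  have mc: "bm (\<lambda>t. cf (X t $ 2))" by (rule bdd_meas_cf[OF m2])
  have p3: "primitive t0 t1 (\<lambda>t. X t $ 3) (\<lambda>t. cf (X t $ 2) * X t $ 3 + 0)"
    unfolding primitive_def
  proof (intro conjI ballI)
    show "bm (\<lambda>t. cf (X t $ 2) * X t $ 3 + 0)" using mc m3 by (intro bdd_meas_intros)
    fix t assume t: "t \<in> {t0..t1}"
    show "X t $ 3 = X t0 $ 3 + integral {t0..t} (\<lambda>t. cf (X t $ 2) * X t $ 3 + 0)"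
      using comp[OF t, of 3] X0 by (simp add: f_dyn_nth)
  qed
  show "X t $ 3 = X0 $ 3 * exp (integral {t0..t} (\<lambda>s. cf (X s $ 2)))" if t: "t \<in> {t0..t1}"
  proof -
    have "X t $ 3 * exp (- integral {t0..t} (\<lambda>s. cf (X s $ 2))) = X t0 $ 3"
      using primitive_eq[OF primitive_linear[OF p3 mc bdd_meas_const] t] by simp
    then show ?thesis using X0 by (simp add: exp_minus field_simps)
  qed
qed

lemma sol_trajectory:
  assumes y: "sol (X0 $ 2) v y" and v: "adm v"
  obtains X where "trajectory t0 t1 c1 c2 cs ys X0 v X"
proof -
  define z where "z t = X0 $ 3 * exp (integral {t0..t} (\<lambda>s. cf (y s)))" for t
  define X :: "real \<Rightarrow> real^3" where "X t = vector [X0 $ 1 + (t - t0), y t, z t]" for t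
  let ?F = "\<lambda>s. f_dyn c1 c2 cs ys (X s) (v s)"
  have X: "X t $ 1 = X0 $ 1 + (t - t0)" "X t $ 2 = y t" "X t $ 3 = z t" for t
    by (simp_all add: X_def)
  have mc: "bm (\<lambda>t. cf (y t))" by (rule bdd_meas_cf[OF solD(3)[OF y]])
  have pz: "primitive t0 t1 z (\<lambda>t. cf (y t) * z t)"
    using primitive_cmult[OF primitive_exp_integral[OF mc], of "X0 $ 3"]
    by (rule primitive_cong) (auto simp: z_def)
  have m: "bm (\<lambda>s. ?F s $ i)" for i
    using exhaust_3[of i] solD(2)[OF y] pz by (auto simp: f_dyn_nth X dest: primitive_bdd_meas)
  have "?F absolutely_integrable_on {t0..t1}"
  proof (rule absolutely_integrable_componentwise)
    fix b :: "real^3" assume "b \<in> Basis"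
    then obtain i where b: "b = axis i 1" unfolding Basis_real3 by blast
    show "(\<lambda>s. ?F s \<bullet> b) absolutely_integrable_on {t0..t1}"
      unfolding b inner_axis inner_real_def mult_1_right by (rule bdd_meas_abs_integrable[OF m])
  qed
  moreover have "X t = X0 + integral {t0..t} ?F" if t: "t \<in> {t0..t1}" for t
  proof -
    have "?F integrable_on {t0..t}"
      using \<open>?F absolutely_integrable_on {t0..t1}\<close> t
      by (auto intro: integrable_on_subinterval dest!: set_lebesgue_integral_eq_integral(1))
    then have i: "integral {t0..t} ?F $ i = integral {t0..t} (\<lambda>s. ?F s $ i)" for i by simp
    have "X t $ i = X0 $ i + integral {t0..t} ?F $ i" for i
      unfolding i
      using exhaust_3[of i] t primitive_eq[OF solD(2)[OF y] t] primitive_eq[OF pz t] solD(1)[OF y]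
      by (auto simp: X f_dyn_nth) (simp add: z_def)
    then show ?thesis by (simp add: vec_eq_iff)
  qed
  ultimately have "trajectory t0 t1 c1 c2 cs ys X0 v X" unfolding trajectory_def by blast
  then show thesis by (rule that)
qed

lemma J_cost_sol:
  assumes v: "adm v" and uv: "AE t in lebesgue_on {t0<..<t1}. u t = v t"
    and Y: "\<And>k. k \<in> {1..N} \<Longrightarrow> sol (x0 k $ 2) v (Y k)"
    and ex: "\<And>k. k \<in> {1..N} \<Longrightarrow> \<exists>X. trajectory t0 t1 c1 c2 cs ys (x0 k) u X"
  shows "J_cost t0 t1 c1 c2 cs ys N x0 u =
    - (\<Sum>k=1..N. Y k t1 * (x0 k $ 3 * exp (growth (Y k))))"
proof -
  have "traj_of t0 t1 c1 c2 cs ys (x0 k) u t1 $ 2 * traj_of t0 t1 c1 c2 cs ys (x0 k) u t1 $ 3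
    = Y k t1 * (x0 k $ 3 * exp (growth (Y k)))" if k: "k \<in> {1..N}" for k
  proof -
    let ?X = "traj_of t0 t1 c1 c2 cs ys (x0 k) u"
    have X: "trajectory t0 t1 c1 c2 cs ys (x0 k) u ?X"
      unfolding traj_of_def using ex[OF k] by (rule someI_ex)
    have e: "?X t $ 2 = Y k t" if "t \<in> {t0..t1}" for t
      using sol_unique[OF trajectory_sol(1)[OF X v uv] Y[OF k] v that] .
    have "integral {t0..t1} (\<lambda>s. cf (?X s $ 2)) = growth (Y k)"
      by (intro integral_cong) (simp add: e)
    then show ?thesis using trajectory_sol(2)[OF X v uv, of t1] e[of t1] t01 by simp
  qed
  then show ?thesis unfolding J_cost_def by (intro arg_cong[where f=uminus] sum.cong refl)
qed

lemma adm_controls: "adm v \<Longrightarrow> v \<in> controls t0 t1 w"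
proof -
  assume v: "adm v"
  have "v \<in> borel_measurable (lebesgue_on {t0<..<t1})"
    by (rule measurable_restrict_mono[of v lebesgue "{t0..t1}"])
       (use admD(1)[OF v] in \<open>auto simp: bdd_meas_def\<close>)
  moreover have "AE t in lebesgue_on {t0<..<t1}. v t \<in> {w..1}"
    using admD(2)[OF v] by (intro AE_I2) (simp add: space_restrict_space)
  ultimately show ?thesis unfolding controls_def by simp
qed

lemma controls_adm:
  assumes u: "u \<in> controls t0 t1 w"
  obtains v where "adm v" "AE t in lebesgue_on {t0<..<t1}. u t = v t"
proof -
  have m: "u \<in> borel_measurable (lebesgue_on {t0<..<t1})"
    and r: "AE t in lebesgue_on {t0<..<t1}. u t \<in> {w..1}" using u unfolding controls_def by auto
  define v where "v t = max w (min 1 (if t \<in> {t0<..<t1} then u t else 0))" for t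
  have "(\<lambda>t. if t \<in> {t0<..<t1} then u t else 0) \<in> borel_measurable lebesgue"
    using m by (intro borel_measurable_if_I) auto
  then have "v \<in> borel_measurable lebesgue" unfolding v_def by (intro borel_measurable_max borel_measurable_min) auto
  then have "v \<in> borel_measurable (lebesgue_on {t0..t1})" by (rule measurable_restrict_space1)
  moreover have vr: "v t \<in> {w..1}" for t using w1 unfolding v_def by auto
  moreover have "\<bar>v t\<bar> \<le> 1" for t using vr[of t] w0 by auto
  ultimately have "adm v" unfolding adm_def using bdd_measI[of v t0 t1 1] by metis
  moreover have "AE t in lebesgue_on {t0<..<t1}. t \<in> {t0<..<t1}"
    by (intro AE_I2) (simp add: space_restrict_space)
  then have "AE t in lebesgue_on {t0<..<t1}. u t = v t"
    using r by eventually_elim (auto simp: v_def)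
  ultimately show thesis by (rule that)
qed

text \<open>To first order in \<open>\<epsilon>\<close>, a varied trajectory differs from \<open>y\<close> by \<open>\<epsilon>\<close> times \<open>shift\<close> at equal clock time.\<close>

definition slope :: "(real \<Rightarrow> real) \<Rightarrow> (real \<Rightarrow> real) \<Rightarrow> real \<Rightarrow> real" where
  "slope y u t = - 2 * y t + c1 * u t"

definition flow :: "(real \<Rightarrow> real) \<Rightarrow> (real \<Rightarrow> real) \<Rightarrow> real \<Rightarrow> real" where
  "flow y u t = exp (integral {t0..t} (slope y u))"

definition forcing :: "(real \<Rightarrow> real) \<Rightarrow> (real \<Rightarrow> real) \<Rightarrow> (real \<Rightarrow> real) \<Rightarrow> (real \<Rightarrow> real) \<Rightarrow> real \<Rightarrow> real" where
  "forcing y u g \<rho> t = g t * speed (y t) (u t) + (c1 * y t + c2) * \<rho> t"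

definition shift :: "(real \<Rightarrow> real) \<Rightarrow> (real \<Rightarrow> real) \<Rightarrow> (real \<Rightarrow> real) \<Rightarrow> (real \<Rightarrow> real) \<Rightarrow> real \<Rightarrow> real" where
  "shift y u g \<rho> t = flow y u t * integral {t0..t} (\<lambda>s. forcing y u g \<rho> s / flow y u s)"

lemma flow_pos: "flow y u t > 0" unfolding flow_def by simp

lemma bdd_meas_slope: "bm y \<Longrightarrow> bm u \<Longrightarrow> bm (slope y u)"
  unfolding slope_def by (intro bdd_meas_intros)

lemma bdd_meas_forcing:
  "bm y \<Longrightarrow> bm u \<Longrightarrow> bm g \<Longrightarrow> bm \<rho>
    \<Longrightarrow> bm (forcing y u g \<rho>)"
  unfolding forcing_def by (intro bdd_meas_intros bdd_meas_speed)

lemma primitive_flow: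
  assumes "bm y" "bm u"
  shows "primitive t0 t1 (flow y u) (\<lambda>t. slope y u t * flow y u t)"
  unfolding flow_def using primitive_exp_integral[OF bdd_meas_slope[OF assms]] .

lemma primitive_inverse_flow:
  assumes "bm y" "bm u"
  shows "primitive t0 t1 (\<lambda>t. 1 / flow y u t) (\<lambda>t. - slope y u t * (1 / flow y u t))"
proof -
  have "primitive t0 t1 (\<lambda>t. - 1 * integral {t0..t} (slope y u)) (\<lambda>t. - 1 * slope y u t)"
    using primitive_cmult[OF primitive_integral[OF bdd_meas_slope[OF assms], of 0], of "-1"] by simp
  from primitive_exp[OF this] show ?thesis
    by (rule primitive_cong) (auto simp: flow_def exp_minus divide_inverse)
qed

lemma primitive_shift:
  assumes "bm y" "bm u" "bm g" "bm \<rho>"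
  shows "primitive t0 t1 (shift y u g \<rho>) (\<lambda>t. slope y u t * shift y u g \<rho> t + forcing y u g \<rho> t)"
proof -
  have m: "bm (\<lambda>s. forcing y u g \<rho> s * (1 / flow y u s))"
    by (intro bdd_meas_intros bdd_meas_forcing assms primitive_bdd_meas'[OF primitive_inverse_flow])
  have "primitive t0 t1 (\<lambda>t. integral {t0..t} (\<lambda>s. forcing y u g \<rho> s / flow y u s)) (\<lambda>s. forcing y u g \<rho> s / flow y u s)"
    using primitive_integral[OF m, of 0] by simp
  from primitive_mult[OF primitive_flow[OF assms(1,2)] this] show ?thesis
    by (rule primitive_cong) (use flow_pos[of y u] in \<open>auto simp: shift_def less_le\<close>)
qed

definition L :: real where "L = 2 * R + c1"
definition B :: real where "B = R\<^sup>2 + (c1 * R + c2)"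

lemma L_pos: "L > 0" and B_pos: "B > 0" and L_ge: "R + ys + c1 \<le> L"
  unfolding L_def B_def using R_ge c1 c2 by (auto intro!: add_pos_pos)

lemma b_bound: assumes "0 \<le> y" "y \<le> R" shows "0 \<le> c1 * y + c2" "c1 * y + c2 \<le> c1 * R + c2" "\<bar>c1 * y + c2\<bar> \<le> B"
proof -
  have "0 \<le> c1 * y" "c1 * y \<le> c1 * R" using assms c1 by auto
  then show "0 \<le> c1 * y + c2" "c1 * y + c2 \<le> c1 * R + c2" "\<bar>c1 * y + c2\<bar> \<le> B"
    using c2 zero_le_power2[of R] unfolding B_def by linarith+
qed

lemma slope_le:
  assumes "0 \<le> y" "y \<le> R" "0 \<le> z" "z \<le> R" "v \<in> {w..1}"
  shows "\<bar>- (y + z) + c1 * v\<bar> \<le> L"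
proof -
  have "0 \<le> c1 * v" "c1 * v \<le> c1" using assms(5) c1 w0 by (auto intro: mult_left_le)
  then show ?thesis using assms R_ge unfolding L_def by linarith
qed

lemma speed_bound:
  assumes "0 \<le> y" "y \<le> R" "v \<in> {w..1}"
  shows "\<bar>speed y v\<bar> \<le> B"
proof -
  have "y\<^sup>2 \<le> R\<^sup>2" using assms by (intro power_mono) auto
  moreover have "0 \<le> (c1 * y + c2) * v" "(c1 * y + c2) * v \<le> c1 * y + c2"
    using b_bound[OF assms(1,2)] assms(3) w0 by (auto intro: mult_left_le)
  ultimately show ?thesis using b_bound[OF assms(1,2)] zero_le_power2[of y] unfolding speed_def B_def by linarith
qed


section \<open>Variations of clock and control\<close>


lemma sol_below:
  assumes y: "sol y0 v y" and v: "adm v" and s: "s \<in> {t0..t1}" "y s < ys" and r: "r \<in> {t0..s}"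
  shows "y r < ys"
  using sol_crossed[OF y v, of r s] s r by (cases "r = s") force+

lemma cf_integral_lower:
  assumes y: "sol y0 v y" and v: "adm v" and y0: "0 \<le> y0" and s: "s \<in> {t0..t1}" "y s < ys"
  shows "cs * (s - t0) \<le> growth y"
proof -
  have m: "bm (\<lambda>t. cf (y t))" by (rule bdd_meas_cf[OF solD(3)[OF y]])
  have "integral {t0..s} (\<lambda>t. cf (y t)) = integral {t0..s} (\<lambda>_. cs)"
    using sol_below[OF y v s] sol_nonneg[OF y v y0] s by (intro integral_cong) (simp add: c_fun_def)
  moreover have "integral {s..t1} (\<lambda>t. cf (y t)) \<ge> 0"
    using s cf_nonneg by (intro integral_nonneg bdd_meas_integrable_on[OF m]) auto
  moreover have "growth y - integral {t0..s} (\<lambda>t. cf (y t)) = integral {s..t1} (\<lambda>t. cf (y t))"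
    using s by (intro bdd_meas_integral_combine[OF m]) auto
  ultimately show ?thesis using s by (simp add: mult.commute)
qed

lemma crossing_cases:
  assumes y: "sol y0 v y" and v: "adm v" and y0: "y0 \<le> ys" and th: "th = crossing_time t0 t1 ys y"
  obtains (cross) "th \<in> {t0..t1}" "y th = ys" "\<And>t. t \<in> {t0..t1} \<Longrightarrow> t < th \<Longrightarrow> y t < ys"
      "\<And>t. t \<in> {t0..t1} \<Longrightarrow> th < t \<Longrightarrow> y t > ys"
    | (nocross) "th = t1 + 1" "\<And>t. t \<in> {t0..t1} \<Longrightarrow> y t < ys"
proof (cases "\<exists>t\<in>{t0..t1}. y t = ys")
  case True
  then obtain s where s: "s \<in> {t0..t1}" "y s = ys" by blast
  have after: "y t > ys" if "t \<in> {t0..t1}" "s < t" for t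
    using sol_crossed[OF y v s(1), of t] s that by auto
  have before: "y t < ys" if "t \<in> {t0..t1}" "t < s" for t
    using sol_crossed[OF y v that(1), of s] s that by force
  have "(THE t. t \<in> {t0..t1} \<and> y t = ys) = s"
  proof (rule the_equality)
    fix t assume "t \<in> {t0..t1} \<and> y t = ys"
    then show "t = s" using after[of t] before[of t] by (metis less_irrefl linorder_neqE)
  qed (use s in simp)
  then have "th = s" using True th unfolding crossing_time_def by auto
  then show thesis using cross s after before by blast
next
  case False
  then have "th = t1 + 1" using th unfolding crossing_time_def by auto
  moreover have "y t < ys" if t: "t \<in> {t0..t1}" for t
  proof (rule ccontr)
    assume "\<not> y t < ys"
    moreover have "continuous_on {t0..t} y" using solD(4)[OF y] t by (auto intro: continuous_on_subset)
    ultimately obtain s where "t0 \<le> s" "s \<le> t" "y s = ys"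
      using IVT'[of y t0 ys t] solD(1)[OF y] y0 t by auto
    then show False using False t by auto
  qed
  ultimately show thesis by (rule nocross)
qed

lemma cf_sol:
  assumes y: "sol y0 v y" and v: "adm v" and y0: "0 \<le> y0" "y0 \<le> ys"
    and th: "th = crossing_time t0 t1 ys y" and t: "t \<in> {t0..t1}"
  shows "cf (y t) = (if t < th then cs else 0)"
  using y v y0(2) th
proof (cases rule: crossing_cases)
  case cross
  then show ?thesis using sol_nonneg[OF y v y0(1) t] t
    by (cases "t < th"; cases "t = th") (force simp: c_fun_def)+
next
  case nocross
  then show ?thesis using sol_nonneg[OF y v y0(1) t] t by (simp add: c_fun_def)
qed

lemma integral_before:
  assumes f: "bm f" and c: "t0 \<le> c"
  shows "integral {t0..t1} (\<lambda>t. (if t < c then k else 0) * f t) = k * integral {t0..min c t1} f"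
proof -
  define d where "d = min c t1"
  have d: "t0 \<le> d" "d \<le> t1" using c t01 unfolding d_def by auto
  have m: "bm (\<lambda>t. (if t < c then k else 0) * f t)"
    by (intro bdd_meas_mult f bdd_meas_if_less bdd_meas_const bdd_meas_continuous continuous_on_id)
  have "integral {t0..d} (\<lambda>t. (if t < c then k else 0) * f t) = integral {t0..d} (\<lambda>t. k * f t)"
    by (rule integral_spike[of "{d}"]) (auto simp: d_def)
  moreover have "integral {d..t1} (\<lambda>t. (if t < c then k else 0) * f t) = integral {d..t1} (\<lambda>t. 0)"
    by (rule integral_spike[of "{d, t1}"]) (auto simp: d_def)
  ultimately show ?thesis
    using bdd_meas_integral_combine[OF m, of d t1] d unfolding d_def[symmetric] by simp
qed

lemma cf_integral:
  assumes y: "sol y0 v y" and v: "adm v" and y0: "0 \<le> y0" "y0 \<le> ys"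
    and th: "th = crossing_time t0 t1 ys y" and f: "bm f"
  shows "integral {t0..t1} (\<lambda>t. cf (y t) * f t) = cs * integral {t0..min th t1} f"
proof -
  have "t0 \<le> th" using y v y0(2) th by (rule crossing_cases) (use t01 in auto)
  moreover have "integral {t0..t1} (\<lambda>t. cf (y t) * f t) = integral {t0..t1} (\<lambda>t. (if t < th then cs else 0) * f t)"
    by (intro integral_cong) (simp add: cf_sol[OF y v y0 th])
  ultimately show ?thesis using integral_before[OF f] by simp
qed

lemma sol_near_crossing:
  assumes y: "sol y0 v y" and v: "adm v" and y0: "0 \<le> y0" "y0 \<le> ys"
    and c: "c \<in> {t0..t1}" and s: "s \<in> {t0..t1}"
  shows "s \<le> c \<Longrightarrow> y s \<le> y c - (c - s) * (min_speed - L * (\<bar>y c - ys\<bar> + B * (c - s)))"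
    and "c \<le> s \<Longrightarrow> y s \<le> y c + (s - c) * (max_speed + L * (\<bar>y c - ys\<bar> + B * (s - c)))"
proof -
  have m: "bm (\<lambda>t. speed (y t) (v t))" using primitive_bdd_meas[OF solD(2)[OF y]] .
  have yb: "0 \<le> y t" "y t \<le> R" if "t \<in> {t0..t1}" for t
    using sol_nonneg[OF y v y0(1) that] sol_le_R[OF y v y0(2) that] .
  have vb: "\<bar>speed (y t) (v t)\<bar> \<le> B" if "t \<in> {t0..t1}" for t
    using speed_bound yb[OF that] admD(2)[OF v that] by blast
  have est: "min_speed - L * (\<bar>y c - ys\<bar> + B * \<Delta>) \<le> speed (y t) (v t) \<and> speed (y t) (v t) \<le> max_speed + L * (\<bar>y c - ys\<bar> + B * \<Delta>)"
    if t: "t \<in> {t0..t1}" "\<bar>t - c\<bar> \<le> \<Delta>" for t \<Delta>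
  proof -
    have "\<bar>y t - y c\<bar> \<le> B * \<bar>t - c\<bar>"
      using primitive_lipschitz[OF solD(2)[OF y] vb c t(1)] .
    also have "\<dots> \<le> B * \<Delta>" using t(2) B_pos by simp
    finally have "\<bar>y t - ys\<bar> \<le> \<bar>y c - ys\<bar> + B * \<Delta>" by linarith
    moreover have "\<bar>- (y t + ys) + c1 * v t\<bar> \<le> L"
      using slope_le yb[OF t(1)] admD(2)[OF v t(1)] ys R_ge(1) by (auto simp: less_imp_le)
    ultimately have "\<bar>(y t - ys) * (- (y t + ys) + c1 * v t)\<bar> \<le> (\<bar>y c - ys\<bar> + B * \<Delta>) * L"
      unfolding abs_mult by (intro mult_mono) auto
    moreover have "speed (y t) (v t) = speed ys (v t) + (y t - ys) * (- (y t + ys) + c1 * v t)"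
      using speed_diff[of "y t" "v t" ys] by simp
    ultimately show ?thesis using speed_ys[OF admD(2)[OF v t(1)]] by (simp add: mult.commute abs_le_iff)
  qed
  show "y s \<le> y c - (c - s) * (min_speed - L * (\<bar>y c - ys\<bar> + B * (c - s)))" if sc: "s \<le> c"
  proof -
    have "y c - y s = integral {s..c} (\<lambda>t. speed (y t) (v t))"
      using sc s c by (intro primitive_diff_eq[OF solD(2)[OF y]]) auto
    moreover have "integral {s..c} (\<lambda>t. min_speed - L * (\<bar>y c - ys\<bar> + B * (c - s))) \<le> \<dots>"
      using sc s c est[of _ "c - s"] by (intro integral_le bdd_meas_integrable_on[OF m]) auto
    ultimately show ?thesis using sc by simp
  qed
  show "y s \<le> y c + (s - c) * (max_speed + L * (\<bar>y c - ys\<bar> + B * (s - c)))" if sc: "c \<le> s"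
  proof -
    have "y s - y c = integral {c..s} (\<lambda>t. speed (y t) (v t))"
      using sc s c by (intro primitive_diff_eq[OF solD(2)[OF y]]) auto
    moreover have "\<dots> \<le> integral {c..s} (\<lambda>t. max_speed + L * (\<bar>y c - ys\<bar> + B * (s - c)))"
      using sc s c est[of _ "s - c"] by (intro integral_le bdd_meas_integrable_on[OF m]) auto
    ultimately show ?thesis using sc by simp
  qed
qed

text \<open>An admissible direction \<open>(g, \<rho>)\<close> perturbs the clock by \<open>g\<close> and the control by \<open>\<rho>\<close>.\<close>

definition direction :: "(real \<Rightarrow> real) \<Rightarrow> (real \<Rightarrow> real) \<Rightarrow> (real \<Rightarrow> real) \<Rightarrow> bool" where
  "direction u g \<rho> \<longleftrightarrow> continuous_on {t0..t1} g \<and> integral {t0..t1} g = 0 \<and> bm \<rho> \<and>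
     (\<exists>r>0. \<forall>\<epsilon>\<in>{0..r}. \<forall>t\<in>{t0..t1}. u t + \<epsilon> * \<rho> t \<in> {w..1})"

definition clock :: "(real \<Rightarrow> real) \<Rightarrow> real \<Rightarrow> real \<Rightarrow> real" where
  "clock g \<epsilon> t = t + \<epsilon> * integral {t0..t} g"

definition varied :: "(real \<Rightarrow> real) \<Rightarrow> (real \<Rightarrow> real) \<Rightarrow> (real \<Rightarrow> real) \<Rightarrow> real \<Rightarrow> (real \<Rightarrow> real) \<Rightarrow> bool" where
  "varied u g \<rho> \<epsilon> v \<longleftrightarrow> adm v \<and> (\<forall>t\<in>{t0..t1}. v (clock g \<epsilon> t) = u t + \<epsilon> * \<rho> t)"

definition expands :: "(real \<Rightarrow> real) \<Rightarrow> (real \<Rightarrow> real) \<Rightarrow> (real \<Rightarrow> real) \<Rightarrow> real \<Rightarrow> (real \<Rightarrow> real) \<Rightarrow> real \<Rightarrow> real \<Rightarrow> bool" where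
  "expands u g \<rho> y0 y C \<epsilon> \<longleftrightarrow> (\<forall>v Y t. varied u g \<rho> \<epsilon> v \<and> sol y0 v Y \<and> t \<in> {t0..t1} \<longrightarrow>
     \<bar>Y (clock g \<epsilon> t) - y t - \<epsilon> * shift y u g \<rho> t\<bar> \<le> C * \<epsilon>\<^sup>2)"

lemma clock_time_change:
  assumes "direction u g \<rho>"
  shows "\<forall>\<^sub>F \<epsilon> in at_right 0. time_change t0 t1 (clock g \<epsilon>) (\<lambda>t. 1 + \<epsilon> * g t)"
proof -
  have g: "continuous_on {t0..t1} g" "integral {t0..t1} g = 0" using assms unfolding direction_def by auto
  obtain G where G: "G > 0" "\<And>t. t \<in> {t0..t1} \<Longrightarrow> \<bar>g t\<bar> \<le> G"
    by (rule bdd_meas_bound[OF bdd_meas_continuous[OF g(1)]]) blast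
  have "\<forall>\<^sub>F \<epsilon> in at_right 0. (0::real) < \<epsilon> \<and> \<epsilon> < 1 / G"
    using G(1) eventually_at_right_real[of 0 "1 / G"] by simp
  then show ?thesis
  proof eventually_elim
    case (elim \<epsilon>)
    have "\<epsilon> * \<bar>g t\<bar> < 1" if "t \<in> {t0..t1}" for t
    proof -
      have "\<epsilon> * \<bar>g t\<bar> \<le> \<epsilon> * G" using elim G(2)[OF that] by simp
      also have "\<dots> < 1" using elim G(1) by (simp add: less_divide_eq)
      finally show ?thesis .
    qed
    then show ?case unfolding clock_def using elim t01 by (intro time_change_integral g) auto
  qed
qed

lemma varied_exists:
  assumes u: "adm u" and d: "direction u g \<rho>"
  shows "\<forall>\<^sub>F \<epsilon> in at_right 0. \<exists>v. varied u g \<rho> \<epsilon> v"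
proof -
  have \<rho>: "bm \<rho>" using d unfolding direction_def by auto
  obtain r where r: "r > 0" "\<And>\<epsilon> t. \<epsilon> \<in> {0..r} \<Longrightarrow> t \<in> {t0..t1} \<Longrightarrow> u t + \<epsilon> * \<rho> t \<in> {w..1}"
    using d unfolding direction_def by blast
  have "\<forall>\<^sub>F \<epsilon> in at_right 0. (0::real) < \<epsilon> \<and> \<epsilon> < r"
    using r(1) eventually_at_right_real[of 0 r] by simp
  with clock_time_change[OF d] show ?thesis
  proof eventually_elim
    case (elim \<epsilon>)
    interpret time_change t0 t1 "clock g \<epsilon>" "\<lambda>t. 1 + \<epsilon> * g t" using elim by simp
    have "bm (\<lambda>t. u t + \<epsilon> * \<rho> t)" by (intro bdd_meas_intros \<rho> admD(1)[OF u])
    then obtain v where v: "bm v" "\<And>t. t \<in> {t0..t1} \<Longrightarrow> v (clock g \<epsilon> t) = u t + \<epsilon> * \<rho> t"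
        "\<And>t. t \<in> {t0..t1} \<Longrightarrow> v t \<in> (\<lambda>t. u t + \<epsilon> * \<rho> t) ` {t0..t1}"
      by (rule bdd_meas_pushforward) blast
    have "v t \<in> {w..1}" if t: "t \<in> {t0..t1}" for t
    proof -
      obtain s where "s \<in> {t0..t1}" "v t = u s + \<epsilon> * \<rho> s" using v(3)[OF t] by blast
      then show ?thesis using r(2)[of \<epsilon> s] elim by auto
    qed
    then show ?case using v unfolding varied_def adm_def by blast
  qed
qed

lemma varied_expansion:
  assumes u: "adm u" and d: "direction u g \<rho>"
    and y: "sol y0 u y" and y0: "0 \<le> y0" "y0 \<le> ys"
  obtains C where "C > 0" "\<forall>\<^sub>F \<epsilon> in at_right 0. expands u g \<rho> y0 y C \<epsilon>"
proof -
  have \<rho>: "bm \<rho>" and g: "bm g"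
    using d unfolding direction_def by (auto intro: bdd_meas_continuous)
  obtain G where G: "G > 0" "\<And>t. t \<in> {t0..t1} \<Longrightarrow> \<bar>g t\<bar> \<le> G" by (rule bdd_meas_bound[OF g]) blast
  obtain P where P: "P > 0" "\<And>t. t \<in> {t0..t1} \<Longrightarrow> \<bar>\<rho> t\<bar> \<le> P" by (rule bdd_meas_bound[OF \<rho>]) blast
  define K where "K = (t1 - t0) * exp (2 * L * (t1 - t0))"
  have K0: "K > 0" using t01 unfolding K_def by simp
  define H where "H = G * B + (1 + G) * (B * P)"
  define C1 where "C1 = H * K"
  define C where "C = (C1\<^sup>2 + (G * (C1 * L) + (c1 * C1) * P + G * (B * P))) * K"
  have H0: "H > 0" unfolding H_def using G(1) P(1) B_pos by (intro add_pos_pos mult_pos_pos) auto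
  then have C10: "C1 > 0" unfolding C1_def using K0 by simp
  then have "C > 0"
    unfolding C_def using G(1) P(1) B_pos L_pos c1 K0 by (intro add_pos_pos mult_pos_pos) auto
  note cpos = H0 C10 this
  have my: "bm y" and mu: "bm u" using solD(3)[OF y] admD(1)[OF u] .
  have yb: "0 \<le> y t" "y t \<le> R" if "t \<in> {t0..t1}" for t
    using sol_nonneg[OF y u y0(1) that] sol_le_R[OF y u y0(2) that] .
  have "\<forall>\<^sub>F \<epsilon> in at_right 0. (0::real) < \<epsilon> \<and> \<epsilon> < 1"
    using eventually_at_right_real[of 0 1] by simp
  with clock_time_change[OF d] have "\<forall>\<^sub>F \<epsilon> in at_right 0. expands u g \<rho> y0 y C \<epsilon>"
  proof eventually_elim
    case (elim \<epsilon>)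
    interpret tc: time_change t0 t1 "clock g \<epsilon>" "\<lambda>t. 1 + \<epsilon> * g t" using elim by simp
    have e: "0 < \<epsilon>" "\<epsilon> \<le> 1" using elim by auto
    show ?case unfolding expands_def
    proof (intro allI impI, elim conjE)
      fix v X t assume v: "varied u g \<rho> \<epsilon> v" and X: "sol y0 v X" and t: "t \<in> {t0..t1}"
      have av: "adm v" and veq: "\<And>t. t \<in> {t0..t1} \<Longrightarrow> v (clock g \<epsilon> t) = u t + \<epsilon> * \<rho> t"
        using v unfolding varied_def by auto
      define Y where "Y t = X (clock g \<epsilon> t)" for t
      have Y0: "Y t0 = y0" using solD(1)[OF X] tc.ends unfolding Y_def by simp
      have Y: "primitive t0 t1 Y (\<lambda>t. (1 + \<epsilon> * g t) * speed (Y t) (u t + \<epsilon> * \<rho> t))"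
        using tc.primitive_pullback[OF solD(2)[OF X]] by (rule primitive_cong) (auto simp: veq Y_def)
      have Yb: "0 \<le> Y t \<and> Y t \<le> R" if "t \<in> {t0..t1}" for t
        using sol_nonneg[OF X av y0(1)] sol_le_R[OF X av y0(2)] tc.theta_mem[OF that] unfolding Y_def by blast
      have mY: "bm Y" using primitive_bdd_meas'[OF Y] .
      define D where "D t = Y t - y t" for t
      define h where "h t = g t * speed (Y t) (u t) + (1 + \<epsilon> * g t) * ((c1 * Y t + c2) * \<rho> t)" for t
      have mh: "bm h" unfolding h_def by (intro bdd_meas_intros bdd_meas_speed g \<rho> mY mu)
      have mk: "bm (\<lambda>t. - (Y t + y t) + c1 * u t)" by (intro bdd_meas_intros mY my mu)
      have mD: "bm D" unfolding D_def by (intro bdd_meas_intros mY my)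
      have pD: "primitive t0 t1 D (\<lambda>t. (1 + \<epsilon> * g t) * speed (Y t) (u t + \<epsilon> * \<rho> t) - speed (y t) (u t))"
        unfolding D_def by (rule primitive_diff[OF Y solD(2)[OF y]])
      have pD1: "primitive t0 t1 D (\<lambda>t. (- (Y t + y t) + c1 * u t) * D t + \<epsilon> * h t)"
        using pD by (rule primitive_cong)
          (auto simp: D_def h_def speed_def algebra_simps power2_eq_square)
      have D0: "D t0 = 0" using Y0 solD(1)[OF y] unfolding D_def by simp
      have hb: "\<bar>h t\<bar> \<le> H" if t: "t \<in> {t0..t1}" for t
      proof -
        have "\<bar>g t * speed (Y t) (u t)\<bar> \<le> G * B"
          unfolding abs_mult using G(2)[OF t] speed_bound Yb[OF t] admD(2)[OF u t] G(1) by (intro mult_mono) auto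
        moreover have eg: "\<bar>\<epsilon> * g t\<bar> \<le> 1 * G"
          unfolding abs_mult using G(2)[OF t] e by (intro mult_mono) auto
        have "\<bar>(1 + \<epsilon> * g t) * ((c1 * Y t + c2) * \<rho> t)\<bar> \<le> (1 + G) * (B * P)"
          unfolding abs_mult using eg P(2)[OF t] b_bound(3) Yb[OF t] B_pos G(1) by (intro mult_mono) auto
        ultimately show ?thesis unfolding h_def H_def by linarith
      qed
      have Db: "\<bar>D t\<bar> \<le> \<epsilon> * C1" if t: "t \<in> {t0..t1}" for t
      proof -
        have "\<bar>D t\<bar> \<le> (\<epsilon> * H) * ((t1 - t0) * exp (2 * L * (t1 - t0)))"
        proof (rule linear_bound[OF pD1 mk _ D0 _ _ t])
          show "bm (\<lambda>t. \<epsilon> * h t)" by (intro bdd_meas_intros mh)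
          show "\<bar>- (Y t + y t) + c1 * u t\<bar> \<le> L" if "t \<in> {t0..t1}" for t
            using slope_le Yb[OF that] yb[OF that] admD(2)[OF u that] by blast
          show "\<bar>\<epsilon> * h t\<bar> \<le> \<epsilon> * H" if "t \<in> {t0..t1}" for t
            using hb[OF that] e by (simp add: abs_mult)
        qed
        then show ?thesis unfolding C1_def K_def by (simp add: mult_ac)
      qed
      define r where "r t = - (D t)\<^sup>2 + \<epsilon> * (h t - forcing y u g \<rho> t)" for t
      have mr: "bm r" unfolding r_def by (intro bdd_meas_intros mD mh bdd_meas_forcing my mu g \<rho>)
      have rb: "\<bar>r t\<bar> \<le> \<epsilon>\<^sup>2 * (C1\<^sup>2 + (G * (C1 * L) + (c1 * C1) * P + G * (B * P)))" if t: "t \<in> {t0..t1}" for t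
      proof -
        have "(D t)\<^sup>2 \<le> (\<epsilon> * C1)\<^sup>2"
          by (rule power2_le_iff_abs_le[THEN iffD2]) (use Db[OF t] cpos e in auto)
        moreover have "\<bar>h t - forcing y u g \<rho> t\<bar> \<le> G * (\<epsilon> * C1 * L) + c1 * (\<epsilon> * C1) * P + \<epsilon> * G * (B * P)"
        proof -
          have eq: "h t - forcing y u g \<rho> t = g t * (D t * (- (Y t + y t) + c1 * u t)) + c1 * D t * \<rho> t
              + \<epsilon> * g t * ((c1 * Y t + c2) * \<rho> t)"
            unfolding h_def forcing_def D_def speed_def by (simp add: algebra_simps power2_eq_square)
          have sb: "\<bar>- (Y t + y t) + c1 * u t\<bar> \<le> L"
            using slope_le Yb[OF t] yb[OF t] admD(2)[OF u t] by blast
          have "\<bar>g t * (D t * (- (Y t + y t) + c1 * u t))\<bar> \<le> G * (\<epsilon> * C1 * L)"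
            unfolding abs_mult using G(2)[OF t] Db[OF t] sb G(1) cpos e by (intro mult_mono) auto
          moreover have "\<bar>c1 * D t * \<rho> t\<bar> \<le> c1 * (\<epsilon> * C1) * P"
            unfolding abs_mult using Db[OF t] P(2)[OF t] c1 cpos e by (intro mult_mono) auto
          moreover have "\<bar>\<epsilon> * g t * ((c1 * Y t + c2) * \<rho> t)\<bar> \<le> \<epsilon> * G * (B * P)"
            unfolding abs_mult using G(1) G(2)[OF t] P(2)[OF t] b_bound(3) Yb[OF t] B_pos e by (intro mult_mono) auto
          ultimately show ?thesis unfolding eq by linarith
        qed
        then have "\<bar>\<epsilon> * (h t - forcing y u g \<rho> t)\<bar> \<le> \<epsilon> * (G * (\<epsilon> * C1 * L) + c1 * (\<epsilon> * C1) * P + \<epsilon> * G * (B * P))"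
          unfolding abs_mult using e by (intro mult_mono) auto
        ultimately have "\<bar>r t\<bar> \<le> (\<epsilon> * C1)\<^sup>2 + \<epsilon> * (G * (\<epsilon> * C1 * L) + c1 * (\<epsilon> * C1) * P + \<epsilon> * G * (B * P))"
          using zero_le_power2[of "D t"] unfolding r_def by linarith
        also have "\<dots> = \<epsilon>\<^sup>2 * (C1\<^sup>2 + (G * (C1 * L) + (c1 * C1) * P + G * (B * P)))"
          by (simp add: algebra_simps power2_eq_square)
        finally show ?thesis .
      qed
      have "primitive t0 t1 (\<lambda>t. D t - \<epsilon> * shift y u g \<rho> t)
          (\<lambda>t. (- (Y t + y t) + c1 * u t) * D t + \<epsilon> * h t - \<epsilon> * (slope y u t * shift y u g \<rho> t + forcing y u g \<rho> t))"
        by (intro primitive_diff pD1 primitive_cmult primitive_shift my mu g \<rho>)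
      then have p: "primitive t0 t1 (\<lambda>t. D t - \<epsilon> * shift y u g \<rho> t)
          (\<lambda>t. slope y u t * (D t - \<epsilon> * shift y u g \<rho> t) + r t)"
        by (rule primitive_cong) (auto simp: slope_def r_def D_def algebra_simps power2_eq_square)
      have "\<bar>D t - \<epsilon> * shift y u g \<rho> t\<bar> \<le> (\<epsilon>\<^sup>2 * (C1\<^sup>2 + (G * (C1 * L) + (c1 * C1) * P + G * (B * P))))
          * ((t1 - t0) * exp (2 * L * (t1 - t0)))"
      proof (rule linear_bound[OF p bdd_meas_slope[OF my mu] mr _ _ rb t])
        show "D t0 - \<epsilon> * shift y u g \<rho> t0 = 0" using D0 by (simp add: shift_def)
        show "\<bar>slope y u t\<bar> \<le> L" if "t \<in> {t0..t1}" for t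
          using slope_le[of "y t" "y t" "u t"] yb[OF that] admD(2)[OF u that] unfolding slope_def by simp
      qed
      then show "\<bar>X (clock g \<epsilon> t) - y t - \<epsilon> * shift y u g \<rho> t\<bar> \<le> C * \<epsilon>\<^sup>2"
        unfolding D_def C_def K_def Y_def by (simp add: mult_ac)
    qed
  qed
  with cpos(3) show thesis by (rule that)
qed

definition jump_lo :: "real \<Rightarrow> real" where "jump_lo th = (if th < t1 then 1 / max_speed else 0)"

lemma tendsto_at_right_0:
  fixes f :: "real \<Rightarrow> real"
  assumes "continuous_on UNIV f" shows "(f \<longlongrightarrow> f 0) (at_right 0)"
proof -
  have "isCont f 0" using assms by (simp add: continuous_on_eq_continuous_at)
  then show ?thesis unfolding isCont_def by (rule tendsto_within_subset) simp
qed

text \<open>A displacement \<open>\<epsilon> d\<close> at the crossing shifts the crossing time, relative to the clock, by about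
  \<open>\<epsilon> d / (a + b u)\<close>. As \<open>u\<close> may oscillate there, only the two extreme speeds give a bound.\<close>

lemma varied_crossing:
  assumes u: "adm u" and d: "direction u g \<rho>"
    and y: "sol y0 u y" and y0: "0 \<le> y0" "y0 \<le> ys" and th: "th = crossing_time t0 t1 ys y"
    and \<kappa>1: "t0 < th \<Longrightarrow> th \<le> t1 \<Longrightarrow>
        max (jump_lo th * shift y u g \<rho> th) (1 / min_speed * shift y u g \<rho> th) < \<kappa>"
    and \<kappa>2: "\<not> (t0 < th \<and> th \<le> t1) \<Longrightarrow> \<kappa> = 0"
  shows "\<forall>\<^sub>F \<epsilon> in at_right 0. \<forall>v Y. varied u g \<rho> \<epsilon> v \<and> sol y0 v Y \<longrightarrow>
      growth y + \<epsilon> * (integral {t0..t1} (\<lambda>t. cf (y t) * g t) - cs * \<kappa>)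
        \<le> growth Y"
proof -
  have g: "bm g" and g0: "integral {t0..t1} g = 0"
    using d unfolding direction_def by (auto intro: bdd_meas_continuous)
  define \<gamma> where "\<gamma> = integral {t0..min th t1} g"
  have cfg: "integral {t0..t1} (\<lambda>t. cf (y t) * g t) = cs * \<gamma>"
    unfolding \<gamma>_def by (rule cf_integral[OF y u y0 th g])
  have th0: "t0 \<le> th" using y u y0(2) th by (rule crossing_cases) (use t01 in auto)
  then have cfy: "growth y = cs * (min th t1 - t0)"
    using cf_integral[OF y u y0 th bdd_meas_const[of _ _ 1]] t01 by simp
  define D where "D = shift y u g \<rho> (min th t1)"
  obtain C where C: "C > 0" and ev: "\<forall>\<^sub>F \<epsilon> in at_right 0. expands u g \<rho> y0 y C \<epsilon>"
    by (rule varied_expansion[OF u d y y0]) blast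
  have e0: "\<forall>\<^sub>F \<epsilon> in at_right 0. (0::real) < \<epsilon>"
    by (rule eventually_at_right_less)
  consider (a) "t0 < th" "th \<le> t1" "y th = ys" | (b) "th = t0" | (c) "th = t1 + 1" "y t1 < ys"
  proof (rule crossing_cases[OF y u y0(2) th])
    assume "th \<in> {t0..t1}" "y th = ys"
    then show thesis using a b by fastforce
  next
    assume "th = t1 + 1" "\<And>t. t \<in> {t0..t1} \<Longrightarrow> y t < ys"
    then show thesis using c t01 by auto
  qed
  then show ?thesis
  proof cases
    case b
    then have "\<gamma> = 0" "\<kappa> = 0" using t01 \<kappa>2 unfolding \<gamma>_def by auto
    moreover have "0 \<le> growth Y" if "sol y0 v Y" for v Y
      using cf_nonneg bdd_meas_integrable_on[OF bdd_meas_cf[OF solD(3)[OF that]]]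
      by (intro integral_nonneg) auto
    ultimately show ?thesis using b t01 unfolding cfg cfy by (intro always_eventually) auto
  next
    case c
    then have z: "\<gamma> = 0" "\<kappa> = 0" "min th t1 = t1" using t01 \<kappa>2 g0 unfolding \<gamma>_def by auto
    define q where "q \<epsilon> = y t1 - ys + \<epsilon> * D + C * \<epsilon>\<^sup>2" for \<epsilon> :: real
    have "continuous_on UNIV q" unfolding q_def by (intro continuous_intros)
    then have "(q \<longlongrightarrow> q 0) (at_right 0)" by (rule tendsto_at_right_0)
    moreover have "q 0 < 0" using c unfolding q_def by simp
    ultimately have "\<forall>\<^sub>F \<epsilon> in at_right 0. q \<epsilon> < 0" by (rule order_tendstoD(2))
    with ev show ?thesis
    proof eventually_elim
      case (elim \<epsilon>)
      show ?case
      proof (intro allI impI, elim conjE)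
        fix v Y assume v: "varied u g \<rho> \<epsilon> v" and Y: "sol y0 v Y"
        have "clock g \<epsilon> t1 = t1" unfolding clock_def using g0 by simp
        moreover have "\<bar>Y (clock g \<epsilon> t1) - y t1 - \<epsilon> * shift y u g \<rho> t1\<bar> \<le> C * \<epsilon>\<^sup>2"
          using elim v Y t01 unfolding expands_def by auto
        ultimately have "Y t1 < ys" using elim z unfolding q_def D_def by simp
        then have "cs * (t1 - t0) \<le> growth Y"
          using v t01 unfolding varied_def by (intro cf_integral_lower[OF Y _ y0(1)]) auto
        then show "growth y + \<epsilon> * (integral {t0..t1} (\<lambda>t. cf (y t) * g t) - cs * \<kappa>)
            \<le> growth Y"
          using z unfolding cfg cfy by simp
      qed
    qed
  next
    case a
    then have mth: "min th t1 = th" by simp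
    have \<kappa>: "jump_lo th * D < \<kappa>" "1 / min_speed * D < \<kappa>"
      using \<kappa>1 a unfolding D_def mth by auto
    define m where "m = (if \<kappa> \<ge> 0 then min_speed else max_speed)"
    have neg: "D - \<kappa> * m < 0"
    proof (cases "\<kappa> \<ge> 0")
      case True
      then show ?thesis using \<kappa>(2) min_speed_pos unfolding m_def by (simp add: divide_less_eq)
    next
      case False
      then have "jump_lo th \<noteq> 0" using \<kappa>(1) by auto
      then have "jump_lo th = 1 / max_speed" unfolding jump_lo_def by auto
      then show ?thesis using \<kappa>(1) False max_speed_pos unfolding m_def by (simp add: divide_less_eq)
    qed
    have \<kappa>0: "\<kappa> \<ge> 0" if "th = t1" using \<kappa>(1) that unfolding jump_lo_def by simp
    define q where "q \<epsilon> = (D - \<kappa> * m) + C * \<epsilon> + \<bar>\<kappa>\<bar> * (L * (\<epsilon> * \<bar>D\<bar> + C * \<epsilon>\<^sup>2 + B * (\<epsilon> * \<bar>\<kappa>\<bar>)))" for \<epsilon> :: real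
    have "continuous_on UNIV q" unfolding q_def by (intro continuous_intros)
    then have "(q \<longlongrightarrow> q 0) (at_right 0)" by (rule tendsto_at_right_0)
    moreover have "q 0 < 0" using neg unfolding q_def by simp
    ultimately have evq: "\<forall>\<^sub>F \<epsilon> in at_right 0. q \<epsilon> < 0" by (rule order_tendstoD(2))
    define S where "S \<epsilon> = th + \<epsilon> * (\<gamma> - \<kappa>)" for \<epsilon> :: real
    have "continuous_on UNIV S" unfolding S_def by (intro continuous_intros)
    then have limS: "(S \<longlongrightarrow> S 0) (at_right 0)" by (rule tendsto_at_right_0)
    have evS1: "\<forall>\<^sub>F \<epsilon> in at_right 0. t0 < S \<epsilon>"
      using a by (intro order_tendstoD(1)[OF limS]) (simp add: S_def)
    have evS2: "\<forall>\<^sub>F \<epsilon> in at_right 0. S \<epsilon> \<le> t1"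
    proof (cases "th = t1")
      case True
      then have \<gamma>0: "\<gamma> = 0" using g0 unfolding \<gamma>_def by simp
      from e0 show ?thesis
        by (rule eventually_mono) (use True \<kappa>0 \<gamma>0 in \<open>simp add: S_def\<close>)
    next
      case False
      then have "\<forall>\<^sub>F \<epsilon> in at_right 0. S \<epsilon> < t1"
        using a by (intro order_tendstoD(2)[OF limS]) (simp add: S_def)
      then show ?thesis by (rule eventually_mono) simp
    qed
    from ev evq evS1 evS2 e0 clock_time_change[OF d] show ?thesis
    proof eventually_elim
      case (elim \<epsilon>)
      interpret time_change t0 t1 "clock g \<epsilon>" "\<lambda>t. 1 + \<epsilon> * g t" using elim by simp
      show ?case
      proof (intro allI impI, elim conjE)
        fix v Y assume v: "varied u g \<rho> \<epsilon> v" and Y: "sol y0 v Y"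
        have av: "adm v" using v unfolding varied_def by simp
        define P where "P = Y (clock g \<epsilon> th)"
        have th_mem: "th \<in> {t0..t1}" using a by simp
        have "\<bar>P - ys - \<epsilon> * D\<bar> \<le> C * \<epsilon>\<^sup>2"
          using elim(1) v Y a unfolding P_def D_def mth expands_def by auto
        then have P1: "P \<le> ys + \<epsilon> * D + C * \<epsilon>\<^sup>2" and "\<bar>P - ys\<bar> \<le> \<bar>\<epsilon> * D\<bar> + C * \<epsilon>\<^sup>2" by linarith+
        then have P2: "\<bar>P - ys\<bar> \<le> \<epsilon> * \<bar>D\<bar> + C * \<epsilon>\<^sup>2" using elim by (simp add: abs_mult)
        have Sc: "S \<epsilon> = clock g \<epsilon> th - \<epsilon> * \<kappa>" unfolding S_def clock_def \<gamma>_def mth by (simp add: algebra_simps)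
        have Sm: "S \<epsilon> \<in> {t0..t1}" using elim by simp
        define W where "W = L * (\<bar>P - ys\<bar> + B * (\<epsilon> * \<bar>\<kappa>\<bar>))"
        have W: "W \<le> L * (\<epsilon> * \<bar>D\<bar> + C * \<epsilon>\<^sup>2 + B * (\<epsilon> * \<bar>\<kappa>\<bar>))"
          unfolding W_def using P2 L_pos by simp
        have "Y (S \<epsilon>) \<le> P - \<epsilon> * \<kappa> * m + \<epsilon> * \<bar>\<kappa>\<bar> * W"
        proof (cases "\<kappa> \<ge> 0")
          case True
          have "Y (S \<epsilon>) \<le> P - (\<epsilon> * \<kappa>) * (min_speed - L * (\<bar>P - ys\<bar> + B * (\<epsilon> * \<kappa>)))"
            using sol_near_crossing(1)[OF Y av y0 theta_mem[OF th_mem] Sm] True elim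
            unfolding Sc P_def by simp
          then show ?thesis using True unfolding W_def m_def by (simp add: algebra_simps)
        next
          case False
          have "Y (S \<epsilon>) \<le> P + (- (\<epsilon> * \<kappa>)) * (max_speed + L * (\<bar>P - ys\<bar> + B * (- (\<epsilon> * \<kappa>))))"
            using sol_near_crossing(2)[OF Y av y0 theta_mem[OF th_mem] Sm] False elim
            unfolding Sc P_def by (simp add: mult_le_0_iff)
          then show ?thesis using False unfolding W_def m_def by (simp add: algebra_simps)
        qed
        also have "\<dots> \<le> (ys + \<epsilon> * D + C * \<epsilon>\<^sup>2) - \<epsilon> * \<kappa> * m
            + \<epsilon> * \<bar>\<kappa>\<bar> * (L * (\<epsilon> * \<bar>D\<bar> + C * \<epsilon>\<^sup>2 + B * (\<epsilon> * \<bar>\<kappa>\<bar>)))"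
          using P1 W elim by (intro add_mono diff_right_mono mult_left_mono) auto
        also have "\<dots> = ys + \<epsilon> * q \<epsilon>"
          unfolding q_def by (simp add: algebra_simps power2_eq_square)
        also have "\<dots> < ys" using elim by (simp add: mult_less_0_iff)
        finally have "cs * (S \<epsilon> - t0) \<le> growth Y"
          by (intro cf_integral_lower[OF Y av y0(1) Sm])
        moreover have "cs * (S \<epsilon> - t0) = cs * (th - t0) + \<epsilon> * (cs * \<gamma> - cs * \<kappa>)"
          unfolding S_def by (simp add: algebra_simps)
        ultimately show "growth y + \<epsilon> * (integral {t0..t1} (\<lambda>t. cf (y t) * g t) - cs * \<kappa>)
            \<le> growth Y"
          unfolding cfg cfy mth by simp
      qed
    qed
  qed
qed

end

section \<open>Multipliers\<close>

lemma bdd_meas_AE_eq_0: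
  assumes f: "bdd_meas a b f" and nn: "\<And>t. t \<in> {a..b} \<Longrightarrow> 0 \<le> f t" and i: "integral {a..b} f \<le> 0"
  shows "AE t in lebesgue_on {a..b}. f t = 0"
proof -
  have int: "integrable (lebesgue_on {a..b}) f"
    using bdd_meas_abs_integrable[OF f]
    by (simp add: integrable_restrict_space set_integrable_def)
  have "integral {a..b} f = 0"
    using i nn by (intro antisym integral_nonneg bdd_meas_integrable_on[OF f]) auto
  then have "integral\<^sup>L (lebesgue_on {a..b}) f = 0"
    using lebesgue_integral_eq_integral[OF int] by simp
  moreover have "AE t in lebesgue_on {a..b}. 0 \<le> f t"
    using nn by (intro AE_I2) (simp add: space_restrict_space)
  ultimately show ?thesis using integral_nonneg_eq_0_iff_AE[OF int] by simp
qed

lemma bdd_meas_orthogonal_continuous: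
  assumes f: "bdd_meas a b f" and orth: "\<And>g. continuous_on {a..b} g \<Longrightarrow> integral {a..b} (\<lambda>t. f t * g t) = 0"
  shows "AE t in lebesgue_on {a..b}. f t = 0"
proof -
  obtain M where M: "M > 0" "\<And>t. t \<in> {a..b} \<Longrightarrow> \<bar>f t\<bar> \<le> M" by (rule bdd_meas_bound[OF f]) blast
  have "f measurable_on {a..b}"
    using f unfolding bdd_meas_def by (subst measurable_on_iff_borel_measurable) auto
  then obtain Z g where Z: "negligible Z" and g: "\<And>n. continuous_on UNIV (g n)"
      and lim: "\<And>x. x \<notin> Z \<Longrightarrow> (\<lambda>n. g n x) \<longlonglongrightarrow> (if x \<in> {a..b} then f x else 0)"
    unfolding measurable_on_def by blast
  define q where "q n x = max (- M) (min M (g n x))" for n :: nat and x :: real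
  have q: "continuous_on {a..b} (q n)" for n
    unfolding q_def using g[of n] by (intro continuous_intros) (auto intro: continuous_on_subset)
  define k where "k n x = (if x \<in> Z then 0 else f x * q n x)" for n x
  define k' where "k' x = (if x \<in> Z then 0 else f x * f x)" for x
  have m: "bdd_meas a b (\<lambda>t. f t * q n t)" for n by (intro bdd_meas_intros f bdd_meas_continuous q)
  have "(\<lambda>n. integral {a..b} (k n)) \<longlonglongrightarrow> integral {a..b} k'"
  proof (rule dominated_convergence(2)[where h="\<lambda>_. M * M"])
    show "k n integrable_on {a..b}" for n
      by (rule integrable_spike[OF bdd_meas_integrable_on[OF m] Z]) (auto simp: k_def)
    fix x assume x: "x \<in> {a..b}"
    show "norm (k n x) \<le> M * M" for n
    proof (cases "x \<in> Z")
      case False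
      have "\<bar>f x\<bar> * \<bar>q n x\<bar> \<le> M * M" using M(1) M(2)[OF x] by (intro mult_mono) (auto simp: q_def)
      then show ?thesis using False by (simp add: k_def abs_mult)
    qed (use M in \<open>simp add: k_def\<close>)
    show "(\<lambda>n. k n x) \<longlonglongrightarrow> k' x"
    proof (cases "x \<in> Z")
      case False
      have "(\<lambda>n. max (- M) (min M (g n x))) \<longlonglongrightarrow> max (- M) (min M (f x))"
        using lim[OF False] x by (intro tendsto_intros) auto
      also have "max (- M) (min M (f x)) = f x" using M(2)[OF x] by auto
      finally have "(\<lambda>n. f x * q n x) \<longlonglongrightarrow> f x * f x" unfolding q_def by (intro tendsto_intros)
      then show ?thesis using False by (simp add: k_def k'_def)
    qed (simp add: k_def k'_def)
  qed (use M in auto)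
  moreover have "integral {a..b} (k n) = 0" for n
    using integral_spike[OF Z, of "{a..b}" "k n" "\<lambda>t. f t * q n t"] orth[OF q] by (simp add: k_def)
  ultimately have "integral {a..b} k' = 0" using LIMSEQ_unique[OF _ tendsto_const] by simp
  then have "integral {a..b} (\<lambda>t. f t * f t) = 0"
    using integral_spike[OF Z, of "{a..b}" k' "\<lambda>t. f t * f t"] by (simp add: k'_def)
  then have "AE t in lebesgue_on {a..b}. f t * f t = 0"
    by (intro bdd_meas_AE_eq_0 bdd_meas_mult f) auto
  then show ?thesis by (rule AE_mp) simp
qed

lemma bdd_meas_orthogonal_zero_mean:
  assumes "a < b" and f: "bdd_meas a b f"
    and orth: "\<And>g. continuous_on {a..b} g \<Longrightarrow> integral {a..b} g = 0 \<Longrightarrow> integral {a..b} (\<lambda>t. f t * g t) = 0"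
  obtains h where "AE t in lebesgue_on {a..b}. f t = h"
proof -
  define h where "h = integral {a..b} f / (b - a)"
  have "integral {a..b} (\<lambda>t. (f t - h) * g t) = 0" if g: "continuous_on {a..b} g" for g
  proof -
    define c where "c = integral {a..b} g / (b - a)"
    have mg: "bdd_meas a b g" by (rule bdd_meas_continuous[OF g])
    have hf: "(f has_integral h * (b - a)) {a..b}" and hg: "(g has_integral c * (b - a)) {a..b}"
      using bdd_meas_integrable_on[OF f] bdd_meas_integrable_on[OF mg] assms(1)
      unfolding h_def c_def by (auto simp: has_integral_iff)
    have hfg: "((\<lambda>t. f t * g t) has_integral integral {a..b} (\<lambda>t. f t * g t)) {a..b}"
      by (intro integrable_integral bdd_meas_integrable_on[of a b] bdd_meas_mult f mg) auto
    have hc: "((\<lambda>t. c) has_integral c * (b - a)) {a..b}"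
      using has_integral_const_real[of c a b] assms(1) by (simp add: mult.commute)
    have "integral {a..b} (\<lambda>t. g t - c) = 0"
      using integral_unique[OF has_integral_diff[OF hg hc]] by simp
    then have "integral {a..b} (\<lambda>t. f t * (g t - c)) = 0"
      using g by (intro orth continuous_intros)
    moreover have "((\<lambda>t. f t * g t - f t * c) has_integral
        integral {a..b} (\<lambda>t. f t * g t) - h * (b - a) * c) {a..b}"
      by (intro has_integral_diff hfg has_integral_mult_left hf)
    then have "integral {a..b} (\<lambda>t. f t * (g t - c)) = integral {a..b} (\<lambda>t. f t * g t) - h * (b - a) * c"
      by (simp add: right_diff_distrib integral_unique)
    moreover have "((\<lambda>t. f t * g t - h * g t) has_integral
        integral {a..b} (\<lambda>t. f t * g t) - h * (c * (b - a))) {a..b}"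
      by (intro has_integral_diff hfg has_integral_mult_right hg)
    then have "integral {a..b} (\<lambda>t. (f t - h) * g t) = integral {a..b} (\<lambda>t. f t * g t) - h * (c * (b - a))"
      by (simp add: left_diff_distrib integral_unique)
    ultimately show ?thesis by (simp add: mult_ac)
  qed
  then have "AE t in lebesgue_on {a..b}. f t - h = 0"
    by (intro bdd_meas_orthogonal_continuous bdd_meas_diff f bdd_meas_const)
  then have "AE t in lebesgue_on {a..b}. f t = h" by (rule AE_mp) simp
  then show thesis by (rule that)
qed

context control_setting
begin

lemma shift_combine:
  assumes "bm y" "bm u" "bm g1" "bm \<rho>1"
    "bm g2" "bm \<rho>2" "t \<in> {t0..t1}"
  shows "shift y u (\<lambda>r. s1 * g1 r + s2 * g2 r) (\<lambda>r. s1 * \<rho>1 r + s2 * \<rho>2 r) t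
    = s1 * shift y u g1 \<rho>1 t + s2 * shift y u g2 \<rho>2 t"
proof -
  let ?g = "\<lambda>r. s1 * g1 r + s2 * g2 r" and ?\<rho> = "\<lambda>r. s1 * \<rho>1 r + s2 * \<rho>2 r"
  have m: "bm (\<lambda>r. forcing y u g \<rho> r * (1 / flow y u r))"
    if "bm g" "bm \<rho>" for g \<rho>
    by (intro bdd_meas_intros bdd_meas_forcing assms that primitive_bdd_meas'[OF primitive_inverse_flow])
  have i: "(\<lambda>r. forcing y u g1 \<rho>1 r / flow y u r) integrable_on {t0..t}"
    "(\<lambda>r. forcing y u g2 \<rho>2 r / flow y u r) integrable_on {t0..t}"
    using bdd_meas_integrable_on[OF m, of g1 \<rho>1 t0 t] bdd_meas_integrable_on[OF m, of g2 \<rho>2 t0 t] assms by auto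
  have "((\<lambda>r. s1 * (forcing y u g1 \<rho>1 r / flow y u r) + s2 * (forcing y u g2 \<rho>2 r / flow y u r)) has_integral
      s1 * integral {t0..t} (\<lambda>r. forcing y u g1 \<rho>1 r / flow y u r) + s2 * integral {t0..t} (\<lambda>r. forcing y u g2 \<rho>2 r / flow y u r)) {t0..t}"
    by (intro has_integral_add has_integral_mult_right integrable_integral i)
  moreover have "s1 * (forcing y u g1 \<rho>1 r / flow y u r) + s2 * (forcing y u g2 \<rho>2 r / flow y u r)
      = forcing y u ?g ?\<rho> r / flow y u r" for r
    using flow_pos[of y u r] by (simp add: forcing_def field_simps)
  ultimately have "integral {t0..t} (\<lambda>r. forcing y u ?g ?\<rho> r / flow y u r)
      = s1 * integral {t0..t} (\<lambda>r. forcing y u g1 \<rho>1 r / flow y u r) + s2 * integral {t0..t} (\<lambda>r. forcing y u g2 \<rho>2 r / flow y u r)"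
    by (simp add: integral_unique)
  then show ?thesis unfolding shift_def by (simp add: algebra_simps)
qed

lemma direction_combine:
  assumes u: "adm u" and d1: "direction u g1 \<rho>1" and d2: "direction u g2 \<rho>2" and s: "s1 \<ge> 0" "s2 \<ge> 0"
  shows "direction u (\<lambda>r. s1 * g1 r + s2 * g2 r) (\<lambda>r. s1 * \<rho>1 r + s2 * \<rho>2 r)"
proof -
  have g: "continuous_on {t0..t1} g1" "continuous_on {t0..t1} g2" "integral {t0..t1} g1 = 0" "integral {t0..t1} g2 = 0"
    and \<rho>: "bm \<rho>1" "bm \<rho>2"
    using d1 d2 unfolding direction_def by auto
  obtain r1 where r1: "r1 > 0" "\<And>\<epsilon> t. \<epsilon> \<in> {0..r1} \<Longrightarrow> t \<in> {t0..t1} \<Longrightarrow> u t + \<epsilon> * \<rho>1 t \<in> {w..1}"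
    using d1 unfolding direction_def by blast
  obtain r2 where r2: "r2 > 0" "\<And>\<epsilon> t. \<epsilon> \<in> {0..r2} \<Longrightarrow> t \<in> {t0..t1} \<Longrightarrow> u t + \<epsilon> * \<rho>2 t \<in> {w..1}"
    using d2 unfolding direction_def by blast
  have "(g1 has_integral 0) {t0..t1}" "(g2 has_integral 0) {t0..t1}"
    using g by (auto simp: has_integral_iff integrable_continuous_real)
  then have "((\<lambda>r. s1 * g1 r + s2 * g2 r) has_integral s1 * 0 + s2 * 0) {t0..t1}"
    by (intro has_integral_add has_integral_mult_right)
  then have "integral {t0..t1} (\<lambda>r. s1 * g1 r + s2 * g2 r) = 0" by (simp add: integral_unique)
  moreover have "continuous_on {t0..t1} (\<lambda>r. s1 * g1 r + s2 * g2 r)" by (intro continuous_intros g)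
  moreover have "bm (\<lambda>r. s1 * \<rho>1 r + s2 * \<rho>2 r)" by (intro bdd_meas_intros \<rho>)
  moreover have "\<exists>r>0. \<forall>\<epsilon>\<in>{0..r}. \<forall>t\<in>{t0..t1}. u t + \<epsilon> * (s1 * \<rho>1 t + s2 * \<rho>2 t) \<in> {w..1}"
  proof (cases "s1 + s2 = 0")
    case True
    then have "s1 = 0" "s2 = 0" using s by auto
    then show ?thesis using admD(2)[OF u] by (intro exI[of _ 1]) auto
  next
    case False
    define S where "S = s1 + s2"
    have S: "S > 0" using False s unfolding S_def by auto
    define r where "r = min r1 r2 / S"
    have "u t + \<epsilon> * (s1 * \<rho>1 t + s2 * \<rho>2 t) \<in> {w..1}" if e: "\<epsilon> \<in> {0..r}" and t: "t \<in> {t0..t1}" for \<epsilon> t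
    proof -
      have "\<epsilon> * S \<le> min r1 r2" using e S unfolding r_def by (simp add: le_divide_eq)
      then have A: "u t + (\<epsilon> * S) * \<rho>1 t \<in> {w..1}" "u t + (\<epsilon> * S) * \<rho>2 t \<in> {w..1}"
        using r1(2)[of "\<epsilon> * S" t] r2(2)[of "\<epsilon> * S" t] e t S by auto
      have eq: "u t + \<epsilon> * (s1 * \<rho>1 t + s2 * \<rho>2 t)
          = (s1 / S) *\<^sub>R (u t + (\<epsilon> * S) * \<rho>1 t) + (s2 / S) *\<^sub>R (u t + (\<epsilon> * S) * \<rho>2 t)"
      proof -
        define p q where "p = s1 / S" and "q = s2 / S"
        have pq: "s1 = p * S" "s2 = q * S" "q = 1 - p"
          using S unfolding p_def q_def S_def by (auto simp: field_simps)
        show ?thesis unfolding p_def[symmetric] q_def[symmetric] real_scaleR_def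
          unfolding pq(1,2) unfolding pq(3) by (simp add: algebra_simps)
      qed
      show ?thesis unfolding eq
        by (rule convexD[OF convex_real_interval(5) A]) (use s S in \<open>auto simp: S_def simp flip: add_divide_distrib\<close>)
    qed
    then show ?thesis using S r1(1) r2(1) unfolding r_def by (intro exI[of _ "min r1 r2 / S"]) auto
  qed
  ultimately show ?thesis unfolding direction_def by blast
qed

end

locale optimal_setting = control_setting +
  fixes N :: nat and y0 z0 :: "nat \<Rightarrow> real" and u :: "real \<Rightarrow> real" and y :: "nat \<Rightarrow> real \<Rightarrow> real" and th :: "nat \<Rightarrow> real"
  assumes u: "adm u"
    and y0: "\<And>k. k \<in> {1..N} \<Longrightarrow> 0 \<le> y0 k" "\<And>k. k \<in> {1..N} \<Longrightarrow> y0 k \<le> ys"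
    and z0: "\<And>k. k \<in> {1..N} \<Longrightarrow> z0 k > 0"
    and y: "\<And>k. k \<in> {1..N} \<Longrightarrow> sol (y0 k) u (y k)"
    and th: "\<And>k. k \<in> {1..N} \<Longrightarrow> th k = crossing_time t0 t1 ys (y k)"
    and optimal: "\<And>v Y. adm v \<Longrightarrow> (\<And>k. k \<in> {1..N} \<Longrightarrow> sol (y0 k) v (Y k)) \<Longrightarrow>
      (\<Sum>k=1..N. Y k t1 * (z0 k * exp (growth (Y k))))
        \<le> (\<Sum>k=1..N. y k t1 * (z0 k * exp (growth (y k))))"
begin

definition z_end :: "nat \<Rightarrow> real" where "z_end k = z0 k * exp (growth (y k))"
definition Q :: "nat \<Rightarrow> real" where "Q k = y k t1 * z_end k"
definition crossers :: "nat set" where "crossers = {k \<in> {1..N}. t0 < th k \<and> th k \<le> t1}"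

lemma my: "k \<in> {1..N} \<Longrightarrow> bm (y k)" using solD(3)[OF y] .
lemma mu: "bm u" using admD(1)[OF u] .

lemma z_end_pos: "k \<in> {1..N} \<Longrightarrow> z_end k > 0" using z0 unfolding z_end_def by simp

lemma Q_nonneg: "k \<in> {1..N} \<Longrightarrow> Q k \<ge> 0"
  using sol_nonneg[OF y u y0(1), of k t1] z_end_pos[of k] t01 unfolding Q_def by simp

lemma first_variation:
  assumes d: "direction u g \<rho>"
    and \<kappa>1: "\<And>k. k \<in> crossers \<Longrightarrow>
      max (jump_lo (th k) * shift (y k) u g \<rho> (th k)) (1 / min_speed * shift (y k) u g \<rho> (th k)) < \<kappa> k"
    and \<kappa>2: "\<And>k. k \<in> {1..N} \<Longrightarrow> k \<notin> crossers \<Longrightarrow> \<kappa> k = 0"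
  shows "(\<Sum>k=1..N. z_end k * (shift (y k) u g \<rho> t1 +
      (integral {t0..t1} (\<lambda>t. cf (y k t) * g t) - cs * \<kappa> k) * y k t1)) \<le> 0"
proof -
  define \<gamma> where "\<gamma> k = integral {t0..t1} (\<lambda>t. cf (y k t) * g t) - cs * \<kappa> k" for k
  define \<delta> where "\<delta> k = shift (y k) u g \<rho> t1" for k
  have g0: "integral {t0..t1} g = 0" using d unfolding direction_def by auto
  have "\<forall>k\<in>{1..N}. \<exists>C>0. \<forall>\<^sub>F \<epsilon> in at_right 0. expands u g \<rho> (y0 k) (y k) C \<epsilon>"
  proof
    fix k assume k: "k \<in> {1..N}"
    show "\<exists>C>0. \<forall>\<^sub>F \<epsilon> in at_right 0. expands u g \<rho> (y0 k) (y k) C \<epsilon>"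
      by (rule varied_expansion[OF u d y[OF k] y0(1)[OF k] y0(2)[OF k]]) blast
  qed
  from bchoice[OF this] obtain C where C: "\<And>k. k \<in> {1..N} \<Longrightarrow> C k > 0"
    and evC: "\<And>k. k \<in> {1..N} \<Longrightarrow> \<forall>\<^sub>F \<epsilon> in at_right 0. expands u g \<rho> (y0 k) (y k) (C k) \<epsilon>" by blast
  have evC': "\<forall>\<^sub>F \<epsilon> in at_right 0. \<forall>k\<in>{1..N}. expands u g \<rho> (y0 k) (y k) (C k) \<epsilon>"
    using evC by (intro eventually_ball_finite) auto
  have evT: "\<forall>\<^sub>F \<epsilon> in at_right 0. \<forall>k\<in>{1..N}. \<forall>v Y. varied u g \<rho> \<epsilon> v \<and> sol (y0 k) v Y \<longrightarrow>
      growth (y k) + \<epsilon> * \<gamma> k \<le> growth Y"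
    unfolding \<gamma>_def
  proof (intro eventually_ball_finite ballI varied_crossing[OF u d y y0 th])
    fix k assume k: "k \<in> {1..N}"
    show "max (jump_lo (th k) * shift (y k) u g \<rho> (th k)) (1 / min_speed * shift (y k) u g \<rho> (th k)) < \<kappa> k"
      if "t0 < th k" "th k \<le> t1" using \<kappa>1[of k] k that unfolding crossers_def by blast
    show "\<kappa> k = 0" if "\<not> (t0 < th k \<and> th k \<le> t1)" using \<kappa>2[OF k] that unfolding crossers_def by blast
  qed auto
  define p where "p k \<epsilon> = (\<delta> k - C k * \<epsilon>) + \<gamma> k * y k t1 - \<bar>\<gamma> k\<bar> * (\<epsilon> * \<bar>\<delta> k\<bar> + C k * \<epsilon>\<^sup>2)" for k \<epsilon>
  have ev0: "\<forall>\<^sub>F \<epsilon> in at_right 0. (0::real) < \<epsilon>" by (rule eventually_at_right_less)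
  have ev: "\<forall>\<^sub>F \<epsilon> in at_right 0. (\<Sum>k=1..N. z_end k * p k \<epsilon>) \<le> 0"
    using varied_exists[OF u d] evC' evT ev0
  proof eventually_elim
    case (elim \<epsilon>)
    then obtain v where v: "varied u g \<rho> \<epsilon> v" by blast
    have av: "adm v" using v unfolding varied_def by simp
    have "\<forall>k\<in>{1..N}. \<exists>Y. sol (y0 k) v Y"
    proof
      fix k assume k: "k \<in> {1..N}"
      show "\<exists>Y. sol (y0 k) v Y" by (rule sol_exists[OF av y0(1)[OF k] y0(2)[OF k]]) blast
    qed
    from bchoice[OF this] obtain Y where Y: "\<And>k. k \<in> {1..N} \<Longrightarrow> sol (y0 k) v (Y k)" by blast
    have "(\<Sum>k=1..N. z_end k * (\<epsilon> * p k \<epsilon>)) \<le> (\<Sum>k=1..N. Y k t1 * (z0 k * exp (growth (Y k))) - y k t1 * z_end k)"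
    proof (rule sum_mono)
      fix k assume k: "k \<in> {1..N}"
      have "clock g \<epsilon> t1 = t1" unfolding clock_def using g0 by simp
      then have "\<bar>Y k t1 - y k t1 - \<epsilon> * \<delta> k\<bar> \<le> C k * \<epsilon>\<^sup>2"
        using elim(2) k v Y[OF k] t01 unfolding \<delta>_def expands_def
        by (metis atLeastAtMost_iff less_imp_le order_refl)
      then have Y1: "Y k t1 - y k t1 \<ge> \<epsilon> * \<delta> k - C k * \<epsilon>\<^sup>2" and "\<bar>Y k t1 - y k t1\<bar> \<le> \<bar>\<epsilon> * \<delta> k\<bar> + C k * \<epsilon>\<^sup>2" by linarith+
      then have Y2: "\<bar>Y k t1 - y k t1\<bar> \<le> \<epsilon> * \<bar>\<delta> k\<bar> + C k * \<epsilon>\<^sup>2" using elim by (simp add: abs_mult)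
      have Y0: "Y k t1 \<ge> 0" using sol_nonneg[OF Y[OF k] av y0(1)[OF k], of t1] t01 by simp
      have "\<bar>\<gamma> k * (Y k t1 - y k t1)\<bar> \<le> \<bar>\<gamma> k\<bar> * (\<epsilon> * \<bar>\<delta> k\<bar> + C k * \<epsilon>\<^sup>2)"
        unfolding abs_mult using Y2 by (intro mult_left_mono) auto
      then have "- (\<bar>\<gamma> k\<bar> * (\<epsilon> * \<bar>\<delta> k\<bar> + C k * \<epsilon>\<^sup>2)) \<le> \<gamma> k * (Y k t1 - y k t1)" by linarith
      then have "\<epsilon> * - (\<bar>\<gamma> k\<bar> * (\<epsilon> * \<bar>\<delta> k\<bar> + C k * \<epsilon>\<^sup>2)) \<le> \<epsilon> * (\<gamma> k * (Y k t1 - y k t1))"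
        using elim by (intro mult_left_mono) auto
      then have "\<epsilon> * p k \<epsilon> \<le> Y k t1 * (1 + \<epsilon> * \<gamma> k) - y k t1"
        using Y1 unfolding p_def by (simp add: algebra_simps power2_eq_square)
      then have "z_end k * (\<epsilon> * p k \<epsilon>) \<le> z_end k * (Y k t1 * (1 + \<epsilon> * \<gamma> k) - y k t1)"
        using z_end_pos[OF k] by (intro mult_left_mono) auto
      also have "\<dots> = Y k t1 * (z_end k * (1 + \<epsilon> * \<gamma> k)) - y k t1 * z_end k" by (simp add: algebra_simps)
      also have "\<dots> \<le> Y k t1 * (z0 k * exp (growth (Y k))) - y k t1 * z_end k"
      proof (intro diff_right_mono mult_left_mono[OF _ Y0])
        have "z_end k * (1 + \<epsilon> * \<gamma> k) \<le> z_end k * exp (\<epsilon> * \<gamma> k)"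
          using z_end_pos[OF k] by (intro mult_left_mono exp_ge_add_one_self) auto
        also have "\<dots> = z0 k * exp (growth (y k) + \<epsilon> * \<gamma> k)"
          by (simp add: z_end_def exp_add)
        also have "\<dots> \<le> z0 k * exp (growth (Y k))"
          using elim(3) k v Y[OF k] z0[OF k] by (intro mult_left_mono) auto
        finally show "z_end k * (1 + \<epsilon> * \<gamma> k) \<le> z0 k * exp (growth (Y k))" .
      qed
      finally show "z_end k * (\<epsilon> * p k \<epsilon>) \<le> Y k t1 * (z0 k * exp (growth (Y k))) - y k t1 * z_end k" .
    qed
    also have "\<dots> \<le> 0"
      using optimal[OF av Y] unfolding sum_subtractf z_end_def by simp
    finally have "\<epsilon> * (\<Sum>k=1..N. z_end k * p k \<epsilon>) \<le> 0"
      by (simp add: sum_distrib_left mult_ac)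
    then show ?case using elim by (simp add: mult_le_0_iff)
  qed
  have "continuous_on UNIV (\<lambda>\<epsilon>. \<Sum>k=1..N. z_end k * p k \<epsilon>)"
    unfolding p_def by (intro continuous_intros)
  from tendsto_at_right_0[OF this] have "(\<Sum>k=1..N. z_end k * p k 0) \<le> 0"
    using ev by (rule tendsto_upperbound) simp
  then show ?thesis unfolding p_def \<delta>_def \<gamma>_def by (simp add: algebra_simps)
qed

abbreviation "\<Delta> d k \<equiv> shift (y k) u (fst d) (snd d)"

definition A :: "(real \<Rightarrow> real) \<times> (real \<Rightarrow> real) \<Rightarrow> real" where
  "A d = (\<Sum>k=1..N. z_end k * \<Delta> d k t1 + Q k * integral {t0..t1} (\<lambda>t. cf (y k t) * fst d t))"

definition loss :: "(real \<Rightarrow> real) \<times> (real \<Rightarrow> real) \<Rightarrow> nat \<Rightarrow> real" where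
  "loss d k = max (cs * Q k * jump_lo (th k) * \<Delta> d k (th k)) (cs * Q k / min_speed * \<Delta> d k (th k))"

lemma first_variation_max:
  assumes d: "direction u (fst d) (snd d)"
  shows "A d \<le> (\<Sum>k\<in>crossers. loss d k)"
proof -
  define m where "m k = max (jump_lo (th k) * \<Delta> d k (th k)) (1 / min_speed * \<Delta> d k (th k))" for k
  have sub: "crossers \<subseteq> {1..N}" unfolding crossers_def by blast
  define M where "M = (\<Sum>k\<in>crossers. cs * Q k)"
  have M0: "M \<ge> 0" unfolding M_def using sub Q_nonneg cs by (intro sum_nonneg mult_nonneg_nonneg) auto
  have key: "A d \<le> (\<Sum>k\<in>crossers. cs * Q k * m k) + \<tau> * M" if \<tau>: "\<tau> > 0" for \<tau>
  proof -
    define \<kappa> where "\<kappa> k = (if k \<in> crossers then m k + \<tau> else 0)" for k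
    have "(\<Sum>k=1..N. z_end k * (\<Delta> d k t1 +
      (integral {t0..t1} (\<lambda>t. cf (y k t) * fst d t) - cs * \<kappa> k) * y k t1)) \<le> 0" (is "?S \<le> 0")
      by (rule first_variation[OF d]) (use \<tau> in \<open>auto simp: \<kappa>_def m_def\<close>)
    moreover have "?S = A d - (\<Sum>k=1..N. cs * Q k * \<kappa> k)"
      unfolding A_def sum_subtractf[symmetric] by (intro sum.cong) (auto simp: Q_def algebra_simps)
    moreover have "(\<Sum>k=1..N. cs * Q k * \<kappa> k) = (\<Sum>k\<in>crossers. cs * Q k * \<kappa> k)"
      using sub by (intro sum.mono_neutral_right) (auto simp: \<kappa>_def)
    moreover have "(\<Sum>k\<in>crossers. cs * Q k * \<kappa> k) = (\<Sum>k\<in>crossers. cs * Q k * m k) + \<tau> * M"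
      unfolding M_def sum_distrib_left sum.distrib[symmetric]
      by (intro sum.cong) (auto simp: \<kappa>_def algebra_simps)
    ultimately show ?thesis by simp
  qed
  have "A d \<le> (\<Sum>k\<in>crossers. cs * Q k * m k)"
  proof (rule field_le_epsilon)
    fix e :: real assume e: "e > 0"
    have "e / (M + 1) * M \<le> e" using e M0 by (simp add: divide_le_eq)
    then show "A d \<le> (\<Sum>k\<in>crossers. cs * Q k * m k) + e"
      using key[of "e / (M + 1)"] e M0 by simp
  qed
  also have "\<dots> = (\<Sum>k\<in>crossers. loss d k)"
  proof (rule sum.cong)
    fix k assume "k \<in> crossers"
    then have "cs * Q k \<ge> 0" using sub Q_nonneg cs by auto
    then show "cs * Q k * m k = loss d k"
      unfolding m_def loss_def by (simp add: max_mult_distrib_left mult.assoc)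
  qed simp
  finally show ?thesis .
qed

lemma multipliers:
  "\<exists>\<eta>. (\<forall>k\<in>crossers. \<eta> k \<in> {cs * Q k * jump_lo (th k)..cs * Q k / min_speed}) \<and>
    (\<forall>d\<in>{d. direction u (fst d) (snd d)}. A d \<le> (\<Sum>k\<in>crossers. \<eta> k * \<Delta> d k (th k)))"
proof -
  have sub: "crossers \<subseteq> {1..N}" unfolding crossers_def by blast
  show ?thesis
  proof (rule minimax)
    show "finite crossers" using sub finite_subset by blast
    show "A d \<le> (\<Sum>k\<in>crossers. max (cs * Q k * jump_lo (th k) * \<Delta> d k (th k)) (cs * Q k / min_speed * \<Delta> d k (th k)))" if "d \<in> {d. direction u (fst d) (snd d)}" for d
      using first_variation_max that by (simp add: loss_def)
    show "cs * Q k * jump_lo (th k) \<le> cs * Q k / min_speed" if "k \<in> crossers" for k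
    proof -
      have "jump_lo (th k) \<le> 1 / min_speed"
        using min_speed_pos min_speed_less_max_speed unfolding jump_lo_def by (simp add: frac_le)
      then have "cs * Q k * jump_lo (th k) \<le> cs * Q k * (1 / min_speed)"
        using that sub Q_nonneg cs by (intro mult_left_mono) auto
      then show ?thesis by simp
    qed
  next
    fix d1 d2 and s1 s2 :: real
    assume d: "d1 \<in> {d. direction u (fst d) (snd d)}" "d2 \<in> {d. direction u (fst d) (snd d)}"
      and s: "s1 \<ge> 0" "s2 \<ge> 0"
    define d where "d = ((\<lambda>r. s1 * fst d1 r + s2 * fst d2 r), (\<lambda>r. s1 * snd d1 r + s2 * snd d2 r))"
    have m: "bm (fst d1)" "bm (snd d1)" "bm (fst d2)" "bm (snd d2)"
      using d(1,2) unfolding direction_def by (auto intro: bdd_meas_continuous)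
    have "direction u (fst d) (snd d)"
      unfolding d_def fst_conv snd_conv by (rule direction_combine[OF u]) (use d(1,2) s in auto)
    moreover have shift: "\<Delta> d k t
        = s1 * \<Delta> d1 k t + s2 * \<Delta> d2 k t"
      if "k \<in> {1..N}" "t \<in> {t0..t1}" for k t
      unfolding d_def fst_conv snd_conv by (rule shift_combine[OF my[OF that(1)] mu m that(2)])
    moreover have "A d = s1 * A d1 + s2 * A d2"
    proof -
      have "integral {t0..t1} (\<lambda>t. cf (y k t) * fst d t) = s1 * integral {t0..t1} (\<lambda>t. cf (y k t) * fst d1 t)
          + s2 * integral {t0..t1} (\<lambda>t. cf (y k t) * fst d2 t)" if k: "k \<in> {1..N}" for k
      proof -
        have i: "(\<lambda>t. cf (y k t) * g t) integrable_on {t0..t1}" if "bm g" for g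
          by (intro bdd_meas_integrable_on[of t0 t1] bdd_meas_mult bdd_meas_cf my k that) auto
        have "((\<lambda>t. s1 * (cf (y k t) * fst d1 t) + s2 * (cf (y k t) * fst d2 t)) has_integral
          s1 * integral {t0..t1} (\<lambda>t. cf (y k t) * fst d1 t) + s2 * integral {t0..t1} (\<lambda>t. cf (y k t) * fst d2 t)) {t0..t1}"
          by (intro has_integral_add has_integral_mult_right integrable_integral i m)
        then show ?thesis unfolding d_def fst_conv by (intro integral_unique) (simp add: algebra_simps)
      qed
      then have "A d = (\<Sum>k=1..N. s1 * (z_end k * \<Delta> d1 k t1 + Q k * integral {t0..t1} (\<lambda>t. cf (y k t) * fst d1 t))
        + s2 * (z_end k * \<Delta> d2 k t1 + Q k * integral {t0..t1} (\<lambda>t. cf (y k t) * fst d2 t)))"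
        unfolding A_def using shift t01 by (intro sum.cong) (auto simp: algebra_simps)
      then show ?thesis unfolding A_def by (simp only: sum.distrib sum_distrib_left distrib_left)
    qed
    moreover have "\<forall>k\<in>crossers. k \<in> {1..N} \<and> th k \<in> {t0..t1}" unfolding crossers_def by auto
    ultimately show "\<exists>d\<in>{d. direction u (fst d) (snd d)}. A d = s1 * A d1 + s2 * A d2 \<and>
        (\<forall>k\<in>crossers. \<Delta> d k (th k)
          = s1 * \<Delta> d1 k (th k) + s2 * \<Delta> d2 k (th k))"
      by blast
  qed
qed

definition costate :: "(nat \<Rightarrow> real) \<Rightarrow> nat \<Rightarrow> real \<Rightarrow> real" where
  "costate \<eta> k t = (z_end k * flow (y k) u t1 - (if t < th k then if k \<in> crossers then \<eta> k * flow (y k) u (th k) else 0 else 0))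
     / flow (y k) u t"

lemma bdd_meas_costate: assumes k: "k \<in> {1..N}" shows "bm (costate \<eta> k)"
proof -
  have "bm (\<lambda>t. (z_end k * flow (y k) u t1 - (if t < th k then if k \<in> crossers then \<eta> k * flow (y k) u (th k) else 0 else 0))
     * (1 / flow (y k) u t))"
    by (intro bdd_meas_intros bdd_meas_if_less[where h="\<lambda>t. t"] primitive_bdd_meas'[OF primitive_inverse_flow]
        my[OF k] mu bdd_meas_continuous[OF continuous_on_id])
  then show ?thesis by (rule bdd_meas_cong) (simp add: costate_def)
qed

definition hamil :: "(nat \<Rightarrow> real) \<Rightarrow> real \<Rightarrow> real" where
  "hamil \<eta> t = (\<Sum>k=1..N. costate \<eta> k t * speed (y k t) (u t) + cf (y k t) * Q k)"

definition switching :: "(nat \<Rightarrow> real) \<Rightarrow> real \<Rightarrow> real" where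
  "switching \<eta> t = (\<Sum>k=1..N. costate \<eta> k t * (c1 * y k t + c2))"

lemma bdd_meas_hamil: "bm (hamil \<eta>)" and bdd_meas_switching: "bm (switching \<eta>)"
  unfolding hamil_def switching_def
  by (intro bdd_meas_intros bdd_meas_costate bdd_meas_speed bdd_meas_cf my mu; assumption)+

lemma variation_integral:
  assumes d: "direction u g \<rho>"
  shows "A (g, \<rho>) - (\<Sum>k\<in>crossers. \<eta> k * shift (y k) u g \<rho> (th k))
    = integral {t0..t1} (\<lambda>t. hamil \<eta> t * g t + switching \<eta> t * \<rho> t)"
proof -
  have m: "bm g" "bm \<rho>"
    using d unfolding direction_def by (auto intro: bdd_meas_continuous)
  have sub: "crossers \<subseteq> {1..N}" unfolding crossers_def by blast
  define e where "e k = (if k \<in> crossers then \<eta> k * flow (y k) u (th k) else 0)" for k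
  define q where "q k t = forcing (y k) u g \<rho> t / flow (y k) u t" for k t
  have mq: "bm (q k)" if k: "k \<in> {1..N}" for k
  proof -
    have "bm (\<lambda>t. forcing (y k) u g \<rho> t * (1 / flow (y k) u t))"
      by (intro bdd_meas_intros bdd_meas_forcing my[OF k] mu m primitive_bdd_meas'[OF primitive_inverse_flow])
    then show ?thesis by (rule bdd_meas_cong) (simp add: q_def)
  qed
  have summand: "z_end k * shift (y k) u g \<rho> t1 + Q k * integral {t0..t1} (\<lambda>t. cf (y k t) * g t)
      - (if k \<in> crossers then \<eta> k * shift (y k) u g \<rho> (th k) else 0)
      = integral {t0..t1} (\<lambda>t. costate \<eta> k t * forcing (y k) u g \<rho> t + Q k * (cf (y k t) * g t))"
    if k: "k \<in> {1..N}" for k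
  proof -
    have i1: "q k integrable_on {t0..t1}" using bdd_meas_integrable_on[OF mq[OF k]] by auto
    have mi: "bm (\<lambda>t. (if t < th k then e k else 0) * q k t)"
      by (intro bdd_meas_mult mq[OF k] bdd_meas_if_less bdd_meas_const bdd_meas_continuous continuous_on_id)
    have i2: "(\<lambda>t. (if t < th k then e k else 0) * q k t) integrable_on {t0..t1}"
      using bdd_meas_integrable_on[OF mi] by auto
    have i3: "(\<lambda>t. cf (y k t) * g t) integrable_on {t0..t1}"
      by (intro bdd_meas_integrable_on[of t0 t1] bdd_meas_mult bdd_meas_cf my k m) auto
    have "t0 \<le> th k" using y[OF k] u y0(2)[OF k] th[OF k] by (rule crossing_cases) (use t01 in auto)
    from integral_before[OF mq[OF k] this, of "e k"]
    have e2: "integral {t0..t1} (\<lambda>t. (if t < th k then e k else 0) * q k t)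
        = (if k \<in> crossers then \<eta> k * shift (y k) u g \<rho> (th k) else 0)"
      unfolding e_def shift_def q_def crossers_def by (auto simp: min_def)
    have "((\<lambda>t. z_end k * flow (y k) u t1 * q k t - (if t < th k then e k else 0) * q k t + Q k * (cf (y k t) * g t)) has_integral
      z_end k * flow (y k) u t1 * integral {t0..t1} (q k) - integral {t0..t1} (\<lambda>t. (if t < th k then e k else 0) * q k t)
      + Q k * integral {t0..t1} (\<lambda>t. cf (y k t) * g t)) {t0..t1}"
      by (intro has_integral_add has_integral_diff has_integral_mult_right integrable_integral i1 i2 i3)
    moreover have "z_end k * flow (y k) u t1 * q k t - (if t < th k then e k else 0) * q k t + Q k * (cf (y k t) * g t)
      = costate \<eta> k t * forcing (y k) u g \<rho> t + Q k * (cf (y k t) * g t)" for t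
      unfolding costate_def q_def e_def by (simp add: diff_divide_distrib left_diff_distrib)
    ultimately have "integral {t0..t1} (\<lambda>t. costate \<eta> k t * forcing (y k) u g \<rho> t + Q k * (cf (y k t) * g t))
      = z_end k * flow (y k) u t1 * integral {t0..t1} (q k) - integral {t0..t1} (\<lambda>t. (if t < th k then e k else 0) * q k t)
      + Q k * integral {t0..t1} (\<lambda>t. cf (y k t) * g t)" by (simp add: integral_unique)
    then show ?thesis unfolding e2 by (simp add: shift_def q_def[abs_def])
  qed
  have "(\<Sum>k\<in>crossers. \<eta> k * shift (y k) u g \<rho> (th k)) = (\<Sum>k=1..N. if k \<in> crossers then \<eta> k * shift (y k) u g \<rho> (th k) else 0)"
    using sub by (intro sum.mono_neutral_cong_left) auto
  then have "A (g, \<rho>) - (\<Sum>k\<in>crossers. \<eta> k * shift (y k) u g \<rho> (th k))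
    = (\<Sum>k=1..N. integral {t0..t1} (\<lambda>t. costate \<eta> k t * forcing (y k) u g \<rho> t + Q k * (cf (y k t) * g t)))"
    unfolding A_def fst_conv snd_conv using summand by (simp only: sum_subtractf[symmetric] cong: sum.cong)
  also have "\<dots> = integral {t0..t1} (\<lambda>t. \<Sum>k=1..N. costate \<eta> k t * forcing (y k) u g \<rho> t + Q k * (cf (y k t) * g t))"
    by (intro integral_sum[symmetric] bdd_meas_integrable_on[of t0 t1] bdd_meas_intros bdd_meas_forcing bdd_meas_costate bdd_meas_cf my mu m) auto
  also have "\<dots> = integral {t0..t1} (\<lambda>t. hamil \<eta> t * g t + switching \<eta> t * \<rho> t)"
    unfolding hamil_def switching_def forcing_def
    by (intro integral_cong, unfold sum_distrib_right sum.distrib[symmetric], rule sum.cong[OF refl])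
       (simp add: algebra_simps)
  finally show ?thesis .
qed

theorem maximum_principle:
  obtains \<eta> h where "\<And>k. k \<in> crossers \<Longrightarrow> \<eta> k \<in> {cs * Q k * jump_lo (th k)..cs * Q k / min_speed}"
    "AE t in lebesgue_on {t0..t1}. hamil \<eta> t = h"
    "AE t in lebesgue_on {t0..t1}. \<forall>v\<in>{w..1}. switching \<eta> t * v \<le> switching \<eta> t * u t"
proof -
  obtain \<eta> where \<eta>: "\<forall>k\<in>crossers. \<eta> k \<in> {cs * Q k * jump_lo (th k)..cs * Q k / min_speed}"
    and A: "\<forall>d\<in>{d. direction u (fst d) (snd d)}. A d \<le> (\<Sum>k\<in>crossers. \<eta> k * \<Delta> d k (th k))"
    using multipliers by blast
  have var: "integral {t0..t1} (\<lambda>t. hamil \<eta> t * g t + switching \<eta> t * \<rho> t) \<le> 0" if "direction u g \<rho>" for g \<rho> :: "real \<Rightarrow> real"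
    using bspec[OF A, of "(g, \<rho>)"] that variation_integral[OF that, of \<eta>] by simp
  have dir0: "direction u g (\<lambda>_. 0)" if "continuous_on {t0..t1} g" "integral {t0..t1} g = 0" for g :: "real \<Rightarrow> real"
    using that admD(2)[OF u] unfolding direction_def by (auto intro!: exI[of _ 1])
  obtain h where h: "AE t in lebesgue_on {t0..t1}. hamil \<eta> t = h"
  proof (rule bdd_meas_orthogonal_zero_mean[OF t01 bdd_meas_hamil])
    fix g :: "real \<Rightarrow> real" assume g: "continuous_on {t0..t1} g" "integral {t0..t1} g = 0"
    have "integral {t0..t1} (\<lambda>t. hamil \<eta> t * g t) \<le> 0" using var[OF dir0[OF g]] by simp
    moreover have "integral {t0..t1} (\<lambda>t. hamil \<eta> t * - g t) \<le> 0"
      using var[OF dir0[of "\<lambda>t. - g t"]] g by (simp add: continuous_on_minus)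
    ultimately show "integral {t0..t1} (\<lambda>t. hamil \<eta> t * g t) = 0" by simp
  qed blast
  define \<rho> where "\<rho> t = (if switching \<eta> t < 0 then w - u t else if - switching \<eta> t < 0 then 1 - u t else 0)" for t
  have "bm \<rho>"
    unfolding \<rho>_def by (intro bdd_meas_if_less bdd_meas_intros bdd_meas_switching mu)
  moreover have "u t + \<epsilon> * \<rho> t \<in> {w..1}" if "\<epsilon> \<in> {0..1}" "t \<in> {t0..t1}" for \<epsilon> t
  proof -
    have "\<epsilon> * (1 - u t) \<le> 1 * (1 - u t)" "\<epsilon> * (u t - w) \<le> 1 * (u t - w)" "0 \<le> \<epsilon> * (1 - u t)" "0 \<le> \<epsilon> * (u t - w)"
      using that admD(2)[OF u that(2)] by (intro mult_right_mono mult_nonneg_nonneg; simp)+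
    then show ?thesis using admD(2)[OF u that(2)] unfolding \<rho>_def by (auto simp: algebra_simps)
  qed
  ultimately have dir: "direction u (\<lambda>_. 0) \<rho>"
    unfolding direction_def by (auto intro!: exI[of _ 1])
  have "AE t in lebesgue_on {t0..t1}. switching \<eta> t * \<rho> t = 0"
  proof (rule bdd_meas_AE_eq_0)
    show "bm (\<lambda>t. switching \<eta> t * \<rho> t)"
      using \<open>bm \<rho>\<close> by (intro bdd_meas_mult bdd_meas_switching)
    show "integral {t0..t1} (\<lambda>t. switching \<eta> t * \<rho> t) \<le> 0" using var[OF dir] by simp
    show "0 \<le> switching \<eta> t * \<rho> t" if "t \<in> {t0..t1}" for t
      using admD(2)[OF u that] unfolding \<rho>_def by (auto simp: mult_nonpos_nonpos)
  qed
  moreover have "AE t in lebesgue_on {t0..t1}. t \<in> {t0..t1}" by (intro AE_I2) (simp add: space_restrict_space)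
  ultimately have mx: "AE t in lebesgue_on {t0..t1}. \<forall>v\<in>{w..1}. switching \<eta> t * v \<le> switching \<eta> t * u t"
  proof eventually_elim
    case (elim t)
    show ?case
    proof
      fix v assume v: "v \<in> {w..1}"
      consider "switching \<eta> t < 0" "u t = w" | "switching \<eta> t > 0" "u t = 1" | "switching \<eta> t = 0"
        using elim unfolding \<rho>_def by (auto split: if_splits)
      then show "switching \<eta> t * v \<le> switching \<eta> t * u t" using v by cases auto
    qed
  qed
  show thesis by (rule that[OF bspec[OF \<eta>] h mx])
qed

end

section \<open>The adjoint functions\<close>

lemma AE_lebesgue_on_subset:
  assumes "AE t in lebesgue_on T. P t" "S \<subseteq> T" "S \<in> sets lebesgue" "T \<in> sets lebesgue"
  shows "AE t in lebesgue_on S. P t"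
proof -
  have "AE t in lebesgue. t \<in> T \<longrightarrow> P t"
    using assms(1,4) by (subst (asm) AE_restrict_space_iff) auto
  then have "AE t in lebesgue. t \<in> S \<longrightarrow> P t" by eventually_elim (use assms(2) in auto)
  then show ?thesis using assms(3) by (subst AE_restrict_space_iff) auto
qed

lemma bdd_meas_integrable_lebesgue_on:
  assumes "bdd_meas a b f" "S \<subseteq> {a..b}" "S \<in> sets lebesgue"
  shows "integrable (lebesgue_on S) f"
proof -
  have "set_integrable lebesgue S f"
    by (rule set_integrable_subset[OF bdd_meas_abs_integrable[OF assms(1)] assms(3,2)])
  then show ?thesis using assms(3) by (simp add: integrable_restrict_space set_integrable_def)
qed

lemma bdd_meas_L_infinity:
  assumes "bdd_meas a b f" "S \<subseteq> {a..b}" "S \<in> sets lebesgue" "\<And>t. t \<in> S \<Longrightarrow> g t = f t"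
  shows "L_infinity S g"
proof -
  obtain M where M: "\<And>t. t \<in> {a..b} \<Longrightarrow> \<bar>f t\<bar> \<le> M" using bdd_meas_bound[OF assms(1)] by metis
  have "f \<in> borel_measurable (lebesgue_on S)"
    by (rule measurable_restrict_mono[of f lebesgue "{a..b}"]) (use assms in \<open>auto simp: bdd_meas_def\<close>)
  moreover have "g \<in> borel_measurable (lebesgue_on S) \<longleftrightarrow> f \<in> borel_measurable (lebesgue_on S)"
    using assms(4) by (intro measurable_cong) (simp add: space_restrict_space)
  moreover have "AE t in lebesgue_on S. \<bar>g t\<bar> \<le> M"
    using M assms(2,4) by (intro AE_I2) (auto simp: space_restrict_space)
  ultimately show ?thesis unfolding L_infinity_def by auto
qed

lemma test_function_primitive:
  assumes "test_function S \<phi>" shows "primitive a b \<phi> (deriv \<phi>)"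
proof -
  have diff: "(deriv ^^ n) \<phi> differentiable (at t)" for n t
    using assms unfolding test_function_def by blast
  have d0: "(\<phi> has_real_derivative deriv \<phi> t) (at t)" for t
    using diff[of 0 t] by (simp add: DERIV_deriv_iff_real_differentiable)
  have "isCont (deriv \<phi>) t" for t
    using diff[of 1 t] by (simp add: differentiable_imp_continuous_within)
  then have c: "continuous_on {a..b} (deriv \<phi>)" by (simp add: continuous_at_imp_continuous_on)
  show ?thesis unfolding primitive_def
  proof (intro conjI ballI)
    show "bdd_meas a b (deriv \<phi>)" by (rule bdd_meas_continuous[OF c])
    fix t assume t: "t \<in> {a..b}"
    have "(deriv \<phi> has_integral \<phi> t - \<phi> a) {a..t}"
      using t d0 by (intro fundamental_theorem_of_calculus)
        (auto simp flip: has_real_derivative_iff_has_vector_derivative intro: has_field_derivative_at_within)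
    then show "\<phi> t = \<phi> a + integral {a..t} (deriv \<phi>)" by (simp add: integral_unique)
  qed
qed

lemma piecewise_primitive_W1_infinity:
  assumes c: "a \<le> c" "c \<le> b" and S: "S = {a<..<c} \<union> {c<..<b}"
    and p1: "primitive a b G1 v1" and p2: "primitive a b G2 v2"
    and g: "\<And>t. t \<in> S \<Longrightarrow> g t = (if t < c then G1 t else G2 t)"
    and v: "\<And>t. t \<in> S \<Longrightarrow> v t = (if t < c then v1 t else v2 t)"
  shows "W1_infinity S g" "weak_derivative_on S g v"
proof -
  have Ssub: "S \<subseteq> {a..b}" and Sm: "S \<in> sets lebesgue" using c unfolding S by auto
  have mid: "bdd_meas a b (\<lambda>t. t)" by (intro bdd_meas_continuous continuous_on_id)
  define g' where "g' t = (if t < c then G1 t else G2 t)" for t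
  define v' where "v' t = (if t < c then v1 t else v2 t)" for t
  have mg: "bdd_meas a b g'" and mv: "bdd_meas a b v'"
    unfolding g'_def v'_def
    by (intro bdd_meas_if_less[where h="\<lambda>t. t"] primitive_bdd_meas'[OF p1] primitive_bdd_meas'[OF p2]
        primitive_bdd_meas[OF p1] primitive_bdd_meas[OF p2] mid)+
  have gg: "g t = g' t" and vv: "v t = v' t" if "t \<in> S" for t using g v that unfolding g'_def v'_def by auto
  have Lg: "L_infinity S g" and Lv: "L_infinity S v"
    using bdd_meas_L_infinity[OF mg Ssub Sm, of g] bdd_meas_L_infinity[OF mv Ssub Sm, of v] gg vv
    by blast+
  show w: "weak_derivative_on S g v"
    unfolding weak_derivative_on_def
  proof (intro conjI allI impI)
    fix K assume K: "compact K \<and> K \<subseteq> S"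
    then have Km: "K \<in> sets lebesgue" and KS: "K \<subseteq> {a..b}" using Ssub by (auto simp: lmeasurable_compact fmeasurableD)
    show "integrable (lebesgue_on K) g"
      using bdd_meas_integrable_lebesgue_on[OF mg KS Km] K gg
      by (subst Bochner_Integration.integrable_cong[of _ _ g g']) (auto simp: space_restrict_space)
    show "integrable (lebesgue_on K) v"
      using bdd_meas_integrable_lebesgue_on[OF mv KS Km] K vv
      by (subst Bochner_Integration.integrable_cong[of _ _ v v']) (auto simp: space_restrict_space)
  next
    fix \<phi> assume \<phi>: "test_function S \<phi>"
    note p\<phi> = test_function_primitive[OF \<phi>, of a b]
    have zero: "\<phi> t = 0" if "t \<notin> S" for t
      using \<phi> closure_subset[of "{t. \<phi> t \<noteq> 0}"] that unfolding test_function_def by blast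
    have split: "(LINT t|lebesgue_on S. f t) = integral {a..c} f1 + integral {c..b} f2"
      if m: "bdd_meas a b f1" "bdd_meas a b f2" and f: "\<And>t. t \<in> S \<Longrightarrow> f t = (if t < c then f1 t else f2 t)"
      for f f1 f2 :: "real \<Rightarrow> real"
    proof -
      define h where "h t = (if t < c then f1 t else f2 t)" for t
      have mh: "bdd_meas a b h" unfolding h_def by (intro bdd_meas_if_less m mid)
      have "(LINT t|lebesgue_on S. f t) = (LINT t|lebesgue_on S. h t)"
        using f by (intro Bochner_Integration.integral_cong) (auto simp: h_def space_restrict_space)
      also have "\<dots> = integral S h"
        by (intro lebesgue_integral_eq_integral bdd_meas_integrable_lebesgue_on[OF mh Ssub Sm] Sm)
      also have "\<dots> = integral {a..b} h"
      proof (rule integral_spike_set)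
        show "negligible {x \<in> S - {a..b}. h x \<noteq> 0}"
          by (rule negligible_subset[of "{a, b, c}"]) (use Ssub in auto)
        show "negligible {x \<in> {a..b} - S. h x \<noteq> 0}"
          by (rule negligible_subset[of "{a, b, c}"]) (auto simp: S)
      qed
      also have "\<dots> = integral {a..c} h + integral {c..b} h"
        using bdd_meas_integral_combine[OF mh, of c b] c by simp
      also have "integral {a..c} h = integral {a..c} f1"
        by (rule integral_spike[of "{c}"]) (auto simp: h_def)
      also have "integral {c..b} h = integral {c..b} f2"
        by (rule integral_cong) (auto simp: h_def)
      finally show ?thesis .
    qed
    have piece: "integral {s..t} (\<lambda>r. G r * deriv \<phi> r) = - integral {s..t} (\<lambda>r. w r * \<phi> r)"
      if G: "primitive a b G w" and st: "a \<le> s" "s \<le> t" "t \<le> b" "s \<notin> S" "t \<notin> S" for G w s t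
    proof -
      have i: "(\<lambda>r. w r * \<phi> r) integrable_on {s..t}" "(\<lambda>r. G r * deriv \<phi> r) integrable_on {s..t}"
        using st by (intro bdd_meas_integrable_on[of a b] bdd_meas_mult primitive_bdd_meas[OF G]
            primitive_bdd_meas'[OF G] primitive_bdd_meas[OF p\<phi>] primitive_bdd_meas'[OF p\<phi>]; auto)+
      have "0 = integral {s..t} (\<lambda>r. w r * \<phi> r + G r * deriv \<phi> r)"
        using primitive_diff_eq[OF primitive_mult[OF G p\<phi>] st(1-3)] zero[OF st(4)] zero[OF st(5)] by simp
      then show ?thesis using integral_add[OF i] by simp
    qed
    have "(LINT t|lebesgue_on S. g t * deriv \<phi> t)
        = integral {a..c} (\<lambda>t. G1 t * deriv \<phi> t) + integral {c..b} (\<lambda>t. G2 t * deriv \<phi> t)"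
      by (intro split bdd_meas_mult primitive_bdd_meas'[OF p1] primitive_bdd_meas'[OF p2] primitive_bdd_meas[OF p\<phi>])
         (simp add: g)
    also have "\<dots> = - (integral {a..c} (\<lambda>t. v1 t * \<phi> t) + integral {c..b} (\<lambda>t. v2 t * \<phi> t))"
      using piece[OF p1, of a c] piece[OF p2, of c b] c unfolding S by simp
    also have "\<dots> = - (LINT t|lebesgue_on S. v t * \<phi> t)"
      by (intro arg_cong[where f=uminus] split[symmetric] bdd_meas_mult primitive_bdd_meas[OF p1]
          primitive_bdd_meas[OF p2] primitive_bdd_meas'[OF p\<phi>]) (simp add: v)
    finally show "(LINT t|lebesgue_on S. g t * deriv \<phi> t) = - (LINT t|lebesgue_on S. v t * \<phi> t)" .
  qed
  show "W1_infinity S g" unfolding W1_infinity_def using Lg Lv w by blast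
qed

lemma continuous_on_left_limit:
  fixes F :: "real \<Rightarrow> real"
  assumes "continuous_on {a..b} F" "a < c" "c \<le> b" "d < c" "\<And>t. d < t \<Longrightarrow> t < c \<Longrightarrow> f t = F t"
  shows "(f \<longlongrightarrow> F c) (at_left c)"
proof -
  have "(F \<longlongrightarrow> F c) (at c within {a..b})" using assms by (auto simp: continuous_on_def)
  then have "(F \<longlongrightarrow> F c) (at c within {a..c})" by (rule tendsto_within_subset) (use assms in auto)
  moreover have "at c within {a..c} = at_left c"
    by (rule at_within_Icc_at_left[OF assms(2)])
  ultimately have "(F \<longlongrightarrow> F c) (at_left c)" by simp
  moreover have "\<forall>\<^sub>F t in at_left c. F t = f t"
    using eventually_at_left_real[OF assms(4)] by (rule eventually_mono) (use assms(5) in auto)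
  ultimately show ?thesis by (rule Lim_transform_eventually)
qed

lemma continuous_on_right_limit:
  fixes F :: "real \<Rightarrow> real"
  assumes "continuous_on {a..b} F" "a \<le> c" "c < b" "\<And>t. c < t \<Longrightarrow> t < b \<Longrightarrow> f t = F t"
  shows "(f \<longlongrightarrow> F c) (at_right c)"
proof -
  have "(F \<longlongrightarrow> F c) (at c within {a..b})" using assms by (auto simp: continuous_on_def)
  then have "(F \<longlongrightarrow> F c) (at c within {c..b})" by (rule tendsto_within_subset) (use assms in auto)
  moreover have "at c within {c..b} = at_right c"
    by (rule at_within_Icc_at_right[OF assms(3)])
  ultimately have "(F \<longlongrightarrow> F c) (at_right c)" by simp
  moreover have "\<forall>\<^sub>F t in at_right c. F t = f t"
    using eventually_at_right_real[OF assms(3)] by (rule eventually_mono) (use assms(4) in auto)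
  ultimately show ?thesis by (rule Lim_transform_eventually)
qed

lemma deriv_a_fun: "deriv a_fun y = - 2 * y"
  unfolding a_fun_def by (rule DERIV_imp_deriv) (auto intro!: derivative_eq_intros)

lemma deriv_b_fun: "deriv (b_fun c1 c2) y = c1"
  unfolding b_fun_def by (rule DERIV_imp_deriv) (auto intro!: derivative_eq_intros)

context optimal_setting
begin

definition z :: "nat \<Rightarrow> real \<Rightarrow> real" where
  "z k t = z0 k * exp (integral {t0..t} (\<lambda>s. cf (y k s)))"

lemma z_pos: "k \<in> {1..N} \<Longrightarrow> z k t > 0" using z0 unfolding z_def by simp

lemma z_t1: "z k t1 = z_end k" unfolding z_def z_end_def by simp

lemma primitive_z: "k \<in> {1..N} \<Longrightarrow> primitive t0 t1 (z k) (\<lambda>t. cf (y k t) * z k t)"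
  using primitive_cmult[OF primitive_exp_integral[OF bdd_meas_cf[OF my]], of k "z0 k"]
  by (rule primitive_cong) (auto simp: z_def)

definition psi :: "(nat \<Rightarrow> real) \<Rightarrow> nat \<Rightarrow> real \<Rightarrow> real^3" where
  "psi \<eta> k t = vector [0, costate \<eta> k t - z k t, Q k / z k t - y k t]"

definition psi' :: "(nat \<Rightarrow> real) \<Rightarrow> nat \<Rightarrow> real \<Rightarrow> real^3" where
  "psi' \<eta> k t = vector [0, - slope (y k) u t * costate \<eta> k t - cf (y k t) * z k t,
     - cf (y k t) * (Q k / z k t) - speed (y k t) (u t)]"

lemma psi_nth [simp]: "psi \<eta> k t $ 1 = 0" "psi \<eta> k t $ 2 = costate \<eta> k t - z k t" "psi \<eta> k t $ 3 = Q k / z k t - y k t"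
  and psi'_nth [simp]: "psi' \<eta> k t $ 1 = 0" "psi' \<eta> k t $ 2 = - slope (y k) u t * costate \<eta> k t - cf (y k t) * z k t"
    "psi' \<eta> k t $ 3 = - cf (y k t) * (Q k / z k t) - speed (y k t) (u t)"
  by (simp_all add: psi_def psi'_def)

definition branch :: "real \<Rightarrow> nat \<Rightarrow> real \<Rightarrow> real" where
  "branch m k t = m * (1 / flow (y k) u t) - z k t"

lemma primitive_branch:
  assumes k: "k \<in> {1..N}"
  shows "primitive t0 t1 (branch m k) (\<lambda>t. - slope (y k) u t * (m / flow (y k) u t) - cf (y k t) * z k t)"
proof -
  have "primitive t0 t1 (branch m k) (\<lambda>t. m * (- slope (y k) u t * (1 / flow (y k) u t)) - cf (y k t) * z k t)"
    unfolding branch_def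
    by (intro primitive_diff primitive_cmult primitive_inverse_flow my[OF k] mu primitive_z[OF k])
  then show ?thesis by (rule primitive_cong) auto
qed

lemma primitive_psi3:
  assumes k: "k \<in> {1..N}"
  shows "primitive t0 t1 (\<lambda>t. Q k / z k t - y k t) (\<lambda>t. - cf (y k t) * (Q k / z k t) - speed (y k t) (u t))"
proof -
  have "primitive t0 t1 (\<lambda>t. - 1 * integral {t0..t} (\<lambda>s. cf (y k s))) (\<lambda>t. - 1 * cf (y k t))"
    using primitive_cmult[OF primitive_integral[OF bdd_meas_cf[OF my[OF k]], of 0], of "-1"] by simp
  from primitive_diff[OF primitive_cmult[OF primitive_exp[OF this], of "Q k / z0 k"] solD(2)[OF y[OF k]]]
  show ?thesis
    by (rule primitive_cong) (auto simp: z_def exp_minus divide_inverse)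
qed

definition psi_lim :: "real \<Rightarrow> nat \<Rightarrow> real \<Rightarrow> real^3" where
  "psi_lim m k t = vector [0, branch m k t, Q k / z k t - y k t]"

lemma psi_lim_nth [simp]: "psi_lim m k t $ 1 = 0" "psi_lim m k t $ 2 = branch m k t"
    "psi_lim m k t $ 3 = Q k / z k t - y k t"
  by (simp_all add: psi_lim_def)

definition jump :: "(nat \<Rightarrow> real) \<Rightarrow> nat \<Rightarrow> real" where
  "jump \<eta> k = (if k \<in> crossers then \<eta> k * flow (y k) u (th k) else 0)"

lemma costate_eq: "costate \<eta> k t = (z_end k * flow (y k) u t1 - (if t < th k then jump \<eta> k else 0)) / flow (y k) u t"
  unfolding costate_def jump_def by simp

lemma costate_branch:
  "t < th k \<Longrightarrow> costate \<eta> k t - z k t = branch (z_end k * flow (y k) u t1 - jump \<eta> k) k t"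
  "th k \<le> t \<Longrightarrow> costate \<eta> k t - z k t = branch (z_end k * flow (y k) u t1) k t"
  unfolding costate_eq branch_def by simp_all

lemma th_cases:
  assumes k: "k \<in> {1..N}"
  obtains "th k = t0" "y k t0 = ys" | "t0 < th k" "th k < t1" "y k (th k) = ys"
    | "th k = t1" "y k t1 = ys" | "th k = t1 + 1"
  using y[OF k] u y0(2)[OF k] th[OF k]
proof (rule crossing_cases)
  assume *: "th k \<in> {t0..t1}" "y k (th k) = ys"
  then consider "th k = t0" | "t0 < th k" "th k < t1" | "th k = t1" by fastforce
  then show thesis using * that by cases auto
qed (rule that(4))

lemma psi_weak:
  assumes k: "k \<in> {1..N}"
  shows "W1_infinity (crossing_free t0 t1 (th k)) (\<lambda>t. psi \<eta> k t $ i) \<and>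
    weak_derivative_on (crossing_free t0 t1 (th k)) (\<lambda>t. psi \<eta> k t $ i) (\<lambda>t. psi' \<eta> k t $ i)"
proof -
  define c where "c = min (th k) t1"
  have c: "t0 \<le> c" "c \<le> t1"
    unfolding c_def using t01 by (cases rule: th_cases[OF k]; simp)+
  have S: "crossing_free t0 t1 (th k) = {t0<..<c} \<union> {c<..<t1}"
    unfolding c_def crossing_free_def using t01 by (cases rule: th_cases[OF k]; force)
  show ?thesis
    using exhaust_3[of i]
  proof (elim disjE)
    assume i: "i = 1"
    show ?thesis unfolding i
      by (intro conjI piecewise_primitive_W1_infinity[OF c S primitive_const[of _ _ 0] primitive_const[of _ _ 0]]) auto
  next
    assume i: "i = 2"
    have lt: "t < c \<longleftrightarrow> t < th k" if "t \<in> crossing_free t0 t1 (th k)" for t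
      using that unfolding crossing_free_def c_def by auto
    show ?thesis unfolding i
      by (intro conjI piecewise_primitive_W1_infinity[OF c S primitive_branch[OF k, of "z_end k * flow (y k) u t1 - jump \<eta> k"]
            primitive_branch[OF k, of "z_end k * flow (y k) u t1"]])
         (auto simp: lt costate_branch not_less, auto simp: costate_eq)
  next
    assume i: "i = 3"
    show ?thesis unfolding i
      by (intro conjI piecewise_primitive_W1_infinity[OF c S primitive_psi3[OF k] primitive_psi3[OF k]]) auto
  qed
qed

lemma psi_left_limit:
  assumes k: "k \<in> {1..N}" and c: "t0 < c" "c \<le> t1" "c \<le> th k \<or> th k < c"
  shows "(psi \<eta> k \<longlongrightarrow> psi_lim (z_end k * flow (y k) u t1 - (if c \<le> th k then jump \<eta> k else 0)) k c) (at_left c)" (is "(_ \<longlongrightarrow> ?l) _")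
proof (rule vec_tendstoI)
  fix i :: 3
  show "((\<lambda>t. psi \<eta> k t $ i) \<longlongrightarrow> ?l $ i) (at_left c)"
    using exhaust_3[of i]
  proof (elim disjE)
    assume i: "i = 2"
    have "((\<lambda>t. costate \<eta> k t - z k t) \<longlongrightarrow> branch (z_end k * flow (y k) u t1 - (if c \<le> th k then jump \<eta> k else 0)) k c) (at_left c)"
    proof (rule continuous_on_left_limit[OF primitive_continuous[OF primitive_branch[OF k]] c(1,2)])
      show "(if c \<le> th k then t0 else th k) < c" using c by auto
      show "costate \<eta> k t - z k t = branch (z_end k * flow (y k) u t1 - (if c \<le> th k then jump \<eta> k else 0)) k t"
        if "(if c \<le> th k then t0 else th k) < t" "t < c" for t
        using that costate_branch(1)[of t k] costate_branch(2)[of k t] by (cases "c \<le> th k") auto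
    qed
    then show ?thesis by (simp add: i)
  next
    assume i: "i = 3"
    have "((\<lambda>t. Q k / z k t - y k t) \<longlongrightarrow> Q k / z k c - y k c) (at_left c)"
      by (rule continuous_on_left_limit[OF primitive_continuous[OF primitive_psi3[OF k]] c(1,2) c(1)]) simp
    then show ?thesis by (simp add: i)
  qed simp
qed

lemma psi_right_limit:
  assumes k: "k \<in> {1..N}" and c: "t0 \<le> th k" "th k < t1"
  shows "(psi \<eta> k \<longlongrightarrow> psi_lim (z_end k * flow (y k) u t1) k (th k)) (at_right (th k))" (is "(_ \<longlongrightarrow> ?l) _")
proof (rule vec_tendstoI)
  fix i :: 3
  show "((\<lambda>t. psi \<eta> k t $ i) \<longlongrightarrow> ?l $ i) (at_right (th k))"
    using exhaust_3[of i]
  proof (elim disjE)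
    assume i: "i = 2"
    have "((\<lambda>t. costate \<eta> k t - z k t) \<longlongrightarrow> branch (z_end k * flow (y k) u t1) k (th k)) (at_right (th k))"
      by (rule continuous_on_right_limit[OF primitive_continuous[OF primitive_branch[OF k]] c]) (simp add: costate_branch)
    then show ?thesis by (simp add: i)
  next
    assume i: "i = 3"
    have "((\<lambda>t. Q k / z k t - y k t) \<longlongrightarrow> Q k / z k (th k) - y k (th k)) (at_right (th k))"
      by (rule continuous_on_right_limit[OF primitive_continuous[OF primitive_psi3[OF k]] c]) simp
    then show ?thesis by (simp add: i)
  qed simp
qed

lemma branch_t1: "branch (z_end k * flow (y k) u t1 - m) k t1 = - (m / flow (y k) u t1)"
  using flow_pos[of "y k" u t1] unfolding branch_def z_t1 by (simp add: field_simps)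

lemma psi_jump:
  assumes k: "k \<in> {1..N}" and c: "t0 < th k" "th k < t1"
    and \<eta>: "k \<in> crossers \<Longrightarrow> \<eta> k \<in> {cs * Q k * jump_lo (th k)..cs * Q k / min_speed}"
  shows "\<exists>l r. (psi \<eta> k \<longlongrightarrow> l) (at_left (th k)) \<and> (psi \<eta> k \<longlongrightarrow> r) (at_right (th k)) \<and>
     l $ 1 = r $ 1 \<and> l $ 3 = r $ 3 \<and>
     r $ 2 - l $ 2 \<in> {cs * z k (th k) * (ys + l $ 3) / max_speed .. cs * z k (th k) * (ys + l $ 3) / min_speed}"
proof -
  have kc: "k \<in> crossers" using k c unfolding crossers_def by auto
  have ycr: "y k (th k) = ys" by (rule th_cases[OF k]) (use c in auto)
  define l where "l = psi_lim (z_end k * flow (y k) u t1 - jump \<eta> k) k (th k)"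
  define r where "r = psi_lim (z_end k * flow (y k) u t1) k (th k)"
  have "(psi \<eta> k \<longlongrightarrow> l) (at_left (th k))"
    using psi_left_limit[OF k, of "th k" \<eta>] c unfolding l_def by simp
  moreover have "(psi \<eta> k \<longlongrightarrow> r) (at_right (th k))"
    using c unfolding r_def by (intro psi_right_limit[OF k]) auto
  moreover have "l $ 1 = r $ 1" "l $ 3 = r $ 3" by (simp_all add: l_def r_def)
  moreover have r2: "r $ 2 - l $ 2 = \<eta> k"
    using flow_pos[of "y k" u "th k"] kc by (simp add: l_def r_def branch_def jump_def field_simps)
  moreover have "cs * z k (th k) * (ys + l $ 3) = cs * Q k"
    using z_pos[OF k, of "th k"] ycr by (simp add: l_def)
  note csQ = this
  have "r $ 2 - l $ 2 \<in> {cs * z k (th k) * (ys + l $ 3) / max_speed .. cs * z k (th k) * (ys + l $ 3) / min_speed}"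
    using \<eta>[OF kc] c unfolding r2 csQ by (simp add: jump_lo_def)
  ultimately show ?thesis by blast
qed

lemma psi_terminal:
  assumes k: "k \<in> {1..N}"
    and \<eta>: "k \<in> crossers \<Longrightarrow> \<eta> k \<in> {cs * Q k * jump_lo (th k)..cs * Q k / min_speed}"
  shows "\<exists>e. (psi \<eta> k \<longlongrightarrow> e) (at_left t1) \<and> e $ 1 = 0 \<and> e $ 3 = 0 \<and> (th k < t1 \<longrightarrow> e $ 2 = 0) \<and>
     (th k = t1 \<longrightarrow> - (e $ 2) \<in> {0 .. cs * z k t1 * ys / min_speed})"
proof (intro exI conjI impI)
  let ?e = "psi_lim (z_end k * flow (y k) u t1 - (if t1 \<le> th k then jump \<eta> k else 0)) k t1"
  show "(psi \<eta> k \<longlongrightarrow> ?e) (at_left t1)" using t01 by (intro psi_left_limit[OF k]) auto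
  show "?e $ 1 = 0" by simp
  show "?e $ 3 = 0" using z_end_pos[OF k] by (simp add: z_t1 Q_def)
  show "?e $ 2 = 0" if "th k < t1" using that branch_t1[of k 0] by simp
  show "- (?e $ 2) \<in> {0 .. cs * z k t1 * ys / min_speed}" if eq: "th k = t1"
  proof -
    have kc: "k \<in> crossers" using k eq t01 unfolding crossers_def by auto
    have "y k t1 = ys" by (rule th_cases[OF k]) (use eq t01 in auto)
    then have "Q k = z k t1 * ys" by (simp add: Q_def z_t1)
    moreover have "- (?e $ 2) = \<eta> k"
      using kc eq flow_pos[of "y k" u t1] by (simp add: branch_t1 jump_def)
    moreover have "jump_lo (th k) = 0" using eq by (simp add: jump_lo_def)
    ultimately show ?thesis using \<eta>[OF kc] by (simp add: mult.assoc)
  qed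
qed

end

theorem theorem3p3:
  fixes t0 t1 c1 c2 cs ys w :: real
    and N :: nat
    and x0 :: "nat \<Rightarrow> real^3"
    and u :: "real \<Rightarrow> real"
    and x :: "nat \<Rightarrow> real \<Rightarrow> real^3"
    and that :: "nat \<Rightarrow> real"
  assumes "t0 < t1"
    and "c1 > 0" and "c2 > 0" and "cs > 0" and "ys > 0"
    and "ys\<^sup>2 / (c1 * ys + c2) < 1"
    and "w \<in> {ys\<^sup>2 / (c1 * ys + c2)<..<1}"
    and "N \<ge> 1"
    and "\<And>k. k \<in> {1..N} \<Longrightarrow> x0 k $ 1 \<in> {0..1} \<and> x0 k $ 2 \<in> {0..ys} \<and> x0 k $ 3 > 0"
    and "optimal_control t0 t1 c1 c2 cs ys w N x0 u"
    and "\<And>k. k \<in> {1..N} \<Longrightarrow> trajectory t0 t1 c1 c2 cs ys (x0 k) u (x k)"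
    and "\<And>k i. k \<in> {1..N} \<Longrightarrow> W1_infinity {t0<..<t1} (\<lambda>t. x k t $ i)"
    and "\<And>k. k \<in> {1..N} \<Longrightarrow> that k = crossing_time t0 t1 ys (\<lambda>t. x k t $ 2)"
  shows "\<exists>\<psi> :: nat \<Rightarrow> real \<Rightarrow> real^3.
     (\<forall>k\<in>{1..N}.
        (\<forall>i. W1_infinity (crossing_free t0 t1 (that k)) (\<lambda>t. \<psi> k t $ i)) \<and>
        (\<exists>\<psi>' :: real \<Rightarrow> real^3.
           (\<forall>i. weak_derivative_on (crossing_free t0 t1 (that k))
                  (\<lambda>t. \<psi> k t $ i) (\<lambda>t. \<psi>' t $ i)) \<and>
           (AE t in lebesgue_on (crossing_free t0 t1 (that k)).
              \<psi>' t $ 1 = 0 \<and>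
              \<psi>' t $ 2 =
                - (deriv a_fun (x k t $ 2) + deriv (b_fun c1 c2) (x k t $ 2) * u t) * \<psi> k t $ 2
                - (deriv a_fun (x k t $ 2) + deriv (b_fun c1 c2) (x k t $ 2) * u t) * x k t $ 3
                - c_fun cs ys (x k t $ 2) * x k t $ 3 \<and>
              \<psi>' t $ 3 =
                - c_fun cs ys (x k t $ 2) * \<psi> k t $ 3
                - (a_fun (x k t $ 2) + b_fun c1 c2 (x k t $ 2) * u t)
                - c_fun cs ys (x k t $ 2) * x k t $ 2)) \<and>
        (t0 < that k \<and> that k < t1 \<longrightarrow>
           (\<exists>l r :: real^3.
              (\<psi> k \<longlongrightarrow> l) (at_left (that k)) \<and> (\<psi> k \<longlongrightarrow> r) (at_right (that k)) \<and>
              l $ 1 = r $ 1 \<and> l $ 3 = r $ 3 \<and>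
              r $ 2 - l $ 2 \<in>
                {cs * x k (that k) $ 3 * (ys + l $ 3) / (a_fun ys + b_fun c1 c2 ys) ..
                 cs * x k (that k) $ 3 * (ys + l $ 3) / (a_fun ys + b_fun c1 c2 ys * w)})) \<and>
        (\<exists>e :: real^3.
           (\<psi> k \<longlongrightarrow> e) (at_left t1) \<and>
           e $ 1 = 0 \<and> e $ 3 = 0 \<and>
           (that k < t1 \<longrightarrow> e $ 2 = 0) \<and>
           (that k = t1 \<longrightarrow>
              - (e $ 2) \<in> {0 .. cs * x k t1 $ 3 * ys / (a_fun ys + b_fun c1 c2 ys * w)}))) \<and>
     (\<exists>h. AE t in lebesgue_on {t0<..<t1}.
        hamiltonian c1 c2 cs ys N (\<lambda>k. x k t) (u t) (\<lambda>k. \<psi> k t) =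
          max_hamiltonian c1 c2 cs ys w N (\<lambda>k. x k t) (\<lambda>k. \<psi> k t) \<and>
        max_hamiltonian c1 c2 cs ys w N (\<lambda>k. x k t) (\<lambda>k. \<psi> k t) = h)"
proof -
  have cset: "control_setting t0 t1 c1 c2 cs ys w"
    using assms(1-7) by unfold_locales auto
  interpret control_setting t0 t1 c1 c2 cs ys w by (rule cset)
  have uc: "u \<in> controls t0 t1 w" using assms(10) unfolding optimal_control_def by blast
  obtain v where v: "adm v" and uv: "AE t in lebesgue_on {t0<..<t1}. u t = v t"
    by (rule controls_adm[OF uc]) blast
  have sol: "sol (x0 k $ 2) v (\<lambda>t. x k t $ 2)" if "k \<in> {1..N}" for k
    using trajectory_sol(1)[OF assms(11)[OF that] v uv] .
  interpret optimal_setting t0 t1 c1 c2 cs ys w N "\<lambda>k. x0 k $ 2" "\<lambda>k. x0 k $ 3" v "\<lambda>k t. x k t $ 2" that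
  proof unfold_locales
    fix k assume k: "k \<in> {1..N}"
    show "0 \<le> x0 k $ 2" "x0 k $ 2 \<le> ys" "0 < x0 k $ 3" using assms(9)[OF k] by auto
    show "that k = crossing_time t0 t1 ys (\<lambda>t. x k t $ 2)" by (rule assms(13)[OF k])
  next
    fix v' Y assume v': "adm v'" and Y: "\<And>k. k \<in> {1..N} \<Longrightarrow> sol (x0 k $ 2) v' (Y k)"
    have "J_cost t0 t1 c1 c2 cs ys N x0 u \<le> J_cost t0 t1 c1 c2 cs ys N x0 v'"
      using assms(10) adm_controls[OF v'] unfolding optimal_control_def by blast
    moreover have "J_cost t0 t1 c1 c2 cs ys N x0 u
      = - (\<Sum>k=1..N. x k t1 $ 2 * (x0 k $ 3 * exp (integral {t0..t1} (\<lambda>s. cf (x k s $ 2)))))"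
      using assms(11) by (intro J_cost_sol[OF v uv sol]) auto
    moreover have "J_cost t0 t1 c1 c2 cs ys N x0 v'
      = - (\<Sum>k=1..N. Y k t1 * (x0 k $ 3 * exp (growth (Y k))))"
    proof (rule J_cost_sol[OF v' _ Y])
      fix k assume k: "k \<in> {1..N}"
      show "\<exists>X. trajectory t0 t1 c1 c2 cs ys (x0 k) v' X"
        by (rule sol_trajectory[OF Y[OF k] v']) blast
    qed auto
    ultimately show "(\<Sum>k=1..N. Y k t1 * (x0 k $ 3 * exp (growth (Y k))))
        \<le> (\<Sum>k=1..N. x k t1 $ 2 * (x0 k $ 3 * exp (integral {t0..t1} (\<lambda>t. cf (x k t $ 2)))))"
      by simp
  qed (use v sol in auto)
  obtain \<eta> h where \<eta>: "\<And>k. k \<in> crossers \<Longrightarrow> \<eta> k \<in> {cs * Q k * jump_lo (that k)..cs * Q k / min_speed}"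
    and h: "AE t in lebesgue_on {t0..t1}. hamil \<eta> t = h"
    and mx: "AE t in lebesgue_on {t0..t1}. \<forall>r\<in>{w..1}. switching \<eta> t * r \<le> switching \<eta> t * v t"
    by (rule maximum_principle) blast
  have x3: "x k t $ 3 = z k t" if "k \<in> {1..N}" "t \<in> {t0..t1}" for k t
    using trajectory_sol(2)[OF assms(11)[OF that(1)] v uv that(2)] unfolding z_def .
  have speeds: "a_fun ys + b_fun c1 c2 ys = max_speed" "a_fun ys + b_fun c1 c2 ys * w = min_speed"
    unfolding a_fun_def b_fun_def max_speed_def min_speed_def by simp_all
  have ham: "hamiltonian c1 c2 cs ys N (\<lambda>k. x k t) r (\<lambda>k. psi \<eta> k t)
      = (hamil \<eta> t - switching \<eta> t * v t) + switching \<eta> t * r" if t: "t \<in> {t0..t1}" for t r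
  proof -
    have "hamiltonian c1 c2 cs ys N (\<lambda>k. x k t) r (\<lambda>k. psi \<eta> k t)
        = (\<Sum>k=1..N. f_dyn c1 c2 cs ys (x k t) r \<bullet> psi \<eta> k t - f0_dyn c1 c2 cs ys (x k t) r)"
      unfolding hamiltonian_def by (simp add: sum_subtractf)
    also have "\<dots> = (\<Sum>k=1..N. (costate \<eta> k t * speed (x k t $ 2) (v t) + cf (x k t $ 2) * Q k
        - costate \<eta> k t * (c1 * x k t $ 2 + c2) * v t) + costate \<eta> k t * (c1 * x k t $ 2 + c2) * r)"
    proof (rule sum.cong)
      fix k assume k: "k \<in> {1..N}"
      have "z k t > 0" by (rule z_pos[OF k])
      then show "f_dyn c1 c2 cs ys (x k t) r \<bullet> psi \<eta> k t - f0_dyn c1 c2 cs ys (x k t) r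
        = (costate \<eta> k t * speed (x k t $ 2) (v t) + cf (x k t $ 2) * Q k
        - costate \<eta> k t * (c1 * x k t $ 2 + c2) * v t) + costate \<eta> k t * (c1 * x k t $ 2 + c2) * r"
        using x3[OF k t]
        by (simp add: inner_vec_def sum_3 f_dyn_nth f0_dyn_def speed_def a_fun_def b_fun_def field_simps)
    qed simp
    also have "\<dots> = (hamil \<eta> t - switching \<eta> t * v t) + switching \<eta> t * r"
      unfolding hamil_def switching_def by (simp add: sum.distrib sum_subtractf sum_distrib_right)
    finally show ?thesis .
  qed
  have pointwise: "hamiltonian c1 c2 cs ys N (\<lambda>k. x k t) (u t) (\<lambda>k. psi \<eta> k t) =
        max_hamiltonian c1 c2 cs ys w N (\<lambda>k. x k t) (\<lambda>k. psi \<eta> k t) \<and>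
      max_hamiltonian c1 c2 cs ys w N (\<lambda>k. x k t) (\<lambda>k. psi \<eta> k t) = h"
    if t: "t \<in> {t0..t1}" and ht: "hamil \<eta> t = h" and uvt: "u t = v t"
      and mt: "\<forall>r\<in>{w..1}. switching \<eta> t * r \<le> switching \<eta> t * v t" for t
  proof -
    let ?H = "\<lambda>r. hamiltonian c1 c2 cs ys N (\<lambda>k. x k t) r (\<lambda>k. psi \<eta> k t)"
    have "?H (u t) = h" using ham[OF t, of "u t"] ht uvt by simp
    moreover have "Sup (?H ` {w..1}) = ?H (u t)"
    proof (rule cSup_eq_maximum)
      show "?H (u t) \<in> ?H ` {w..1}" using admD(2)[OF v t] uvt by simp
      fix s assume "s \<in> ?H ` {w..1}"
      then show "s \<le> ?H (u t)" using ham[OF t] mt uvt by force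
    qed
    ultimately show ?thesis unfolding max_hamiltonian_def by simp
  qed
  have mem: "AE t in lebesgue_on S. t \<in> {t0..t1}" if "S \<subseteq> {t0..t1}" for S
    using that by (intro AE_I2) (auto simp: space_restrict_space)
  show ?thesis
  proof (intro exI[of _ "psi \<eta>"] conjI ballI allI, goal_cases)
    case (1 k i)
    then show ?case using psi_weak by blast
  next
    case (2 k)
    have sub: "crossing_free t0 t1 (that k) \<subseteq> {t0<..<t1}" and m: "crossing_free t0 t1 (that k) \<in> sets lebesgue"
      unfolding crossing_free_def by auto
    show ?case
    proof (intro exI[of _ "psi' \<eta> k"] conjI allI psi_weak[OF 2, THEN conjunct2], goal_cases)
      case 1
      have "AE t in lebesgue_on (crossing_free t0 t1 (that k)). u t = v t"
        by (rule AE_lebesgue_on_subset[OF uv sub m]) auto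
      moreover have "AE t in lebesgue_on (crossing_free t0 t1 (that k)). t \<in> {t0..t1}"
        using sub by (intro mem) auto
      ultimately show ?case
      proof eventually_elim
        case (elim t)
        then show ?case using x3[OF 2, of t]
          by (simp add: deriv_a_fun deriv_b_fun slope_def speed_def a_fun_def b_fun_def algebra_simps)
      qed
    qed
  next
    case (3 k)
    have "x k (that k) $ 3 = z k (that k)" if "t0 < that k" "that k < t1"
      using that by (intro x3[OF 3]) auto
    then show ?case
      unfolding speeds using psi_jump[where \<eta>=\<eta>, OF 3 _ _ \<eta>[of k]] by auto
  next
    case (4 k)
    have "x k t1 $ 3 = z k t1" using assms(1) by (intro x3[OF 4]) auto
    then show ?case unfolding speeds using psi_terminal[where \<eta>=\<eta>, OF 4 \<eta>[of k]] by simp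
  next
    case 5
    have "AE t in lebesgue_on {t0<..<t1}. t \<in> {t0..t1}" by (rule mem) auto
    moreover have "AE t in lebesgue_on {t0<..<t1}. hamil \<eta> t = h"
      by (rule AE_lebesgue_on_subset[OF h]) auto
    moreover have "AE t in lebesgue_on {t0<..<t1}. \<forall>r\<in>{w..1}. switching \<eta> t * r \<le> switching \<eta> t * v t"
      by (rule AE_lebesgue_on_subset[OF mx]) auto
    ultimately show ?case
      using uv by (intro exI[of _ h], eventually_elim) (rule pointwise)
  qed
qed

end
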